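(* Let $u(x;a,E,c)$ be a $T$-periodic traveling wave solution of the generalized Benjamin-Bona-Mahony equation as described in the context, with monodromy matrix $\mathbf{M}(\mu)$, and define $$\Delta=\frac14\left(\operatorname{tr}(\mathbf{M}_{\mu\mu}(0))-\left(\tfrac{T}{c}\right)^2\right)^2\left(2\operatorname{tr}(\mathbf{M}_{\mu\mu}(0))-\left(\tfrac{T}{c}\right)^2\right)-27\{T,M,P\}_{a,E,c}^2+6\{T,M,P\}_{a,E,c}\left(\frac{3\operatorname{tr}(\mathbf{M}_{\mu\mu}(0))}{2}-\frac{5}{6}\left(\tfrac{T}{c}\right)^2\right)\frac{T}{c}.$$ Suppose that $\{T,M,P\}_{a,E,c}\neq 0$. If $\Delta>0$, then $\operatorname{spec}(\mathcal{A})$ in a neighborhood of the origin consists of the imaginary axis with a triple covering (multiplicity three). If $\Delta<0$, then $\operatorname{spec}(\mathcal{A})$ in a neighborhood of the origin consists of the imaginary axis with multiplicity one together with two curves which are tangent to lines through the origin.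
   Context: The generalized Benjamin-Bona-Mahony (gBBM) equation is $u_t-u_{xxt}+u_x+(f(u))_x=0$ with $f\in C^2(\mathbb{R})$; let $F'=f$, $F(0)=0$. Periodic traveling waves. For $a,E\in\mathbb{R}$ and $c>1$ let $V(u;a,c)=F(u)-\frac{c-1}{2}u^2-au$. It is assumed throughout that $(a,E,c)$ lies in the interior of the set of parameters for which $V(\cdot;a,c)$ has a non-degenerate local minimum and the equation $V(\cdot;a,c)=E$ has simple roots $u_-<u_+$ with $V(\cdot;a,c)<E$ on $(u_-,u_+)$ (so $u_\pm$ are $C^1$ functions of $(a,E,c)$). Then $u(x;a,E,c)$ denotes the periodic solution of $cu_{xx}-(c-1)u+f(u)=a$, $\frac{c}{2}u_x^2+V(u;a,c)=E$, oscillating between $u_-$ and $u_+$, normalized by $u(0)=u_-$, $u_x(0)=0$; $u(x-ct;a,E,c)$ solves gBBM. Its period is $T=T(a,E,c)$, and $M(a,E,c)=\int_0^T u\,dx$, $P(a,E,c)=\frac12\int_0^T(u^2+u_x^2)\,dx$; these are $C^1$ functions of $(a,E,c)$. The bracket $\{T,M,P\}_{a,E,c}=\frac{\partial(T,M,P)}{\partial(a,E,c)}$ denotes the $3\times 3$ Jacobian determinant. Linearization. Put $\mathcal{L}=-c\partial_x^2+(c-1)-f'(u)$, $\mathcal{D}=1-\partial_x^2$, $\mathcal{A}=\mathcal{D}^{-1}\partial_x\mathcal{L}$. The spectral problem is $\partial_x\mathcal{L}v=\mu\mathcal{D}v$, $\mu\in\mathbb{C}$. It is equivalent to the system $Y_x=\mathbf{H}(x,\mu)Y$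 for $Y=(v,v_x,v_{xx})^t$ with $$\mathbf{H}(x,\mu)=\begin{pmatrix}0&1&0\\0&0&1\\-\frac1c(\mu+u_xf''(u))&\frac1c(c-1-f'(u))&\frac{\mu}{c}\end{pmatrix}.$$ Let $\Phi(x;\mu)$ be its fundamental matrix with $\Phi(0;\mu)=\mathbf{I}$. The monodromy matrix is $\mathbf{M}(\mu)=\Phi(T;\mu)$ ($\mathbf{M}_{\mu\mu}$ is its second derivative in $\mu$), and the periodic Evans function is $D(\mu,\lambda)=\det(\mathbf{M}(\mu)-\lambda\mathbf{I})$, $\mu,\lambda\in\mathbb{C}$. By definition $\mu\in\operatorname{spec}(\mathcal{A})$ iff $D(\mu,\lambda)=0$ for some $\lambda\in\mathbb{C}$ with $|\lambda|=1$, i.e. $\operatorname{spec}(\mathcal{A})=\bigcup_{\kappa\in[-\pi,\pi)}\{\mu: D(\mu,e^{i\kappa})=0\}$. The multiplicity (covering number) of $\mu$ in the spectrum is the number of $\lambda$ on the unit circle, with multiplicity, satisfying $D(\mu,\lambda)=0$. *)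

theory Defs
  imports "HOL-Analysis.Analysis" "HOL-Complex_Analysis.Complex_Analysis"
begin

section \<open>Periodic traveling waves\<close>

definition C2_real :: "(real \<Rightarrow> real) \<Rightarrow> bool" where
  "C2_real f \<longleftrightarrow> f C1_differentiable_on UNIV \<and> deriv f C1_differentiable_on UNIV"

text \<open>Parameter triples \<open>(a, E, c)\<close> are vectors \<open>p :: real^3\<close> with
  \<open>p$1 = a\<close>, \<open>p$2 = E\<close>, \<open>p$3 = c\<close>.\<close>

definition potential :: "(real \<Rightarrow> real) \<Rightarrow> real^3 \<Rightarrow> real \<Rightarrow> real" where
  "potential F p w = F w - (p$3 - 1) / 2 * w\<^sup>2 - p$1 * w"

definition well :: "(real \<Rightarrow> real) \<Rightarrow> real^3 \<Rightarrow> real \<Rightarrow> real \<Rightarrow> bool" where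
  "well F p um up \<longleftrightarrow>
     p$3 > 1 \<and>
     (\<exists>m. (\<forall>\<^sub>F w in nhds m. potential F p m \<le> potential F p w) \<and>
          deriv (deriv (potential F p)) m \<noteq> 0) \<and>
     um < up \<and>
     potential F p um = p$2 \<and> deriv (potential F p) um \<noteq> 0 \<and>
     potential F p up = p$2 \<and> deriv (potential F p) up \<noteq> 0 \<and>
     (\<forall>w\<in>{um<..<up}. potential F p w < p$2)"

definition periodic_wave ::
    "(real \<Rightarrow> real) \<Rightarrow> (real \<Rightarrow> real) \<Rightarrow> real^3 \<Rightarrow> real \<Rightarrow> real \<Rightarrow> (real \<Rightarrow> real) \<Rightarrow> bool" where
  "periodic_wave f F p um up w \<longleftrightarrow>
     (\<forall>x. w differentiable at x \<and> deriv w differentiable at x) \<and>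
     (\<forall>x. p$3 * deriv (deriv w) x - (p$3 - 1) * w x + f (w x) = p$1) \<and>
     (\<forall>x. p$3 / 2 * (deriv w x)\<^sup>2 + potential F p (w x) = p$2) \<and>
     (\<exists>t>0. \<forall>x. w (x + t) = w x) \<and>
     range w = {um..up} \<and>
     w 0 = um \<and> deriv w 0 = 0"

text \<open>The potential may have several wells on the energy level \<open>E\<close>. The wave is therefore
  followed over an open set of parameters along one continuous branch of the roots; since the roots
  are simple, such a branch is automatically \<open>C\<^sup>1\<close>.\<close>

definition wave_family ::
    "(real \<Rightarrow> real) \<Rightarrow> (real \<Rightarrow> real) \<Rightarrow> (real^3) set \<Rightarrow> (real^3 \<Rightarrow> real) \<Rightarrow> (real^3 \<Rightarrow> real) \<Rightarrow>
     (real^3 \<Rightarrow> real \<Rightarrow> real) \<Rightarrow> bool" where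
  "wave_family f F \<Omega> um up u \<longleftrightarrow>
     open \<Omega> \<and> continuous_on \<Omega> um \<and> continuous_on \<Omega> up \<and>
     (\<forall>p\<in>\<Omega>. well F p (um p) (up p) \<and> periodic_wave f F p (um p) (up p) (u p))"

definition period :: "(real \<Rightarrow> real) \<Rightarrow> real" where
  "period w = (LEAST t. 0 < t \<and> (\<forall>x. w (x + t) = w x))"

definition mass :: "(real \<Rightarrow> real) \<Rightarrow> real" where
  "mass w = integral {0..period w} w"

definition momentum :: "(real \<Rightarrow> real) \<Rightarrow> real" where
  "momentum w = 1 / 2 * integral {0..period w} (\<lambda>x. (w x)\<^sup>2 + (deriv w x)\<^sup>2)"

definition TMP_bracket :: "(real^3 \<Rightarrow> real \<Rightarrow> real) \<Rightarrow> real^3 \<Rightarrow> real" where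
  "TMP_bracket u p =
     det (jacobian (\<lambda>q. vector [period (u q), mass (u q), momentum (u q)] :: real^3) (at p))"

section \<open>Periodic Evans function\<close>

definition spectral_matrix ::
    "(real \<Rightarrow> real) \<Rightarrow> real \<Rightarrow> (real \<Rightarrow> real) \<Rightarrow> real \<Rightarrow> complex \<Rightarrow> complex^3^3" where
  "spectral_matrix f c w x \<mu> = vector
     [vector [0, 1, 0],
      vector [0, 0, 1],
      vector [- (\<mu> + of_real (deriv w x * deriv (deriv f) (w x))) / of_real c,
              of_real ((c - 1 - deriv f (w x)) / c),
              \<mu> / of_real c]]"

definition fundamental_matrix ::
    "(real \<Rightarrow> real) \<Rightarrow> real \<Rightarrow> (real \<Rightarrow> real) \<Rightarrow> (real \<Rightarrow> complex \<Rightarrow> complex^3^3) \<Rightarrow> bool" where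
  "fundamental_matrix f c w \<Phi> \<longleftrightarrow>
     (\<forall>\<mu>. \<Phi> 0 \<mu> = mat 1 \<and>
        (\<forall>x. ((\<lambda>y. \<Phi> y \<mu>) has_vector_derivative (spectral_matrix f c w x \<mu> ** \<Phi> x \<mu>)) (at x)))"

text \<open>Below, \<open>M\<close> is the monodromy matrix as a function of the spectral parameter.\<close>

definition evans :: "(complex \<Rightarrow> complex^3^3) \<Rightarrow> complex \<Rightarrow> complex \<Rightarrow> complex" where
  "evans M \<mu> \<zeta> = det (M \<mu> - mat \<zeta>)"

definition evans_spectrum :: "(complex \<Rightarrow> complex^3^3) \<Rightarrow> complex set" where
  "evans_spectrum M = {\<mu>. \<exists>\<zeta>. norm \<zeta> = 1 \<and> evans M \<mu> \<zeta> = 0}"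

text \<open>\<open>evans M \<mu>\<close> is a cubic polynomial with leading coefficient \<open>-1\<close>, so the sum is
  finite and each \<open>zorder\<close> is the multiplicity of a root.\<close>

definition spec_multiplicity :: "(complex \<Rightarrow> complex^3^3) \<Rightarrow> complex \<Rightarrow> nat" where
  "spec_multiplicity M \<mu> =
     (\<Sum>\<zeta>\<in>{\<zeta>. norm \<zeta> = 1 \<and> evans M \<mu> \<zeta> = 0}. nat (zorder (evans M \<mu>) \<zeta>))"

definition second_deriv_matrix :: "(complex \<Rightarrow> complex^3^3) \<Rightarrow> complex \<Rightarrow> complex^3^3" where
  "second_deriv_matrix M \<mu> = (\<chi> i j. deriv (deriv (\<lambda>\<nu>. M \<nu> $ i $ j)) \<mu>)"

text \<open>In the application \<open>M\<close> is real on the real axis, so the trace of its second derivative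
  at \<open>0\<close> is real and taking the real part below loses nothing. The argument \<open>B\<close> is the
  bracket of period, mass and momentum.\<close>

definition modulational_discriminant ::
    "(complex \<Rightarrow> complex^3^3) \<Rightarrow> real \<Rightarrow> real \<Rightarrow> real \<Rightarrow> real" where
  "modulational_discriminant M T c B =
     (let \<tau> = Re (trace (second_deriv_matrix M 0)) in
        1 / 4 * (\<tau> - (T / c)\<^sup>2)\<^sup>2 * (2 * \<tau> - (T / c)\<^sup>2)
        - 27 * B\<^sup>2
        + 6 * B * (3 * \<tau> / 2 - 5 / 6 * (T / c)\<^sup>2) * (T / c))"

section \<open>Spectral curves\<close>

definition imaginary_axis :: "complex set" where
  "imaginary_axis = {\<mu>. Re \<mu> = 0}"

definition regular_arc :: "complex set \<Rightarrow> (real \<Rightarrow> complex) \<Rightarrow> bool" where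
  "regular_arc \<Gamma> \<gamma> \<longleftrightarrow>
     \<Gamma> = \<gamma> ` {-1<..<1} \<and> inj_on \<gamma> {-1<..<1} \<and> \<gamma> C1_differentiable_on {-1<..<1} \<and>
     (\<forall>s\<in>{-1<..<1}. vector_derivative \<gamma> (at s) \<noteq> 0)"

definition curve_tangent_at_origin :: "complex set \<Rightarrow> complex set \<Rightarrow> bool" where
  "curve_tangent_at_origin \<Gamma> L \<longleftrightarrow>
     (\<exists>\<gamma>. regular_arc \<Gamma> \<gamma> \<and> \<gamma> 0 = 0 \<and> L = span {vector_derivative \<gamma> (at 0)})"

end

theory Submission
  imports Defs "HOL-Computational_Algebra.Fundamental_Theorem_Algebra"
begin

text \<open>
  Liouville's formula and the reflection \<open>x \<mapsto> T - x\<close> show that the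
  characteristic polynomial of the monodromy matrix is determined by its trace \<open>a(\<mu>)\<close> alone, namely
  \<open>-\<lambda>\<^sup>3 + a(\<mu>)\<lambda>\<^sup>2 - e^{\<mu>T/c} a(-\<mu>)\<lambda> + e^{\<mu>T/c}\<close>, with \<open>a(cnj \<mu>) = cnj (a(\<mu>))\<close> and \<open>a(0) = 3\<close>.
  Pairing \<open>M(\<mu>) - 1\<close> with the two conserved functionals of the linearised flow, and with the parameter derivatives
  of the wave, gives \<open>D(\<mu>, 1) = -{T,M,P} \<mu>\<^sup>3 + o(\<mu>\<^sup>3)\<close>. Putting \<open>\<lambda> = 1 + \<mu>y\<close> and dividing by \<open>\<mu>\<^sup>3\<close> leaves at
  \<open>\<mu> = 0\<close> a real cubic in \<open>y\<close> whose discriminant is \<open>\<Delta>\<close>. When \<open>\<Delta> \<noteq> 0\<close> its roots are simple and continue to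
  analytic branches \<open>\<lambda>\<^sub>j(\<mu>) = 1 + \<mu>y\<^sub>j(\<mu>)\<close>, which the map \<open>(\<mu>, \<lambda>) \<mapsto> (-cnj \<mu>, 1 / cnj \<lambda>)\<close> permutes. A branch with
  real \<open>y\<^sub>j(0)\<close> is mapped to itself, so it lies on the unit circle precisely for imaginary \<open>\<mu>\<close>; a branch with
  nonreal \<open>y\<^sub>j(0)\<close> lies on the unit circle along a curve tangent to the line where \<open>\<mu>y\<^sub>j(0)\<close> is imaginary.
\<close>

text \<open>The three factors \<mu> in D(\<mu>, 1) have two sources. The conserved functionals make
  two rows of M - 1, modulo row operations, equal to \<mu> times the integrals of v and of v (u -
  u_xx). The third factor comes from a column: both integrals and the jump of v_x over a period
  vanish on the translation mode u_x. As L u_c = -(u - u_xx), the solution started from u_x - \<mu>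
  u_c gives a column which, divided by \<mu>, tends to the functionals of -u_c; u_a and u_E fill the
  other two columns. The derivatives of (T, M, P) are the same functionals at u_a, u_E, u_c, up to a
  factor and multiples of the T row. The obstacle is regularity: f is only C^2, and the family is
  given with continuous roots only. The parameter derivatives are therefore built as solutions of
  linear equations, by variation of constants in \<open>\<Phi>\<close>, and then shown by Gronwall
  estimates to be derivatives at p. The period is differentiated through the simple zero of u_x at
  T, not through a quadrature with singular endpoints.\<close>

no_notation fps_nth (infixl "$" 75)

section \<open>Root branches of analytic cubics\<close>

text \<open>Subtracting the cubic equations at \<mu> and m leaves
  \<open>(z \<mu> - z m) * G \<mu>\<close> equal to minus the increments of the coefficients, where
  \<open>G\<close> tends to the derivative of the cubic in its root. A simple root makes this limit
  nonzero, so the difference quotient of \<open>z\<close> converges.\<close>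

lemma holomorphic_root_branch:
  fixes C2 C1 C0 z :: "complex \<Rightarrow> complex"
  assumes S: "open S"
    and C2: "C2 holomorphic_on S" and C1: "C1 holomorphic_on S" and C0: "C0 holomorphic_on S"
    and cont: "continuous_on S z"
    and root: "\<And>\<mu>. \<mu> \<in> S \<Longrightarrow> - ((z \<mu>)^3) + C2 \<mu> * (z \<mu>)^2 + C1 \<mu> * z \<mu> + C0 \<mu> = 0"
    and simple: "\<And>\<mu>. \<mu> \<in> S \<Longrightarrow> - 3 * (z \<mu>)^2 + 2 * C2 \<mu> * z \<mu> + C1 \<mu> \<noteq> 0"
  shows "z holomorphic_on S"
proof -
  have "z field_differentiable at m" if m: "m \<in> S" for m
  proof -
    define Q where "Q k \<mu> = (k \<mu> - k m) / (\<mu> - m)" for k :: "complex \<Rightarrow> complex" and \<mu>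
    define G where "G \<mu> = - ((z \<mu>)^2 + z \<mu> * z m + (z m)^2) + C2 m * (z \<mu> + z m) + C1 m" for \<mu>
    have lim: "((Q k) \<longlongrightarrow> deriv k m) (at m)" if "k holomorphic_on S" for k
      using that holomorphic_derivI[OF that S m] unfolding Q_def has_field_derivative_iff by blast
    have z: "(z \<longlongrightarrow> z m) (at m)"
      using cont S m by (simp add: continuous_on_eq_continuous_at isCont_def)
    have "(G \<longlongrightarrow> - ((z m)^2 + z m * z m + (z m)^2) + C2 m * (z m + z m) + C1 m) (at m)"
      unfolding G_def by (intro tendsto_intros z)
    then have G: "(G \<longlongrightarrow> - 3 * (z m)^2 + 2 * C2 m * z m + C1 m) (at m)"
      by (simp add: power2_eq_square algebra_simps)
    have lim2: "((\<lambda>\<mu>. - (Q C2 \<mu> * (z \<mu>)^2 + Q C1 \<mu> * z \<mu> + Q C0 \<mu>) / G \<mu>) \<longlongrightarrow>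
      - (deriv C2 m * (z m)^2 + deriv C1 m * z m + deriv C0 m) / (- 3 * (z m)^2 + 2 * C2 m * z m + C1 m)) (at m)"
      by (intro tendsto_intros z G lim C2 C1 C0 simple m)
    have ev: "\<forall>\<^sub>F \<mu> in at m. \<mu> \<in> S \<and> \<mu> \<noteq> m \<and> G \<mu> \<noteq> 0"
      using tendsto_imp_eventually_ne[OF G simple[OF m]] eventually_at_in_open'[OF S m]
      by (auto simp: eventually_conj_iff eventually_at_filter)
    have "\<forall>\<^sub>F \<mu> in at m. - (Q C2 \<mu> * (z \<mu>)^2 + Q C1 \<mu> * z \<mu> + Q C0 \<mu>) / G \<mu> = (z \<mu> - z m) / (\<mu> - m)"
      using ev
    proof eventually_elim
      case (elim \<mu>)
      have "(z \<mu> - z m) * G \<mu> = - ((C2 \<mu> - C2 m) * (z \<mu>)^2 + (C1 \<mu> - C1 m) * z \<mu> + (C0 \<mu> - C0 m))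
          + (- ((z \<mu>)^3) + C2 \<mu> * (z \<mu>)^2 + C1 \<mu> * z \<mu> + C0 \<mu>) - (- ((z m)^3) + C2 m * (z m)^2 + C1 m * z m + C0 m)"
        unfolding G_def by algebra
      also have "\<dots> = - ((C2 \<mu> - C2 m) * (z \<mu>)^2 + (C1 \<mu> - C1 m) * z \<mu> + (C0 \<mu> - C0 m))"
        using root elim m by simp
      finally have e: "(z \<mu> - z m) * G \<mu> = - ((C2 \<mu> - C2 m) * (z \<mu>)^2 + (C1 \<mu> - C1 m) * z \<mu> + (C0 \<mu> - C0 m))" .
      have "- (Q C2 \<mu> * (z \<mu>)^2 + Q C1 \<mu> * z \<mu> + Q C0 \<mu>)
          = - ((C2 \<mu> - C2 m) * (z \<mu>)^2 + (C1 \<mu> - C1 m) * z \<mu> + (C0 \<mu> - C0 m)) / (\<mu> - m)"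
        using elim by (simp add: Q_def divide_simps)
      also have "\<dots> = (z \<mu> - z m) * G \<mu> / (\<mu> - m)" using e by simp
      finally show ?case using elim by simp
    qed
    then have "((\<lambda>\<mu>. (z \<mu> - z m) / (\<mu> - m)) \<longlongrightarrow>
      - (deriv C2 m * (z m)^2 + deriv C1 m * z m + deriv C0 m) / (- 3 * (z m)^2 + 2 * C2 m * z m + C1 m)) (at m)"
      using lim2 by (rule Lim_transform_eventually[rotated])
    then show ?thesis
      unfolding field_differentiable_def has_field_derivative_iff by blast
  qed
  then show ?thesis
    by (simp add: holomorphic_on_def field_differentiable_at_within)
qed

text \<open>Vieta by divided differences: the difference of two root equations cancels
  \<open>a - b\<close>, and the difference of two of the resulting quadratics cancels
  \<open>b - c\<close>.\<close>

lemma cubic_factorization: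
  fixes C2 C1 C0 a b c :: "'a :: idom"
  assumes "a \<noteq> b" "a \<noteq> c" "b \<noteq> c"
    and a: "- (a^3) + C2 * a^2 + C1 * a + C0 = 0"
    and b: "- (b^3) + C2 * b^2 + C1 * b + C0 = 0"
    and c: "- (c^3) + C2 * c^2 + C1 * c + C0 = 0"
  shows "C2 = a + b + c" "C1 = - (a * b + a * c + b * c)" "C0 = a * b * c"
proof -
  have "(a - b) * (- (a^2 + a * b + b^2) + C2 * (a + b) + C1) = 0" using a b by algebra
  then have ab: "- (a^2 + a * b + b^2) + C2 * (a + b) + C1 = 0" using assms by simp
  have "(a - c) * (- (a^2 + a * c + c^2) + C2 * (a + c) + C1) = 0" using a c by algebra
  then have ac: "- (a^2 + a * c + c^2) + C2 * (a + c) + C1 = 0" using assms by simp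
  have "(b - c) * (C2 - (a + b + c)) = 0" using ab ac by algebra
  then show C2: "C2 = a + b + c" using assms by simp
  show C1: "C1 = - (a * b + a * c + b * c)" using ab C2 by algebra
  show "C0 = a * b * c" using a C2 C1 by algebra
qed

text \<open>In modulus, the value at \<open>y\<close> is the product of the distances from
  \<open>y\<close> to the three roots; were all of them at least \<open>e\<close>, the product would
  be at least \<open>e^3\<close>.\<close>

lemma cubic_root_nearby:
  fixes C2 C1 C0 y :: complex
  assumes e: "e > 0" and small: "norm (- (y^3) + C2 * y^2 + C1 * y + C0) < e^3"
  obtains r where "- (r^3) + C2 * r^2 + C1 * r + C0 = 0" "norm (r - y) < e"
proof -
  let ?p = "[:- C0, - C1, - C2, 1:]"
  have "?p \<noteq> 0" "degree ?p = 3" by auto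
  then obtain A where A: "size A = 3" "?p = smult (lead_coeff ?p) (\<Prod>x\<in>#A. [:- x, 1:])"
    using alg_closed_imp_factorization[of ?p] by metis
  obtain r1 A1 where A1: "A = add_mset r1 A1" "size A1 = 2"
    using A(1) size_eq_Suc_imp_eq_union[of A 2] by auto
  then obtain r2 A2 where A2: "A1 = add_mset r2 A2" "size A2 = 1"
    using size_eq_Suc_imp_eq_union[of A1 1] by auto
  then obtain r3 where "A2 = {#r3#}" using size_1_singleton_mset by blast
  then have "A = {#r1, r2, r3#}" using A1 A2 by simp
  with A have p: "?p = [:- r1, 1:] * [:- r2, 1:] * [:- r3, 1:]" by (simp add: algebra_simps)
  have ev: "- (z^3) + C2 * z^2 + C1 * z + C0 = - ((z - r1) * (z - r2) * (z - r3))" for z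
  proof -
    have "poly ?p z = (z - r1) * (z - r2) * (z - r3)" unfolding p by (simp add: algebra_simps)
    then show ?thesis by (simp add: algebra_simps power2_eq_square power3_eq_cube)
  qed
  have "norm (r1 - y) < e \<or> norm (r2 - y) < e \<or> norm (r3 - y) < e"
  proof (rule ccontr)
    assume "\<not> ?thesis"
    then have "e \<le> norm (y - r1)" "e \<le> norm (y - r2)" "e \<le> norm (y - r3)"
      by (auto simp: norm_minus_commute)
    then have "e * e * e \<le> norm (y - r1) * norm (y - r2) * norm (y - r3)"
      using e by (intro mult_mono) auto
    then show False using small unfolding ev by (simp add: norm_mult power3_eq_cube)
  qed
  then show ?thesis using that[of r1] that[of r2] that[of r3] unfolding ev by auto
qed

text \<open>The branches come from choice: \<open>z j \<mu>\<close> is some root close to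
  \<open>y j\<close>. Separation of the \<open>y j\<close> makes it the only one, which gives
  continuity and then holomorphy.\<close>

lemma cubic_root_branches:
  fixes C2 C1 C0 :: "complex \<Rightarrow> complex"
  assumes R: "R > 0"
    and hol: "C2 holomorphic_on ball 0 R" "C1 holomorphic_on ball 0 R" "C0 holomorphic_on ball 0 R"
    and fac: "\<And>z. - (z^3) + C2 0 * z^2 + C1 0 * z + C0 0 = - ((z - y 1) * (z - y 2) * (z - y (3::nat)))"
    and dist: "y 1 \<noteq> y 2" "y 1 \<noteq> y 3" "y 2 \<noteq> y 3"
    and d: "d > 0"
  obtains r z where "0 < r" "r \<le> R" "\<And>j. j \<in> {1,2,3::nat} \<Longrightarrow> z j holomorphic_on ball 0 r"
    "\<And>j. j \<in> {1,2,3} \<Longrightarrow> z j 0 = y j"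
    "\<And>j \<mu>. j \<in> {1,2,3} \<Longrightarrow> \<mu> \<in> ball 0 r \<Longrightarrow> norm (z j \<mu> - y j) < d"
    "\<And>\<mu> w. \<mu> \<in> ball 0 r \<Longrightarrow>
       - (w^3) + C2 \<mu> * w^2 + C1 \<mu> * w + C0 \<mu> = - ((w - z 1 \<mu>) * (w - z 2 \<mu>) * (w - z 3 \<mu>))"
proof -
  define q where "q \<mu> w = - (w^3) + C2 \<mu> * w^2 + C1 \<mu> * w + C0 \<mu>" for \<mu> w
  \<comment> \<open>At most half of every separation, so the open e-balls around the
    \<open>y j\<close> are disjoint and each contains exactly one root.\<close>
  define e where "e = Min {d, norm (y 1 - y 2) / 2, norm (y 1 - y 3) / 2, norm (y 2 - y 3) / 2}"
  have e: "e > 0" "e \<le> d" "2 * e \<le> norm (y 1 - y 2)" "2 * e \<le> norm (y 1 - y 3)" "2 * e \<le> norm (y 2 - y 3)"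
    using d dist by (auto simp: e_def min_def)
  have esep: "2 * e \<le> norm (y i - y j)" if "i \<in> {1,2,3}" "j \<in> {1,2,3}" "i \<noteq> j" for i j
    using that e by (auto simp: norm_minus_commute)
  have qcont: "continuous (at \<mu>) (\<lambda>\<nu>. q \<nu> w)" if "\<mu> \<in> ball 0 R" for \<mu> w
    unfolding q_def using that hol[THEN holomorphic_on_imp_continuous_on]
    by (intro continuous_intros) (auto simp: continuous_on_eq_continuous_at)
  have small: "\<forall>\<^sub>F \<nu> in nhds \<mu>. norm (q \<nu> w) < s^3" if "\<mu> \<in> ball 0 R" "q \<mu> w = 0" "s > 0" for \<mu> w s
  proof -
    have "((\<lambda>\<nu>. norm (q \<nu> w)) \<longlongrightarrow> norm (q \<mu> w)) (nhds \<mu>)"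
      using qcont[OF that(1), of w, unfolded isCont_def]
      by (intro tendsto_norm) (subst (asm) tendsto_at_iff_tendsto_nhds)
    then show ?thesis using that by (intro order_tendstoD) auto
  qed
  have q0: "q 0 (y j) = 0" if "j \<in> {1,2,3}" for j
    using that unfolding q_def fac by auto
  have "\<forall>\<^sub>F \<nu> in nhds 0. \<forall>j\<in>{1,2,3}. norm (q \<nu> (y j)) < e^3"
    using small[of 0] q0 R e by (intro eventually_ball_finite ballI) auto
  then obtain r0 where r0: "r0 > 0" "\<And>\<nu> j. norm \<nu> < r0 \<Longrightarrow> j \<in> {1,2,3} \<Longrightarrow> norm (q \<nu> (y j)) < e^3"
    unfolding eventually_nhds_metric by (auto simp: dist_norm)
  define r where "r = min r0 R"
  have r: "0 < r" "r \<le> R" "r \<le> r0" using r0 R by (auto simp: r_def)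
  define z where "z j \<mu> = (SOME w. q \<mu> w = 0 \<and> norm (w - y j) < e)" for j \<mu>
  have z: "q \<mu> (z j \<mu>) = 0 \<and> norm (z j \<mu> - y j) < e" if "\<mu> \<in> ball 0 r" "j \<in> {1,2,3}" for \<mu> j
  proof -
    have "norm (q \<mu> (y j)) < e^3" using that r r0 by auto
    then obtain w where "q \<mu> w = 0" "norm (w - y j) < e"
      using cubic_root_nearby[OF e(1)] unfolding q_def by metis
    then show ?thesis unfolding z_def by (rule_tac someI2[where a = w]) auto
  qed
  have zne: "z i \<mu> \<noteq> z j \<mu>" if "\<mu> \<in> ball 0 r" "i \<in> {1,2,3}" "j \<in> {1,2,3}" "i \<noteq> j" for \<mu> i j
  proof
    assume "z i \<mu> = z j \<mu>"
    then have "norm (y i - y j) < e + e"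
      using z[OF that(1,2)] z[OF that(1,3)] norm_diff_triangle_less[of "y i" "z i \<mu>" e "y j" e]
      by (auto simp: norm_minus_commute)
    then show False using esep[OF that(2-4)] by simp
  qed
  have qf: "q \<mu> w = - ((w - z 1 \<mu>) * (w - z 2 \<mu>) * (w - z 3 \<mu>))" if "\<mu> \<in> ball 0 r" for \<mu> w
  proof -
    have "z 1 \<mu> \<noteq> z 2 \<mu>" "z 1 \<mu> \<noteq> z 3 \<mu>" "z 2 \<mu> \<noteq> z 3 \<mu>" using zne[OF that] by auto
    note cubic_factorization[OF this z[OF that, THEN conjunct1, unfolded q_def] z[OF that, THEN conjunct1, unfolded q_def] z[OF that, THEN conjunct1, unfolded q_def]]
    from this[simplified] show ?thesis unfolding q_def One_nat_def by algebra
  qed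
  have uniq: "w = z j \<mu>" if "\<mu> \<in> ball 0 r" "j \<in> {1,2,3}" "q \<mu> w = 0" "norm (w - y j) < e" for \<mu> j w
  proof -
    have "w = z 1 \<mu> \<or> w = z 2 \<mu> \<or> w = z 3 \<mu>" using qf[OF that(1), of w] that(3) by auto
    then obtain i where i: "i \<in> {1,2,3}" "w = z i \<mu>" by blast
    have "i = j"
    proof (rule ccontr)
      assume "i \<noteq> j"
      have "norm (y i - y j) < e + e"
        using z[OF that(1) i(1)] that(4) norm_diff_triangle_less[of "y i" w e "y j" e] i(2)
        by (auto simp: norm_minus_commute)
      then show False using esep[OF i(1) that(2) \<open>i \<noteq> j\<close>] by simp
    qed
    with i show ?thesis by simp
  qed
  have cont: "continuous_on (ball 0 r) (z j)" if j: "j \<in> {1,2,3}" for j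
  proof -
    have "(z j \<longlongrightarrow> z j m) (at m)" if m: "m \<in> ball 0 r" for m
    proof (rule tendstoI)
      fix s :: real assume s: "s > 0"
      \<comment> \<open>A root within \<open>t\<close> of \<open>z j m\<close> is still within
        \<open>e\<close> of \<open>y j\<close>, where uniqueness identifies it as
        \<open>z j \<nu>\<close>.\<close>
      define t where "t = min s (e - norm (z j m - y j))"
      have t: "t > 0" "t \<le> s" "t \<le> e - norm (z j m - y j)" using s z[OF m j] by (auto simp: t_def)
      have "m \<in> ball 0 R" using m r by auto
      then have "\<forall>\<^sub>F \<nu> in nhds m. norm (q \<nu> (z j m)) < t^3"
        using small z[OF m j] t by auto
      then have "\<forall>\<^sub>F \<nu> in at m. norm (q \<nu> (z j m)) < t^3"
        by (simp add: eventually_at_filter eventually_mono)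
      moreover have "\<forall>\<^sub>F \<nu> in at m. \<nu> \<in> ball 0 r" using m by (intro eventually_at_in_open') auto
      ultimately show "\<forall>\<^sub>F \<nu> in at m. dist (z j \<nu>) (z j m) < s"
      proof eventually_elim
        case (elim \<nu>)
        then obtain w where w: "q \<nu> w = 0" "norm (w - z j m) < t"
          using cubic_root_nearby[OF t(1)] unfolding q_def by metis
        have "norm (w - y j) \<le> norm (w - z j m) + norm (z j m - y j)"
          using norm_triangle_ineq[of "w - z j m" "z j m - y j"] by simp
        then have "norm (w - y j) < e" using w t by linarith
        then have "w = z j \<nu>" using uniq elim j w by blast
        then show ?case using w t by (simp add: dist_norm)
      qed
    qed
    then show ?thesis by (simp add: continuous_on_eq_continuous_at isCont_def)
  qed
  have "z j holomorphic_on ball 0 r" if j: "j \<in> {1,2,3}" for j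
  proof (rule holomorphic_root_branch)
    show "open (ball (0::complex) r)" "continuous_on (ball 0 r) (z j)" using cont j by auto
    show "C2 holomorphic_on ball 0 r" "C1 holomorphic_on ball 0 r" "C0 holomorphic_on ball 0 r"
      using hol r by (auto elim!: holomorphic_on_subset)
    fix \<mu> :: complex assume m: "\<mu> \<in> ball 0 r"
    show "- (z j \<mu> ^ 3) + C2 \<mu> * (z j \<mu>)\<^sup>2 + C1 \<mu> * z j \<mu> + C0 \<mu> = 0"
      using z[OF m j] by (simp add: q_def)
    have ne: "z 1 \<mu> \<noteq> z 2 \<mu>" "z 1 \<mu> \<noteq> z 3 \<mu>" "z 2 \<mu> \<noteq> z 3 \<mu>" using zne[OF m] by auto
    note c = cubic_factorization[OF ne z[OF m, THEN conjunct1, unfolded q_def] z[OF m, THEN conjunct1, unfolded q_def] z[OF m, THEN conjunct1, unfolded q_def], simplified]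
    have "- 3 * (z 1 \<mu>)^2 + 2 * C2 \<mu> * z 1 \<mu> + C1 \<mu> = - ((z 1 \<mu> - z 2 \<mu>) * (z 1 \<mu> - z 3 \<mu>))"
      "- 3 * (z 2 \<mu>)^2 + 2 * C2 \<mu> * z 2 \<mu> + C1 \<mu> = - ((z 2 \<mu> - z 1 \<mu>) * (z 2 \<mu> - z 3 \<mu>))"
      "- 3 * (z 3 \<mu>)^2 + 2 * C2 \<mu> * z 3 \<mu> + C1 \<mu> = - ((z 3 \<mu> - z 1 \<mu>) * (z 3 \<mu> - z 2 \<mu>))"
      unfolding c One_nat_def by (simp_all add: algebra_simps power2_eq_square)
    with ne j show "- 3 * (z j \<mu>)\<^sup>2 + 2 * C2 \<mu> * z j \<mu> + C1 \<mu> \<noteq> 0" by auto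
  qed
  moreover have "z j 0 = y j" if "j \<in> {1,2,3}" for j
    using uniq[of 0 j "y j"] that r e q0 by auto
  moreover have "norm (z j \<mu> - y j) < d" if "j \<in> {1,2,3}" "\<mu> \<in> ball 0 r" for j \<mu>
    using z[OF that(2,1)] e by simp
  ultimately show ?thesis using r qf unfolding q_def by (intro that[of r z]) auto
qed

section \<open>Real cubics and the sign of their discriminant\<close>

lemma real_cubic_has_root:
  fixes b2 b1 b0 :: real
  obtains y where "- (y^3) + b2 * y^2 + b1 * y + b0 = 0"
proof -
  \<comment> \<open>Chosen so that \<open>K^3\<close> is \<open>K^2\<close> times one plus the sum
    of the absolute coefficients, which dominates all lower terms at K and at -K.\<close>
  define K where "K = 1 + \<bar>b2\<bar> + \<bar>b1\<bar> + \<bar>b0\<bar>"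
  define h where "h y = - (y^3) + b2 * y^2 + b1 * y + b0" for y
  have K1: "K \<ge> 1" by (simp add: K_def)
  then have "1 * K \<le> K * K" by (intro mult_right_mono) auto
  with K1 have K: "K \<ge> 1" "K * K \<ge> K" "K * K \<ge> 1" by linarith+
  have "\<bar>b2 * K^2\<bar> \<le> \<bar>b2\<bar> * K^2" "\<bar>b1 * K\<bar> \<le> \<bar>b1\<bar> * K^2" "\<bar>b0\<bar> \<le> \<bar>b0\<bar> * K^2"
    using K by (auto simp: abs_mult power2_eq_square intro!: mult_left_mono mult_le_cancel_left1[THEN iffD2])
  moreover have "K^3 = K^2 + \<bar>b2\<bar> * K^2 + \<bar>b1\<bar> * K^2 + \<bar>b0\<bar> * K^2"
    by (simp add: power3_eq_cube power2_eq_square K_def algebra_simps)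
  moreover have "K^2 > 0" using K by simp
  moreover have "h K = - (K^3) + b2 * K^2 + b1 * K + b0" "h (-K) = K^3 + b2 * K^2 - b1 * K + b0"
    by (simp_all add: h_def power3_eq_cube)
  ultimately have "h K \<le> 0" "h (-K) \<ge> 0" by linarith+
  moreover have "\<forall>x. isCont h x" unfolding h_def by auto
  ultimately obtain y where "h y = 0"
    using IVT2[of h K 0 "-K"] K by auto
  then show ?thesis using that by (auto simp: h_def)
qed

text \<open>\<open>D\<close> is the discriminant of the cubic. Once a real root \<open>y\<close> is
  split off, its sign is decided by the remaining quadratic \<open>z^2 + s z + t\<close>.\<close>

lemma real_cubic_roots:
  fixes b2 b1 b0 :: real
  defines "D \<equiv> b2\<^sup>2 * b1\<^sup>2 + 4 * b1^3 - 4 * b2^3 * b0 - 27 * b0\<^sup>2 - 18 * b2 * b1 * b0"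
  shows "D > 0 \<Longrightarrow> \<exists>y1 y2 y3 :: real. y1 \<noteq> y2 \<and> y1 \<noteq> y3 \<and> y2 \<noteq> y3 \<and>
     (\<forall>z::complex. - (z^3) + b2 * z^2 + b1 * z + b0 = - ((z - y1) * (z - y2) * (z - y3)))"
   and "D < 0 \<Longrightarrow> \<exists>(y1::real) w. Im w \<noteq> 0 \<and>
     (\<forall>z::complex. - (z^3) + b2 * z^2 + b1 * z + b0 = - ((z - y1) * (z - w) * (z - cnj w)))"
proof -
  obtain y where y: "- (y^3) + b2 * y^2 + b1 * y + b0 = 0" by (rule real_cubic_has_root)
  define s where "s = y - b2"
  define t where "t = y^2 - b2 * y - b1"
  have b: "b2 = y - s" "b1 = s * y - t" "b0 = t * y"
    using y by (auto simp: s_def t_def power2_eq_square power3_eq_cube algebra_simps)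
  \<comment> \<open>The discriminant of the quadratic factor times the square of the value of that
    factor at \<open>y\<close>; the latter is nonzero exactly when \<open>y\<close> is a simple
    root.\<close>
  have D: "D = (s\<^sup>2 - 4 * t) * (y\<^sup>2 + s * y + t)\<^sup>2"
    unfolding D_def b by algebra
  have fac: "- (z^3) + b2 * z^2 + b1 * z + b0 = - ((z - y) * (z^2 + s * z + t))" for z :: complex
    unfolding b by (simp add: algebra_simps power2_eq_square power3_eq_cube)
  show "\<exists>y1 y2 y3 :: real. y1 \<noteq> y2 \<and> y1 \<noteq> y3 \<and> y2 \<noteq> y3 \<and>
     (\<forall>z::complex. - (z^3) + b2 * z^2 + b1 * z + b0 = - ((z - y1) * (z - y2) * (z - y3)))" if "D > 0"
  proof -
    have q: "s\<^sup>2 - 4 * t > 0" "y\<^sup>2 + s * y + t \<noteq> 0"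
      using that unfolding D by (auto simp: zero_less_mult_iff)
    define r where "r = sqrt (s\<^sup>2 - 4 * t)"
    have r: "r > 0" "r^2 = s\<^sup>2 - 4 * t" using q by (auto simp: r_def)
    define y2 y3 where "y2 = (- s + r) / 2" and "y3 = (- s - r) / 2"
    have p: "s = - (y2 + y3)" "t = y2 * y3"
      using r(2) by (auto simp: y2_def y3_def field_simps power2_eq_square)
    have "(y - y2) * (y - y3) \<noteq> 0" using q(2) unfolding p by (simp add: algebra_simps power2_eq_square)
    moreover have "y2 \<noteq> y3" using r(1) by (auto simp: y2_def y3_def)
    moreover have "z^2 + s * z + t = (z - y2) * (z - y3)" for z :: complex
      unfolding p by (simp add: algebra_simps power2_eq_square)
    ultimately show ?thesis unfolding fac
      by (intro exI[of _ y] exI[of _ y2] exI[of _ y3]) (auto simp: mult.assoc)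
  qed
  show "\<exists>(y1::real) w. Im w \<noteq> 0 \<and>
     (\<forall>z::complex. - (z^3) + b2 * z^2 + b1 * z + b0 = - ((z - y1) * (z - w) * (z - cnj w)))" if "D < 0"
  proof -
    have q: "s\<^sup>2 - 4 * t < 0"
      using that unfolding D by (auto simp: mult_less_0_iff)
    define r where "r = sqrt (4 * t - s\<^sup>2)"
    have r: "r > 0" "r^2 = 4 * t - s\<^sup>2" using q by (auto simp: r_def)
    define w where "w = Complex (- s / 2) (r / 2)"
    have "w + cnj w = - s" "w * cnj w = t"
      using r(2) by (auto simp: w_def complex_eq_iff field_simps power2_eq_square)
    moreover have "(z - w) * (z - cnj w) = z^2 - (w + cnj w) * z + w * cnj w" for z :: complex
      by (simp add: algebra_simps power2_eq_square)
    ultimately have "z^2 + s * z + t = (z - w) * (z - cnj w)" for z :: complex by simp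
    moreover have "Im w \<noteq> 0" using r(1) by (auto simp: w_def)
    ultimately show ?thesis unfolding fac by (auto simp: mult.assoc)
  qed
qed

section \<open>Removable singularities and second-order limits at the origin\<close>

lemma holomorphic_removable_fill:
  fixes f :: "complex \<Rightarrow> complex"
  assumes f: "f holomorphic_on - {0}" and l: "(f \<longlongrightarrow> l) (at 0)"
  shows "(\<lambda>\<mu>. if \<mu> = 0 then l else f \<mu>) holomorphic_on UNIV"
proof -
  let ?g = "\<lambda>\<mu>. if \<mu> = 0 then l else f \<mu>"
  have hol: "?g holomorphic_on - {0}"
    using f by (rule holomorphic_transform) auto
  have "isCont ?g x" for x
  proof (cases "x = 0")
    case True
    have "(?g \<longlongrightarrow> l) (at 0)"
      by (rule Lim_transform_eventually[OF l]) (auto simp: eventually_at_filter)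
    then show ?thesis using True by (simp add: isCont_def)
  next
    case False
    then show ?thesis
      using holomorphic_on_imp_continuous_on[OF hol] continuous_on_eq_continuous_at[of "- {0}" ?g] by auto
  qed
  then show ?thesis
    using no_isolated_singularity[of UNIV ?g "{0}"] hol
    by (simp add: continuous_at_imp_continuous_on Compl_eq_Diff_UNIV)
qed

text \<open>Taylor's formula with a cubic remainder on the closed unit disc, where the continuous
  third derivative is bounded.\<close>

lemma second_order_limit:
  fixes h h1 h2 :: "complex \<Rightarrow> complex"
  assumes d: "\<And>\<mu>. (h has_field_derivative h1 \<mu>) (at \<mu>)" "\<And>\<mu>. (h1 has_field_derivative h2 \<mu>) (at \<mu>)"
    and z: "h 0 = 0" "h1 0 = 0"
  shows "((\<lambda>\<mu>. h \<mu> / \<mu>^2) \<longlongrightarrow> h2 0 / 2) (at 0)"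
proof -
  have "h holomorphic_on UNIV" using d(1) by (auto simp: holomorphic_on_def field_differentiable_def)
  moreover have h12: "h1 = deriv h" "h2 = deriv h1" using DERIV_imp_deriv[OF d(1)] DERIV_imp_deriv[OF d(2)] by auto
  ultimately have h2: "h2 holomorphic_on UNIV" by (simp add: holomorphic_deriv)
  have h3: "(h2 has_field_derivative deriv h2 \<mu>) (at \<mu>)" "continuous_on S (deriv h2)" for \<mu> S
    using h2 holomorphic_derivI[of h2 UNIV \<mu>] holomorphic_deriv[of h2 UNIV]
    by (auto intro: holomorphic_on_imp_continuous_on continuous_on_subset)
  have "bounded (deriv h2 ` cball 0 1)"
    by (intro compact_imp_bounded compact_continuous_image h3) auto
  then obtain B where "\<forall>x \<in> deriv h2 ` cball 0 1. norm x \<le> B" unfolding bounded_iff by blast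
  then have B: "norm (deriv h2 x) \<le> B" if "norm x \<le> 1" for x using that by simp
  have bd: "norm (h z - h2 0 / 2 * z^2) \<le> B * norm z ^ 3 / 2" if "norm z \<le> 1" for z
  proof -
    let ?f = "\<lambda>i. [h, h1, h2, deriv h2] ! i"
    have "cmod (?f 0 z - (\<Sum>i\<le>2. ?f i 0 * (z - 0) ^ i / fact i)) \<le> B * cmod (z - 0) ^ Suc 2 / fact 2"
    proof (rule complex_Taylor[of "cball 0 1"])
      fix i :: nat and x :: complex assume "x \<in> cball 0 1" "i \<le> 2"
      then have "i = 0 \<or> i = 1 \<or> i = 2" by auto
      then show "(?f i has_field_derivative ?f (Suc i) x) (at x within cball 0 1)"
        using d h3(1) by (elim disjE) (simp_all add: has_field_derivative_at_within numeral_2_eq_2)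
    qed (use that B in \<open>simp_all add: numeral_2_eq_2\<close>)
    then show ?thesis using z by (simp add: numeral_2_eq_2 numeral_3_eq_3)
  qed
  have "((\<lambda>\<mu>. h \<mu> / \<mu>^2 - h2 0 / 2) \<longlongrightarrow> 0) (at 0)"
  proof (rule Lim_null_comparison[where g = "\<lambda>\<mu>. B / 2 * norm \<mu>"])
    have "\<forall>\<^sub>F \<mu> in at 0. norm \<mu> < (1::real) \<and> \<mu> \<noteq> (0::complex)"
      unfolding eventually_at by (intro exI[of _ 1]) auto
    then show "\<forall>\<^sub>F \<mu> in at 0. norm (h \<mu> / \<mu>^2 - h2 0 / 2) \<le> B / 2 * norm \<mu>"
    proof eventually_elim
      case (elim \<mu>)
      have "h \<mu> / \<mu>^2 - h2 0 / 2 = (h \<mu> - h2 0 / 2 * \<mu>^2) / \<mu>^2" using elim by (simp add: field_simps)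
      then have "norm (h \<mu> / \<mu>^2 - h2 0 / 2) = norm (h \<mu> - h2 0 / 2 * \<mu>^2) / norm \<mu>^2"
        by (simp add: norm_divide norm_power)
      also have "\<dots> \<le> (B * norm \<mu> ^ 3 / 2) / norm \<mu>^2"
        using bd elim by (intro divide_right_mono) auto
      finally show ?case using elim by (simp add: power3_eq_cube power2_eq_square)
    qed
  qed (auto intro!: tendsto_eq_intros)
  then show ?thesis by (simp add: Lim_null[symmetric])
qed

section \<open>Level sets of unit modulus as regular arcs\<close>

lemma isCont_imp_tendsto_nhds: "isCont f x \<Longrightarrow> (f \<longlongrightarrow> f x) (nhds x)"
  by (simp only: isCont_def tendsto_at_iff_tendsto_nhds[of f x])

lemma abs_mult_less_one:
  fixes q x :: real
  assumes "0 < q" "q \<le> 1" "\<bar>x\<bar> < 1"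
  shows "\<bar>q * x\<bar> < 1"
proof -
  have "q * \<bar>x\<bar> \<le> 1 * \<bar>x\<bar>" by (rule mult_right_mono) (use assms in auto)
  moreover have "\<bar>q * x\<bar> = q * \<bar>x\<bar>" using assms by (simp add: abs_mult)
  ultimately show ?thesis using assms(3) by linarith
qed

lemma has_vector_derivative_exp_i:
  fixes q s :: real
  shows "((\<lambda>s. exp (\<i> * complex_of_real (q * s))) has_vector_derivative
    of_real q * \<i> * exp (\<i> * complex_of_real (q * s))) (at s)"
proof -
  have "((\<lambda>z. exp (\<i> * (of_real q * z))) has_field_derivative
      of_real q * \<i> * exp (\<i> * complex_of_real (q * s))) (at (of_real s))"
    by (auto intro!: derivative_eq_intros)
  from has_vector_derivative_real_field[OF this] show ?thesis by simp
qed

lemma exp_i_real_inj: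
  fixes s t :: real
  assumes e: "exp (\<i> * complex_of_real s) = exp (\<i> * complex_of_real t)" and "\<bar>s\<bar> < 1" "\<bar>t\<bar> < 1"
  shows "s = t"
proof -
  have "\<bar>Im (\<i> * complex_of_real s) - Im (\<i> * complex_of_real t)\<bar> < 2 * pi" using assms pi_gt3 by simp
  from exp_complex_eqI[OF this e] have "\<i> * complex_of_real s = \<i> * complex_of_real t" .
  then show ?thesis by simp
qed

text \<open>An injective holomorphic \<open>l\<close> has a holomorphic inverse \<open>g\<close>, so
  near 0 the set where \<open>l\<close> has modulus one is the image under \<open>g\<close> of an
  arc of the unit circle through 1.\<close>

lemma unit_modulus_arc:
  fixes l :: "complex \<Rightarrow> complex"
  assumes r: "r > 0" and hol: "l holomorphic_on ball 0 r" and inj: "inj_on l (ball 0 r)" and l0: "l 0 = 1"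
  obtains \<Gamma> L U where "curve_tangent_at_origin \<Gamma> L" "\<Gamma> \<subseteq> ball 0 r" "0 \<in> \<Gamma>" "\<And>\<mu>. \<mu> \<in> \<Gamma> \<Longrightarrow> norm (l \<mu>) = 1"
    "open U" "0 \<in> U" "U \<subseteq> ball 0 r" "\<And>\<mu>. \<mu> \<in> U \<Longrightarrow> norm (l \<mu>) = 1 \<Longrightarrow> \<mu> \<in> \<Gamma>"
proof -
  obtain g where g: "g holomorphic_on (l ` ball 0 r)"
      "\<And>z. z \<in> ball 0 r \<Longrightarrow> deriv l z * deriv g (l z) = 1" "\<And>z. z \<in> ball 0 r \<Longrightarrow> g (l z) = z"
    using holomorphic_has_inverse[OF hol open_ball inj] by metis
  define V where "V = l ` ball 0 r"
  have V: "open V" unfolding V_def by (rule open_mapping_thm3[OF hol open_ball inj])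
  have V1: "1 \<in> V" unfolding V_def by (rule image_eqI[of _ _ 0]) (use r l0 in simp_all)
  have gV: "g v \<in> ball 0 r" "l (g v) = v" "deriv g v \<noteq> 0" if "v \<in> V" for v
  proof -
    obtain z where z: "z \<in> ball 0 r" "v = l z" using \<open>v \<in> V\<close> by (auto simp: V_def)
    have "deriv l z * deriv g v = 1" using g(2)[OF z(1)] z(2) by simp
    then show "deriv g v \<noteq> 0" by auto
    show "g v \<in> ball 0 r" "l (g v) = v" using g(3)[OF z(1)] z by simp_all
  qed
  define e where "e s = exp (\<i> * complex_of_real s)" for s
  have "isCont e 0" unfolding e_def by (intro continuous_intros)
  then have "(e \<longlongrightarrow> e 0) (nhds 0)" by (rule isCont_imp_tendsto_nhds)
  then have "(e \<longlongrightarrow> 1) (nhds 0)" by (simp add: e_def)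
  then have "\<forall>\<^sub>F s in nhds 0. e s \<in> V" using V V1 by (rule topological_tendstoD)
  then obtain q0 where q0: "q0 > 0" "\<And>s. \<bar>s\<bar> < q0 \<Longrightarrow> e s \<in> V"
    unfolding eventually_nhds_metric by (auto simp: dist_real_def)
  \<comment> \<open>\<open>q0\<close> keeps the circular arc in the range of \<open>l\<close>; the
    bound 1 makes s -> exp(i q s) injective on (-1, 1), the parameter interval prescribed by
    \<open>regular_arc\<close>.\<close>
  define q where "q = min q0 1"
  have q: "q > 0" "q \<le> 1" using q0(1) by (auto simp: q_def)
  have qV: "e s \<in> V" if "\<bar>s\<bar> < q" for s using that by (intro q0(2)) (simp add: q_def)
  define \<gamma> where "\<gamma> s = g (e (q * s))" for s
  have sV: "e (q * s) \<in> V" if "s \<in> {-1<..<1}" for s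
  proof (rule qV)
    have "q * \<bar>s\<bar> < q * 1" by (rule mult_strict_left_mono) (use that q(1) in auto)
    then show "\<bar>q * s\<bar> < q" using q(1) by (simp only: abs_mult abs_of_pos mult_1_right)
  qed
  have lg: "l (\<gamma> s) = e (q * s)" "\<gamma> s \<in> ball 0 r" if "s \<in> {-1<..<1}" for s
    using gV[OF sV[OF that]] by (auto simp: \<gamma>_def)
  define D where "D s = of_real q * \<i> * e (q * s) * deriv g (e (q * s))" for s
  have der: "(\<gamma> has_vector_derivative D s) (at s)" if "s \<in> {-1<..<1}" for s
  proof -
    have g': "(g has_field_derivative deriv g (e (q * s))) (at (e (q * s)))"
      using g(1) V sV[OF that] unfolding V_def by (rule holomorphic_derivI)
    have e': "((\<lambda>s. e (q * s)) has_vector_derivative of_real q * \<i> * e (q * s)) (at s)"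
      unfolding e_def by (rule has_vector_derivative_exp_i)
    have "\<gamma> = g \<circ> (\<lambda>s. e (q * s))" by (rule ext) (simp only: \<gamma>_def o_def)
    with field_vector_diff_chain_at[OF e' g'] show ?thesis by (simp only: D_def)
  qed
  have ce: "continuous_on S (\<lambda>s. e (q * s))" for S
    unfolding e_def by (intro continuous_intros)
  have "continuous_on {-1<..<1} (\<lambda>s. deriv g (e (q * s)))"
  proof (rule continuous_on_compose2[of V "deriv g"])
    show "continuous_on V (deriv g)"
      using g(1) V unfolding V_def by (intro holomorphic_on_imp_continuous_on holomorphic_deriv)
    show "(\<lambda>s. e (q * s)) ` {-1<..<1} \<subseteq> V" using sV by blast
  qed (rule ce)
  then have contD: "continuous_on {-1<..<1} D" unfolding D_def
    by (intro continuous_intros ce)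
  have e_inj: "s = t" if st: "e (q * s) = e (q * t)" "\<bar>s\<bar> < 1" "\<bar>t\<bar> < 1" for s t
  proof -
    have "q * s = q * t"
      using st(1) abs_mult_less_one[OF q(1,2) st(2)] abs_mult_less_one[OF q(1,2) st(3)]
      unfolding e_def by (rule exp_i_real_inj)
    then show ?thesis using q(1) by simp
  qed
  have "inj_on \<gamma> {-1<..<1}"
  proof (rule inj_onI)
    fix s t :: real assume s: "s \<in> {-1<..<1}" and t: "t \<in> {-1<..<1}" and "\<gamma> s = \<gamma> t"
    then have "e (q * s) = e (q * t)" using lg(1)[OF s] lg(1)[OF t] by simp
    then show "s = t" using s t by (intro e_inj) (auto simp: abs_less_iff)
  qed
  moreover have vd: "vector_derivative \<gamma> (at s) = D s" if "s \<in> {-1<..<1}" for s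
    using der[OF that] by (rule vector_derivative_at)
  moreover have "D s \<noteq> 0" if "s \<in> {-1<..<1}" for s
    using gV(3)[OF sV[OF that]] q by (auto simp: D_def e_def)
  ultimately have arc: "regular_arc (\<gamma> ` {-1<..<1}) \<gamma>"
    unfolding regular_arc_def C1_differentiable_on_def using der contD by (intro conjI exI[of _ D]) auto
  have g0: "\<gamma> 0 = 0" using g(3)[of 0] r l0 by (simp add: \<gamma>_def e_def)
  \<comment> \<open>For the converse inclusion: values near 1 have argument below \<open>q\<close>,
    so a value of modulus one is exp(i q s) with \<bar>s\<bar> < 1.\<close>
  have "isCont Arg 1" by (intro continuous_at_Arg) (auto simp: complex_nonpos_Reals_iff)
  then have "(Arg \<longlongrightarrow> Arg 1) (nhds 1)" by (rule isCont_imp_tendsto_nhds)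
  then have "(Arg \<longlongrightarrow> 0) (nhds 1)" by simp
  then have "\<forall>\<^sub>F v in nhds 1. \<bar>Arg v\<bar> < q" using q(1)
    by (rule order_tendstoD(2)[OF tendsto_rabs_zero])
  then have "\<forall>\<^sub>F v in nhds 1. \<bar>Arg v\<bar> < q \<and> v \<noteq> 0"
    by (rule eventually_conj) (rule t1_space_nhds, simp)
  then obtain W where W: "open W" "1 \<in> W" "\<forall>v\<in>W. \<bar>Arg v\<bar> < q \<and> v \<noteq> 0"
    unfolding eventually_nhds by (elim exE conjE) (rule that)
  define U where "U = ball 0 r \<inter> l -` W"
  have U: "open U" unfolding U_def
    using holomorphic_on_imp_continuous_on[OF hol] open_ball W(1) by (rule continuous_open_preimage)
  have U0: "0 \<in> U" "U \<subseteq> ball 0 r" using r l0 W(2) by (auto simp: U_def)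
  have in_arc: "\<mu> \<in> \<gamma> ` {-1<..<1}" if m: "\<mu> \<in> U" "norm (l \<mu>) = 1" for \<mu>
  proof -
    define s where "s = Arg (l \<mu>) / q"
    have W': "\<bar>Arg (l \<mu>)\<bar> < q" "l \<mu> \<noteq> 0" "\<mu> \<in> ball 0 r" using m(1) W(3)[rule_format, of "l \<mu>"] by (auto simp: U_def)
    have qs: "q * s = Arg (l \<mu>)" using q(1) by (simp add: s_def)
    have lm: "l \<mu> = e (q * s)"
      unfolding qs e_def by (rule Arg_eq[OF W'(2), unfolded m(2) of_real_1 mult_1])
    have "\<gamma> s = \<mu>" unfolding \<gamma>_def lm[symmetric] by (rule g(3)[OF W'(3)])
    moreover have "\<bar>s\<bar> < 1" unfolding s_def abs_divide using W'(1) q(1) by (simp only: abs_of_pos divide_less_eq_1_pos)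
    then have "s \<in> {-1<..<1}" by (simp add: abs_less_iff)
    ultimately show ?thesis by (intro image_eqI) auto
  qed
  show ?thesis
  proof (rule that)
    show "curve_tangent_at_origin (\<gamma> ` {-1<..<1}) (span {vector_derivative \<gamma> (at 0)})"
      unfolding curve_tangent_at_origin_def using arc g0 by (intro exI[of _ \<gamma>]) simp
    show "\<gamma> ` {-1<..<1} \<subseteq> ball 0 r" using lg(2) by (rule image_subsetI)
    show "0 \<in> \<gamma> ` {-1<..<1}" by (rule image_eqI[of _ _ 0]) (simp_all add: g0)
    show "norm (l \<mu>) = 1" if "\<mu> \<in> \<gamma> ` {-1<..<1}" for \<mu>
      using that lg(1) by (auto simp: e_def)
  qed (fact U U0 in_arc)+
qed

section \<open>The spectrum near the origin of a reflection-symmetric monodromy\<close>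

text \<open>The interface between the differential equation and the spectral analysis: \<tau> will
  be T/c, \<sigma> the trace of the second derivative of the monodromy at 0, \<open>a\<close> the
  trace of the monodromy and \<open>B\<close> the bracket.\<close>

locale evans_symmetric =
  fixes M :: "complex \<Rightarrow> complex^3^3" and a :: "complex \<Rightarrow> complex" and \<tau> \<sigma> B :: real
  assumes evans: "\<And>\<mu> \<zeta> :: complex. evans M \<mu> \<zeta> = - (\<zeta>^3) + a \<mu> * \<zeta>^2 - a (- \<mu>) * exp (of_real \<tau> * \<mu>) * \<zeta> + exp (of_real \<tau> * \<mu>)"
    and hol: "a holomorphic_on UNIV"
    and cnj: "\<And>\<mu>. a (cnj \<mu>) = cnj (a \<mu>)"
    and a0: "a 0 = 3"
    and a2: "deriv (deriv a) 0 = \<sigma>"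
    and lim: "((\<lambda>\<mu>. evans M \<mu> 1 / \<mu>^3) \<longlongrightarrow> - of_real B) (at 0)"
    and B: "B \<noteq> 0"
begin

text \<open>Conjugating the cubic and multiplying it by -exp(-\<tau> cnj \<mu>) produces the
  coefficients of the cubic at -cnj \<mu> in reverse order, and reversing coefficients inverts
  roots.\<close>

lemma evans_reflect:
  assumes "\<zeta> \<noteq> 0" and "evans M \<mu> \<zeta> = 0"
  shows "evans M (- cnj \<mu>) (1 / cnj \<zeta>) = 0"
proof -
  define e e' where "e = exp (of_real \<tau> * cnj \<mu>)" and "e' = exp (- (of_real \<tau> * cnj \<mu>))"
  have ee: "e * e' = 1" by (simp add: e_def e'_def exp_minus)
  have z: "cnj \<zeta> \<noteq> 0" using assms by simp
  have "cnj (evans M \<mu> \<zeta>) = 0" using assms by simp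
  then have 1: "- (cnj \<zeta>^3) + cnj (a \<mu>) * cnj \<zeta>^2 - cnj (a (- \<mu>)) * e * cnj \<zeta> + e = 0"
    unfolding evans e_def by (simp add: exp_cnj)
  have a': "a (- cnj \<mu>) = cnj (a (- \<mu>))" "a (cnj \<mu>) = cnj (a \<mu>)" using cnj[of "- \<mu>"] cnj[of \<mu>] by simp_all
  have "cnj \<zeta>^3 * evans M (- cnj \<mu>) (1 / cnj \<zeta>) = - 1 + cnj (a (- \<mu>)) * cnj \<zeta> - cnj (a \<mu>) * e' * cnj \<zeta>^2 + e' * cnj \<zeta>^3"
    unfolding evans using z by (simp add: a' e'_def field_simps power2_eq_square power3_eq_cube)
  also have "\<dots> = - e' * (- (cnj \<zeta>^3) + cnj (a \<mu>) * cnj \<zeta>^2 - cnj (a (- \<mu>)) * e * cnj \<zeta> + e)"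
    using ee by algebra
  finally show ?thesis using 1 z by simp
qed

lemma a_derivs:
  "(a has_field_derivative deriv a \<mu>) (at \<mu>)"
  "(deriv a has_field_derivative deriv (deriv a) \<mu>) (at \<mu>)"
  using hol holomorphic_derivI[of a UNIV \<mu> UNIV] holomorphic_derivI[of "deriv a" UNIV \<mu> UNIV] holomorphic_deriv[of a UNIV]
  by auto

text \<open>The linear Taylor coefficient of D(\<mu>, 1) is 2 a'(0) - 2 \<tau>, and it must vanish
  since D(\<mu>, 1) is of order \<mu>^3.\<close>

lemma deriv_a0: "deriv a 0 = \<tau>"
proof -
  have "((\<lambda>\<mu>. evans M \<mu> 1) has_field_derivative 2 * deriv a 0 - 2 * \<tau>) (at 0)"
    unfolding evans
    by (auto intro!: derivative_eq_intros DERIV_chain2[of a] a_derivs simp: a0)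
  then have "((\<lambda>\<mu>. evans M \<mu> 1 / \<mu>) \<longlongrightarrow> 2 * deriv a 0 - 2 * \<tau>) (at 0)"
    by (simp add: has_field_derivative_iff evans a0)
  moreover have "((\<lambda>\<mu>. evans M \<mu> 1 / \<mu>^3 * \<mu>^2) \<longlongrightarrow> - of_real B * 0^2) (at 0)"
    by (intro tendsto_intros lim)
  then have "((\<lambda>\<mu>. evans M \<mu> 1 / \<mu>) \<longlongrightarrow> - of_real B * 0^2) (at 0)"
    by (rule Lim_transform_eventually) (simp add: eventually_at_filter power2_eq_square power3_eq_cube)
  then have "((\<lambda>\<mu>. evans M \<mu> 1 / \<mu>) \<longlongrightarrow> 0) (at 0)" by simp
  ultimately have "2 * deriv a 0 - complex_of_real (2 * \<tau>) = 0"
    by (rule LIM_unique)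
  then show ?thesis by simp
qed

text \<open>\<open>C2\<close>, \<open>C1\<close> and \<open>C0\<close> are half the second
  \<zeta>-derivative, the first \<zeta>-derivative and the value of D(\<mu>, \<zeta>) at \<zeta> =
  1, divided by \<mu>, \<mu>^2 and \<mu>^3; the values at 0 are the limits.\<close>

definition C2 :: "complex \<Rightarrow> complex" where "C2 \<mu> = (if \<mu> = 0 then of_real \<tau> else (a \<mu> - 3) / \<mu>)"
definition C1 :: "complex \<Rightarrow> complex" where
  "C1 \<mu> = (if \<mu> = 0 then of_real ((\<sigma> - \<tau>\<^sup>2) / 2) else (- 3 + 2 * a \<mu> - a (- \<mu>) * exp (of_real \<tau> * \<mu>)) / \<mu>^2)"
definition C0 :: "complex \<Rightarrow> complex" where
  "C0 \<mu> = (if \<mu> = 0 then - of_real B else evans M \<mu> 1 / \<mu>^3)"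

lemma hol_minus: "(\<lambda>\<mu>. a (- \<mu>)) holomorphic_on S"
  using holomorphic_on_compose_gen[of uminus S a UNIV] hol by (simp add: o_def holomorphic_on_minus)

lemma hol_C: "C2 holomorphic_on UNIV" "C1 holomorphic_on UNIV" "C0 holomorphic_on UNIV"
proof -
  have h: "a holomorphic_on S" for S using hol by (rule holomorphic_on_subset) simp
  have "((\<lambda>\<mu>. (a \<mu> - 3) / \<mu>) \<longlongrightarrow> \<tau>) (at 0)"
    using a_derivs(1)[of 0] deriv_a0 by (simp add: has_field_derivative_iff a0)
  then have "(\<lambda>\<mu>. if \<mu> = 0 then of_real \<tau> else (a \<mu> - 3) / \<mu>) holomorphic_on UNIV"
    by (intro holomorphic_removable_fill holomorphic_intros h) auto
  then show "C2 holomorphic_on UNIV" unfolding C2_def[abs_def] .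
  define h1 where "h1 \<mu> = 2 * deriv a \<mu> + deriv a (- \<mu>) * exp (of_real \<tau> * \<mu>) - \<tau> * a (- \<mu>) * exp (of_real \<tau> * \<mu>)" for \<mu> :: complex
  define h2 where "h2 \<mu> = 2 * deriv (deriv a) \<mu> - deriv (deriv a) (- \<mu>) * exp (of_real \<tau> * \<mu>)
     + 2 * \<tau> * deriv a (- \<mu>) * exp (of_real \<tau> * \<mu>) - \<tau>^2 * a (- \<mu>) * exp (of_real \<tau> * \<mu>)" for \<mu> :: complex
  have "((\<lambda>\<mu>. (- 3 + 2 * a \<mu> - a (- \<mu>) * exp (of_real \<tau> * \<mu>)) / \<mu>^2) \<longlongrightarrow> h2 0 / 2) (at 0)"
  proof (rule second_order_limit)
    show "((\<lambda>\<mu>. - 3 + 2 * a \<mu> - a (- \<mu>) * exp (of_real \<tau> * \<mu>)) has_field_derivative h1 \<mu>) (at \<mu>)" for \<mu> :: complex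
      unfolding h1_def by (auto intro!: derivative_eq_intros DERIV_chain2[of a] a_derivs)
    show "(h1 has_field_derivative h2 \<mu>) (at \<mu>)" for \<mu> :: complex
      unfolding h1_def h2_def
      by (auto intro!: derivative_eq_intros DERIV_chain2[of a] DERIV_chain2[of "deriv a"] a_derivs simp: algebra_simps power2_eq_square)
  qed (simp_all add: a0 h1_def deriv_a0)
  moreover have "h2 0 = \<sigma> - \<tau>\<^sup>2" by (simp add: h2_def a0 a2 deriv_a0 power2_eq_square algebra_simps)
  ultimately have "(\<lambda>\<mu>. if \<mu> = 0 then of_real ((\<sigma> - \<tau>\<^sup>2) / 2) else (- 3 + 2 * a \<mu> - a (- \<mu>) * exp (of_real \<tau> * \<mu>)) / \<mu>^2) holomorphic_on UNIV"
    by (intro holomorphic_removable_fill holomorphic_intros h hol_minus) auto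
  then show "C1 holomorphic_on UNIV" unfolding C1_def[abs_def] .
  have "(\<lambda>\<mu>. if \<mu> = 0 then - of_real B else evans M \<mu> 1 / \<mu>^3) holomorphic_on UNIV"
    using lim by (intro holomorphic_removable_fill) (auto simp: evans intro!: holomorphic_intros h hol_minus)
  then show "C0 holomorphic_on UNIV" unfolding C0_def[abs_def] .
qed

lemma evans_scaled:
  "evans M \<mu> (1 + \<mu> * w) = \<mu>^3 * (- (w^3) + C2 \<mu> * w^2 + C1 \<mu> * w + C0 \<mu>)"
proof (cases "\<mu> = 0")
  case True
  then show ?thesis by (simp add: evans a0)
next
  case False
  then have A: "a \<mu> = 3 + \<mu> * C2 \<mu>"
    and X: "a (- \<mu>) * exp (of_real \<tau> * \<mu>) = 3 + 2 * (\<mu> * C2 \<mu>) - \<mu>^2 * C1 \<mu>"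
    by (simp_all add: C2_def C1_def field_simps)
  have "evans M \<mu> 1 = \<mu>^3 * C0 \<mu>" using False by (simp add: C0_def)
  then have E: "exp (of_real \<tau> * \<mu>) = 1 - (3 + \<mu> * C2 \<mu>) + (3 + 2 * (\<mu> * C2 \<mu>) - \<mu>^2 * C1 \<mu>) + \<mu>^3 * C0 \<mu>"
    unfolding evans X A by (simp add: algebra_simps)
  show ?thesis unfolding evans X unfolding A E by (simp add: algebra_simps power2_eq_square power3_eq_cube)
qed

text \<open>\<open>s\<close> records how complex conjugation permutes the limiting roots; the
  reflection symmetry then sends branch \<open>j\<close> to branch \<open>s j\<close>, because near
  0 a branch is determined by the limiting root it is close to.\<close>

lemma spectral_branches:
  fixes y :: "nat \<Rightarrow> complex" and s :: "nat \<Rightarrow> nat"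
  assumes fac: "\<And>z. - (z^3) + of_real \<tau> * z^2 + of_real ((\<sigma> - \<tau>\<^sup>2) / 2) * z - of_real B
      = - ((z - y 1) * (z - y 2) * (z - y 3))"
    and dist: "y 1 \<noteq> y 2" "y 1 \<noteq> y 3" "y 2 \<noteq> y 3"
    and s: "\<And>j. j \<in> {1,2,3} \<Longrightarrow> s j \<in> {1,2,3} \<and> y (s j) = cnj (y j)"
  obtains r l where "0 < r"
    "\<And>j. j \<in> {1,2,3::nat} \<Longrightarrow> l j holomorphic_on ball 0 r"
    "\<And>j. j \<in> {1,2,3} \<Longrightarrow> inj_on (l j) (ball 0 r)"
    "\<And>j. j \<in> {1,2,3} \<Longrightarrow> l j 0 = 1"
    "\<And>\<mu> \<zeta>. \<mu> \<in> ball 0 r \<Longrightarrow> evans M \<mu> \<zeta> = - ((\<zeta> - l 1 \<mu>) * (\<zeta> - l 2 \<mu>) * (\<zeta> - l 3 \<mu>))"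
    "\<And>\<mu> i j. \<mu> \<in> ball 0 r \<Longrightarrow> \<mu> \<noteq> 0 \<Longrightarrow> i \<in> {1,2,3} \<Longrightarrow> j \<in> {1,2,3} \<Longrightarrow> l i \<mu> = l j \<mu> \<Longrightarrow> i = j"
    "\<And>\<mu> j. \<mu> \<in> ball 0 r \<Longrightarrow> j \<in> {1,2,3} \<Longrightarrow> l (s j) (- cnj \<mu>) * cnj (l j \<mu>) = 1"
proof -
  \<comment> \<open>\<open>B\<close> is, up to sign, the product of the limiting roots. Nonzero
    \<open>y j\<close>, the derivative of \<open>l j\<close> at 0, is what makes the branch
    injective near 0.\<close>
  have ynz: "y j \<noteq> 0" if "j \<in> {1,2,3}" for j
    using fac[of 0] B that by auto
  define d where "d = Min {norm (y 1 - y 2), norm (y 1 - y 3), norm (y 2 - y 3)} / 2"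
  have d: "d > 0" "2 * d \<le> norm (y 1 - y 2)" "2 * d \<le> norm (y 1 - y 3)" "2 * d \<le> norm (y 2 - y 3)"
    using dist by (auto simp: d_def min_def)
  have sep: "2 * d \<le> norm (y i - y j)" if "i \<in> {1,2,3}" "j \<in> {1,2,3}" "i \<noteq> j" for i j
    using that d(2-4) by (auto simp: norm_minus_commute)
  have C: "C2 holomorphic_on ball 0 1" "C1 holomorphic_on ball 0 1" "C0 holomorphic_on ball 0 1"
    by (rule holomorphic_on_subset[OF hol_C(1)] holomorphic_on_subset[OF hol_C(2)] holomorphic_on_subset[OF hol_C(3)], simp)+
  have "- (z^3) + C2 0 * z^2 + C1 0 * z + C0 0 = - ((z - y 1) * (z - y 2) * (z - y 3))" for z
    using fac[of z] by (simp add: C2_def C1_def C0_def)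
  from cubic_root_branches[OF _ C this dist d(1)] obtain r z where r: "0 < r" "r \<le> 1"
    and z: "\<And>j. j \<in> {1,2,3::nat} \<Longrightarrow> z j holomorphic_on ball 0 r"
      "\<And>j. j \<in> {1,2,3} \<Longrightarrow> z j 0 = y j"
      "\<And>j \<mu>. j \<in> {1,2,3} \<Longrightarrow> \<mu> \<in> ball 0 r \<Longrightarrow> norm (z j \<mu> - y j) < d"
    and zf: "\<And>\<mu> w. \<mu> \<in> ball 0 r \<Longrightarrow>
       - (w^3) + C2 \<mu> * w^2 + C1 \<mu> * w + C0 \<mu> = - ((w - z 1 \<mu>) * (w - z 2 \<mu>) * (w - z 3 \<mu>))"
    using zero_less_one by metis
  define l where "l j \<mu> = 1 + \<mu> * z j \<mu>" for j \<mu>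
  have lhol: "l j holomorphic_on ball 0 r" if "j \<in> {1,2,3}" for j
    unfolding l_def by (intro holomorphic_intros z that)
  have l0: "l j 0 = 1" for j by (simp add: l_def)
  have lev: "evans M \<mu> \<zeta> = - ((\<zeta> - l 1 \<mu>) * (\<zeta> - l 2 \<mu>) * (\<zeta> - l 3 \<mu>))" if "\<mu> \<in> ball 0 r" for \<mu> \<zeta>
  proof (cases "\<mu> = 0")
    case True
    then show ?thesis unfolding l_def evans by (simp add: a0 algebra_simps power2_eq_square power3_eq_cube)
  next
    case False
    define w where "w = (\<zeta> - 1) / \<mu>"
    have w: "\<zeta> = 1 + \<mu> * w" using False by (simp add: w_def)
    show ?thesis unfolding w evans_scaled zf[OF that] l_def by algebra
  qed
  have lne: "i = j" if "\<mu> \<in> ball 0 r" "\<mu> \<noteq> 0" "i \<in> {1,2,3}" "j \<in> {1,2,3}" "l i \<mu> = l j \<mu>" for \<mu> i j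
  proof (rule ccontr)
    assume "i \<noteq> j"
    have "z i \<mu> = z j \<mu>" using that by (simp add: l_def)
    then have "norm (y i - y j) < d + d"
      using z(3)[OF that(3,1)] z(3)[OF that(4,1)] norm_diff_triangle_less[of "y i" "z i \<mu>" d "y j" d]
      by (simp add: norm_minus_commute)
    then show False using sep[OF that(3,4) \<open>i \<noteq> j\<close>] by simp
  qed
  \<comment> \<open>With l = 1 + \<mu> z, the reflected root 1 / cnj l equals 1 - cnj \<mu> cnj (z /
    l). Its scaled root is thus the conjugate of z / l, and the bound on z / l decides to which
    branch it belongs.\<close>
  have "\<forall>\<^sub>F \<mu> in nhds 0. \<forall>j\<in>{1,2,3}. l j \<mu> \<noteq> 0 \<and> norm (z j \<mu> / l j \<mu> - y j) < d"
  proof (intro eventually_ball_finite ballI)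
    fix j :: nat assume j: "j \<in> {1,2,3}"
    have zc: "isCont (z j) 0" and lc: "isCont (l j) 0"
      using holomorphic_on_imp_continuous_on[OF z(1)[OF j]] holomorphic_on_imp_continuous_on[OF lhol[OF j]] r
      by (auto simp: continuous_on_eq_continuous_at)
    have "isCont (\<lambda>\<mu>. norm (z j \<mu> / l j \<mu> - y j)) 0"
      using zc lc l0 by (intro continuous_intros) auto
    from isCont_imp_tendsto_nhds[OF this]
    have "((\<lambda>\<mu>. norm (z j \<mu> / l j \<mu> - y j)) \<longlongrightarrow> 0) (nhds 0)" using z(2)[OF j] l0 by simp
    then have "\<forall>\<^sub>F \<mu> in nhds 0. norm (z j \<mu> / l j \<mu> - y j) < d"
      using d(1) by (rule order_tendstoD(2))
    moreover have "\<forall>\<^sub>F \<mu> in nhds 0. l j \<mu> \<noteq> 0"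
      using isCont_imp_tendsto_nhds[OF lc] by (rule tendsto_imp_eventually_ne) (simp add: l0)
    ultimately show "\<forall>\<^sub>F \<mu> in nhds 0. l j \<mu> \<noteq> 0 \<and> norm (z j \<mu> / l j \<mu> - y j) < d"
      by (simp add: eventually_conj_iff)
  qed simp
  then obtain r1 where r1: "r1 > 0" "\<And>\<mu> j. norm \<mu> < r1 \<Longrightarrow> j \<in> {1,2,3} \<Longrightarrow> l j \<mu> \<noteq> 0 \<and> norm (z j \<mu> / l j \<mu> - y j) < d"
    unfolding eventually_nhds_metric dist_0_norm[symmetric] by (auto simp: dist_norm)
  have "\<exists>q. q > 0 \<and> inj_on (l j) (ball 0 q)" if j: "j \<in> {1,2,3}" for j
  proof -
    have zd: "(z j has_field_derivative deriv (z j) 0) (at 0)"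
      using z(1)[OF j] r by (intro holomorphic_derivI) auto
    have "(l j has_field_derivative y j) (at 0)"
      unfolding l_def by (auto intro!: derivative_eq_intros zd simp: z(2)[OF j])
    then have "deriv (l j) 0 \<noteq> 0" using ynz[OF j] by (simp add: DERIV_imp_deriv)
    then show ?thesis
      using has_complex_derivative_locally_invertible[OF lhol[OF j], of 0] r(1) by (metis centre_in_ball open_ball)
  qed
  then obtain q where q: "\<And>j. j \<in> {1,2,3} \<Longrightarrow> q j > 0 \<and> inj_on (l j) (ball 0 (q j))" by metis
  define R where "R = Min {r, r1, q 1, q 2, q 3}"
  have R: "R > 0" "R \<le> r" "R \<le> r1" "\<And>j. j \<in> {1,2,3} \<Longrightarrow> R \<le> q j"
    using r(1) r1(1) q by (auto simp: R_def)
  show ?thesis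
  proof (rule that[of R l])
    show "0 < R" by (rule R)
    fix j :: nat assume j: "j \<in> {1,2,3}"
    show "l j holomorphic_on ball 0 R" using lhol[OF j] R(2) by (auto elim: holomorphic_on_subset)
    show "inj_on (l j) (ball 0 R)" using q[OF j] R(4)[OF j] by (auto elim: inj_on_subset)
    show "l j 0 = 1" by (rule l0)
  next
    fix \<mu> \<zeta> :: complex assume "\<mu> \<in> ball 0 R"
    then show "evans M \<mu> \<zeta> = - ((\<zeta> - l 1 \<mu>) * (\<zeta> - l 2 \<mu>) * (\<zeta> - l 3 \<mu>))"
      using R by (intro lev) auto
  next
    fix \<mu> i j assume "\<mu> \<in> ball 0 R" "\<mu> \<noteq> 0" "i \<in> {1,2,3}" "j \<in> {1,2,3}" "l i \<mu> = l j \<mu>"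
    then show "i = j" using R lne[of \<mu> i j] by auto
  next
    fix \<mu> :: complex and j :: nat assume m: "\<mu> \<in> ball 0 R" and j: "j \<in> {1,2,3}"
    show "l (s j) (- cnj \<mu>) * cnj (l j \<mu>) = 1"
    proof (cases "\<mu> = 0")
      case True
      then show ?thesis by (simp add: l0)
    next
      case False
      have m': "\<mu> \<in> ball 0 r" "- cnj \<mu> \<in> ball 0 r" "norm \<mu> < r1" using m R by auto
      have lz: "l j \<mu> \<noteq> 0" and zl: "norm (z j \<mu> / l j \<mu> - y j) < d" using r1(2)[OF m'(3) j] by auto
      have "evans M \<mu> (l j \<mu>) = 0" using j lev[OF m'(1)] by auto
      from evans_reflect[OF lz this] have "evans M (- cnj \<mu>) (1 / cnj (l j \<mu>)) = 0" .
      then have "1 / cnj (l j \<mu>) = l 1 (- cnj \<mu>) \<or> 1 / cnj (l j \<mu>) = l 2 (- cnj \<mu>) \<or> 1 / cnj (l j \<mu>) = l 3 (- cnj \<mu>)"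
        unfolding lev[OF m'(2)] by auto
      then obtain i where i: "i \<in> {1,2,3}" "1 / cnj (l j \<mu>) = l i (- cnj \<mu>)" by blast
      have cl: "cnj (l j \<mu>) = 1 + cnj \<mu> * cnj (z j \<mu>)" by (simp add: l_def)
      have cm: "cnj \<mu> \<noteq> 0" "cnj (l j \<mu>) \<noteq> 0" using False lz by auto
      have "1 = cnj (l j \<mu>) * (1 - cnj \<mu> * z i (- cnj \<mu>))"
        using i(2) cm(2) by (simp add: l_def[of i] field_simps)
      then have "cnj \<mu> * (cnj (l j \<mu>) * z i (- cnj \<mu>) - cnj (z j \<mu>)) = 0"
        using cl by algebra
      then have "z i (- cnj \<mu>) = cnj (z j \<mu> / l j \<mu>)" using cm by (simp add: field_simps)
      then have "norm (z i (- cnj \<mu>) - y (s j)) = norm (cnj (z j \<mu> / l j \<mu> - y j))" using s[OF j] by simp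
      then have 1: "norm (z i (- cnj \<mu>) - y (s j)) < d" using zl by (simp only: complex_mod_cnj)
      have "i = s j"
      proof (rule ccontr)
        assume "i \<noteq> s j"
        have "norm (y i - y (s j)) < d + d"
          using z(3)[OF i(1) m'(2)] 1 norm_diff_triangle_less[of "y i" "z i (- cnj \<mu>)" d "y (s j)" d]
          by (simp add: norm_minus_commute)
        then show False using sep[OF i(1) _ \<open>i \<noteq> s j\<close>] s[OF j] by simp
      qed
      then show ?thesis using i(2) cm(2) by (simp add: field_simps)
    qed
  qed
qed

end

section \<open>Counting roots of the Evans function on the unit circle\<close>

lemma norm_eq_1_iff_mult_cnj: "norm z = 1 \<longleftrightarrow> z * cnj z = 1"
proof -
  have "z * cnj z = 1 \<longleftrightarrow> (norm z)\<^sup>2 = 1"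
    by (simp only: complex_norm_square[symmetric] of_real_power[symmetric] of_real_eq_1_iff)
  then show ?thesis using norm_ge_zero[of z] by (auto simp: power2_eq_1_iff)
qed

lemma spec_multiplicity_distinct:
  assumes ev: "\<And>\<zeta>. evans M \<mu> \<zeta> = - ((\<zeta> - z1) * (\<zeta> - z2) * (\<zeta> - z3))"
    and ne: "z1 \<noteq> z2" "z1 \<noteq> z3" "z2 \<noteq> z3"
  shows "spec_multiplicity M \<mu> = of_bool (norm z1 = 1) + of_bool (norm z2 = 1) + of_bool (norm z3 = 1)"
proof -
  have zo: "zorder (evans M \<mu>) w1 = 1"
    if "\<And>\<zeta>. evans M \<mu> \<zeta> = - ((\<zeta> - w1) * (\<zeta> - w2) * (\<zeta> - w3))" "w1 \<noteq> w2" "w1 \<noteq> w3" for w1 w2 w3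
    by (rule simple_zeroI[of UNIV _ "\<lambda>\<zeta>. - ((\<zeta> - w2) * (\<zeta> - w3))"])
       (use that in \<open>auto intro!: holomorphic_intros\<close>)
  have z: "zorder (evans M \<mu>) z1 = 1" "zorder (evans M \<mu>) z2 = 1" "zorder (evans M \<mu>) z3 = 1"
    using ev ne by (auto intro!: zo[of z1 z2 z3] zo[of z2 z1 z3] zo[of z3 z1 z2])
  have "{\<zeta>. norm \<zeta> = 1 \<and> evans M \<mu> \<zeta> = 0} = {\<zeta> \<in> {z1, z2, z3}. norm \<zeta> = 1}"
    using ev by auto
  then have "spec_multiplicity M \<mu> = (\<Sum>\<zeta>\<in>{\<zeta> \<in> {z1, z2, z3}. norm \<zeta> = 1}. nat (zorder (evans M \<mu>) \<zeta>))"
    by (simp only: spec_multiplicity_def)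
  also have "\<dots> = (\<Sum>\<zeta>\<in>{z1, z2, z3}. if norm \<zeta> = 1 then nat (zorder (evans M \<mu>) \<zeta>) else 0)"
    by (rule sum.inter_filter) simp
  also have "\<dots> = of_bool (norm z1 = 1) + of_bool (norm z2 = 1) + of_bool (norm z3 = 1)"
    using ne z by simp
  finally show ?thesis .
qed

text \<open>The case \<mu> = 0, where the three branches meet at 1 and the multiplicity is the order
  of one zero instead of a count of simple ones.\<close>

lemma spec_multiplicity_triple:
  assumes ev: "\<And>\<zeta>. evans M \<mu> \<zeta> = - ((\<zeta> - 1) * (\<zeta> - 1) * (\<zeta> - 1))"
  shows "spec_multiplicity M \<mu> = 3"
proof -
  have "zorder (evans M \<mu>) 1 = 3"
    by (rule zorder_eqI[of UNIV _ "\<lambda>_. -1"]) (auto simp: ev power3_eq_cube)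
  moreover have "{\<zeta>. norm \<zeta> = 1 \<and> evans M \<mu> \<zeta> = 0} = {1}" using ev by auto
  ultimately show ?thesis by (simp add: spec_multiplicity_def)
qed

section \<open>The two alternatives for the sign of the discriminant\<close>

context evans_symmetric
begin

definition disc :: real where
  "disc = 1 / 4 * (\<sigma> - \<tau>\<^sup>2)\<^sup>2 * (2 * \<sigma> - \<tau>\<^sup>2) - 27 * B\<^sup>2 + 6 * B * (3 * \<sigma> / 2 - 5 / 6 * \<tau>\<^sup>2) * \<tau>"

text \<open>The origin of the formula for \<Delta>: it is the discriminant of the limiting cubic,
  whose coefficients are -1, \<tau>, (\<sigma> - \<tau>^2) / 2 and -B.\<close>

lemma disc_cubic:
  "disc = \<tau>\<^sup>2 * ((\<sigma> - \<tau>\<^sup>2) / 2)\<^sup>2 + 4 * ((\<sigma> - \<tau>\<^sup>2) / 2)^3 - 4 * \<tau>^3 * (- B) - 27 * (- B)\<^sup>2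
     - 18 * \<tau> * ((\<sigma> - \<tau>\<^sup>2) / 2) * (- B)"
  by (simp add: disc_def field_simps power2_eq_square power3_eq_cube)

lemma spectrum_triple:
  assumes "disc > 0"
  shows "\<exists>U. open U \<and> 0 \<in> U \<and> evans_spectrum M \<inter> U = imaginary_axis \<inter> U \<and>
             (\<forall>\<mu>\<in>imaginary_axis \<inter> U. spec_multiplicity M \<mu> = 3)"
proof -
  obtain y1 y2 y3 :: real where y: "y1 \<noteq> y2" "y1 \<noteq> y3" "y2 \<noteq> y3" and
    fac: "\<And>z::complex. - (z^3) + of_real \<tau> * z^2 + of_real ((\<sigma> - \<tau>\<^sup>2) / 2) * z + of_real (- B) = - ((z - y1) * (z - y2) * (z - y3))"
    using real_cubic_roots(1)[of \<tau> "(\<sigma> - \<tau>\<^sup>2) / 2" "- B"] assms unfolding disc_cubic by metis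
  define y where "y j = complex_of_real (if j = (1::nat) then y1 else if j = 2 then y2 else y3)" for j
  have "- (z^3) + of_real \<tau> * z^2 + of_real ((\<sigma> - \<tau>\<^sup>2) / 2) * z - of_real B = - ((z - y 1) * (z - y 2) * (z - y 3))" for z
    using fac[of z] by (simp add: y_def)
  moreover have "y 1 \<noteq> y 2" "y 1 \<noteq> y 3" "y 2 \<noteq> y 3" using y by (auto simp: y_def)
  moreover have "id j \<in> {1,2,3} \<and> y (id j) = cnj (y j)" if "j \<in> {1,2,3}" for j using that by (auto simp: y_def)
  ultimately obtain r l where r: "0 < r" and
    l: "\<And>j. j \<in> {1,2,3::nat} \<Longrightarrow> inj_on (l j) (ball 0 r)"
    "\<And>j. j \<in> {1,2,3} \<Longrightarrow> l j 0 = 1"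
    "\<And>\<mu> \<zeta>. \<mu> \<in> ball 0 r \<Longrightarrow> evans M \<mu> \<zeta> = - ((\<zeta> - l 1 \<mu>) * (\<zeta> - l 2 \<mu>) * (\<zeta> - l 3 \<mu>))"
    "\<And>\<mu> i j. \<mu> \<in> ball 0 r \<Longrightarrow> \<mu> \<noteq> 0 \<Longrightarrow> i \<in> {1,2,3} \<Longrightarrow> j \<in> {1,2,3} \<Longrightarrow> l i \<mu> = l j \<mu> \<Longrightarrow> i = j"
    and sym: "\<And>\<mu> j. \<mu> \<in> ball 0 r \<Longrightarrow> j \<in> {1,2,3} \<Longrightarrow> l (id j) (- cnj \<mu>) * cnj (l j \<mu>) = 1"
    by (rule spectral_branches[of y id]) blast+
  \<comment> \<open>On the unit circle cnj l = 1 / l, so the symmetry reads l(-cnj \<mu>) =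
    l(\<mu>), and injectivity of the branch gives -cnj \<mu> = \<mu>.\<close>
  have unit: "norm (l j \<mu>) = 1 \<longleftrightarrow> Re \<mu> = 0" if m: "\<mu> \<in> ball 0 r" and j: "j \<in> {1,2,3}" for \<mu> j
  proof
    assume "norm (l j \<mu>) = 1"
    then have "l j \<mu> * cnj (l j \<mu>) = 1" by (simp only: norm_eq_1_iff_mult_cnj)
    then have "l j (- cnj \<mu>) * cnj (l j \<mu>) = l j \<mu> * cnj (l j \<mu>)" "cnj (l j \<mu>) \<noteq> 0" using sym[OF m j] by auto
    then have "l j (- cnj \<mu>) = l j \<mu>" by simp
    then have "- cnj \<mu> = \<mu>" using l(1)[OF j] m by (auto simp: inj_on_def)
    then show "Re \<mu> = 0" by (simp add: complex_eq_iff)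
  next
    assume "Re \<mu> = 0"
    then have "- cnj \<mu> = \<mu>" by (simp add: complex_eq_iff)
    then have "l j \<mu> * cnj (l j \<mu>) = 1" using sym[OF m j] by simp
    then show "norm (l j \<mu>) = 1" by (simp only: norm_eq_1_iff_mult_cnj)
  qed
  have spec: "\<mu> \<in> evans_spectrum M \<longleftrightarrow> Re \<mu> = 0" if m: "\<mu> \<in> ball 0 r" for \<mu>
    unfolding evans_spectrum_def using l(3)[OF m] unit[OF m] by auto
  have "spec_multiplicity M \<mu> = 3" if m: "\<mu> \<in> ball 0 r" "Re \<mu> = 0" for \<mu>
  proof (cases "\<mu> = 0")
    case True
    then show ?thesis using l(3)[OF m(1)] l(2) by (intro spec_multiplicity_triple) simp
  next
    case False
    then have "l 1 \<mu> \<noteq> l 2 \<mu>" "l 1 \<mu> \<noteq> l 3 \<mu>" "l 2 \<mu> \<noteq> l 3 \<mu>" using l(4)[OF m(1)] by force+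
    from spec_multiplicity_distinct[OF l(3)[OF m(1)] this] show ?thesis using unit[OF m(1)] m(2) by simp
  qed
  then show ?thesis using r spec by (intro exI[of _ "ball 0 r"]) (auto simp: imaginary_axis_def)
qed

text \<open>The real limiting root carries the imaginary axis, the conjugate pair carries the two
  curves. At 0 all three branches equal 1, hence the multiplicity claims leave out this
  point.\<close>

lemma spectrum_curves:
  assumes "disc < 0"
  shows "\<exists>U \<Gamma>1 \<Gamma>2 L1 L2. open U \<and> 0 \<in> U \<and>
             curve_tangent_at_origin \<Gamma>1 L1 \<and> curve_tangent_at_origin \<Gamma>2 L2 \<and>
             \<Gamma>1 \<inter> imaginary_axis = {0} \<and> \<Gamma>2 \<inter> imaginary_axis = {0} \<and>
             evans_spectrum M \<inter> U = (imaginary_axis \<union> \<Gamma>1 \<union> \<Gamma>2) \<inter> U \<and>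
             (\<forall>\<mu>\<in>imaginary_axis \<inter> U - {0}. spec_multiplicity M \<mu> = 1) \<and>
             (\<forall>\<mu>\<in>U - imaginary_axis.
                spec_multiplicity M \<mu> = of_bool (\<mu> \<in> \<Gamma>1) + of_bool (\<mu> \<in> \<Gamma>2))"
proof -
  obtain y1 :: real and w where w: "Im w \<noteq> 0" and
    fac: "\<And>z::complex. - (z^3) + of_real \<tau> * z^2 + of_real ((\<sigma> - \<tau>\<^sup>2) / 2) * z + of_real (- B) = - ((z - y1) * (z - w) * (z - cnj w))"
    using real_cubic_roots(2)[of \<tau> "(\<sigma> - \<tau>\<^sup>2) / 2" "- B"] assms unfolding disc_cubic by metis
  define y where "y j = (if j = (1::nat) then complex_of_real y1 else if j = 2 then w else cnj w)" for j
  define s where "s j = (if j = (1::nat) then 1 else if j = 2 then 3 else 2 :: nat)" for j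
  have "- (z^3) + of_real \<tau> * z^2 + of_real ((\<sigma> - \<tau>\<^sup>2) / 2) * z - of_real B = - ((z - y 1) * (z - y 2) * (z - y 3))" for z
    using fac[of z] by (simp add: y_def)
  moreover have "y 1 \<noteq> y 2" "y 1 \<noteq> y 3" "y 2 \<noteq> y 3" using w by (auto simp: y_def complex_eq_iff)
  moreover have "s j \<in> {1,2,3} \<and> y (s j) = cnj (y j)" if "j \<in> {1,2,3}" for j using that by (auto simp: y_def s_def)
  ultimately obtain r l where r: "0 < r" and
    l: "\<And>j. j \<in> {1,2,3::nat} \<Longrightarrow> inj_on (l j) (ball 0 r)"
    "\<And>j. j \<in> {1,2,3} \<Longrightarrow> l j 0 = 1"
    "\<And>\<mu> \<zeta>. \<mu> \<in> ball 0 r \<Longrightarrow> evans M \<mu> \<zeta> = - ((\<zeta> - l 1 \<mu>) * (\<zeta> - l 2 \<mu>) * (\<zeta> - l 3 \<mu>))"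
    "\<And>\<mu> i j. \<mu> \<in> ball 0 r \<Longrightarrow> \<mu> \<noteq> 0 \<Longrightarrow> i \<in> {1,2,3} \<Longrightarrow> j \<in> {1,2,3} \<Longrightarrow> l i \<mu> = l j \<mu> \<Longrightarrow> i = j"
    and sym: "\<And>\<mu> j. \<mu> \<in> ball 0 r \<Longrightarrow> j \<in> {1,2,3} \<Longrightarrow> l (s j) (- cnj \<mu>) * cnj (l j \<mu>) = 1"
    and lh: "\<And>j. j \<in> {1,2,3} \<Longrightarrow> l j holomorphic_on ball 0 r"
    by (rule spectral_branches[of y s]) blast+
  have unit1: "norm (l 1 \<mu>) = 1 \<longleftrightarrow> Re \<mu> = 0" if m: "\<mu> \<in> ball 0 r" for \<mu>
  proof
    assume "norm (l 1 \<mu>) = 1"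
    then have "l 1 \<mu> * cnj (l 1 \<mu>) = 1" by (simp only: norm_eq_1_iff_mult_cnj)
    moreover have "cnj (l 1 \<mu>) \<noteq> 0" using calculation by auto
    moreover have "l 1 (- cnj \<mu>) * cnj (l 1 \<mu>) = 1" using sym[OF m, of 1] by (simp add: s_def)
    ultimately have "l 1 (- cnj \<mu>) = l 1 \<mu>" by (metis mult_cancel_right)
    then have "- cnj \<mu> = \<mu>" using l(1)[of 1] m by (auto simp: inj_on_def)
    then show "Re \<mu> = 0" by (simp add: complex_eq_iff)
  next
    assume "Re \<mu> = 0"
    then have "- cnj \<mu> = \<mu>" by (simp add: complex_eq_iff)
    then show "norm (l 1 \<mu>) = 1" using sym[OF m, of 1] by (simp add: s_def norm_eq_1_iff_mult_cnj)
  qed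
  \<comment> \<open>On the axis the symmetry relates branches 2 and 3 at the same \<mu>; unit
    modulus of one would make them equal, which happens only at 0. The curves therefore meet the
    axis only there.\<close>
  have off: "\<mu> = 0" if m: "\<mu> \<in> ball 0 r" and j: "j \<in> {2,3}" and n: "norm (l j \<mu>) = 1" and "Re \<mu> = 0" for \<mu> j
  proof (rule ccontr)
    assume "\<mu> \<noteq> 0"
    have "- cnj \<mu> = \<mu>" using \<open>Re \<mu> = 0\<close> by (simp add: complex_eq_iff)
    then have "l (s j) \<mu> * cnj (l j \<mu>) = 1" using sym[OF m, of j] j by auto
    moreover have "l j \<mu> * cnj (l j \<mu>) = 1" using n by (simp only: norm_eq_1_iff_mult_cnj)
    ultimately have "l (s j) \<mu> = l j \<mu>" by (metis mult_cancel_right mult_zero_right zero_neq_one)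
    then have "s j = j" using l(4)[OF m \<open>\<mu> \<noteq> 0\<close>, of "s j" j] j by (auto simp: s_def)
    then show False using j by (auto simp: s_def)
  qed
  obtain \<Gamma>1 L1 U1 where G1: "curve_tangent_at_origin \<Gamma>1 L1" "\<Gamma>1 \<subseteq> ball 0 r" "0 \<in> \<Gamma>1"
      "\<And>\<mu>. \<mu> \<in> \<Gamma>1 \<Longrightarrow> norm (l 2 \<mu>) = 1"
    "open U1" "0 \<in> U1" "U1 \<subseteq> ball 0 r" "\<And>\<mu>. \<mu> \<in> U1 \<Longrightarrow> norm (l 2 \<mu>) = 1 \<Longrightarrow> \<mu> \<in> \<Gamma>1"
    using unit_modulus_arc[OF r lh[of 2] l(1)[of 2] l(2)[of 2]] by (metis insert_iff)
  obtain \<Gamma>2 L2 U2 where G2: "curve_tangent_at_origin \<Gamma>2 L2" "\<Gamma>2 \<subseteq> ball 0 r" "0 \<in> \<Gamma>2"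
      "\<And>\<mu>. \<mu> \<in> \<Gamma>2 \<Longrightarrow> norm (l 3 \<mu>) = 1"
    "open U2" "0 \<in> U2" "U2 \<subseteq> ball 0 r" "\<And>\<mu>. \<mu> \<in> U2 \<Longrightarrow> norm (l 3 \<mu>) = 1 \<Longrightarrow> \<mu> \<in> \<Gamma>2"
    using unit_modulus_arc[OF r lh[of 3] l(1)[of 3] l(2)[of 3]] by (metis insert_iff)
  define U where "U = U1 \<inter> U2"
  have Ur: "\<mu> \<in> ball 0 r" if "\<mu> \<in> U" for \<mu> using that G1(7) by (auto simp: U_def)
  have U1: "norm (l 2 \<mu>) = 1 \<longleftrightarrow> \<mu> \<in> \<Gamma>1" if "\<mu> \<in> U" for \<mu> using that G1(4,8) by (auto simp: U_def)
  have U2: "norm (l 3 \<mu>) = 1 \<longleftrightarrow> \<mu> \<in> \<Gamma>2" if "\<mu> \<in> U" for \<mu> using that G2(4,8) by (auto simp: U_def)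
  have spec: "\<mu> \<in> evans_spectrum M \<longleftrightarrow> Re \<mu> = 0 \<or> \<mu> \<in> \<Gamma>1 \<or> \<mu> \<in> \<Gamma>2" if m: "\<mu> \<in> U" for \<mu>
  proof -
    have "\<mu> \<in> evans_spectrum M \<longleftrightarrow> norm (l 1 \<mu>) = 1 \<or> norm (l 2 \<mu>) = 1 \<or> norm (l 3 \<mu>) = 1"
      unfolding evans_spectrum_def using l(3)[OF Ur[OF m]] by auto
    then show ?thesis using unit1[OF Ur[OF m]] U1[OF m] U2[OF m] by simp
  qed
  have mult: "spec_multiplicity M \<mu> = of_bool (Re \<mu> = 0) + of_bool (\<mu> \<in> \<Gamma>1) + of_bool (\<mu> \<in> \<Gamma>2)"
    if m: "\<mu> \<in> U" "\<mu> \<noteq> 0" for \<mu>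
  proof -
    have "l 1 \<mu> \<noteq> l 2 \<mu>" "l 1 \<mu> \<noteq> l 3 \<mu>" "l 2 \<mu> \<noteq> l 3 \<mu>" using l(4)[OF Ur[OF m(1)] m(2)] by force+
    from spec_multiplicity_distinct[OF l(3)[OF Ur[OF m(1)]] this]
    show ?thesis using unit1[OF Ur[OF m(1)]] U1[OF m(1)] U2[OF m(1)] by simp
  qed
  have i1: "\<mu> = 0" if "\<mu> \<in> \<Gamma>1" "Re \<mu> = 0" for \<mu> using off[of \<mu> 2] G1(2,4) that by auto
  have i2: "\<mu> = 0" if "\<mu> \<in> \<Gamma>2" "Re \<mu> = 0" for \<mu> using off[of \<mu> 3] G2(2,4) that by auto
  have "open U" "0 \<in> U" using G1(5,6) G2(5,6) by (auto simp: U_def)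
  moreover have "\<Gamma>1 \<inter> imaginary_axis = {0}" "\<Gamma>2 \<inter> imaginary_axis = {0}"
    using i1 i2 G1(3) G2(3) by (auto simp: imaginary_axis_def)
  moreover have "evans_spectrum M \<inter> U = (imaginary_axis \<union> \<Gamma>1 \<union> \<Gamma>2) \<inter> U"
    using spec by (auto simp: imaginary_axis_def)
  moreover have "spec_multiplicity M \<mu> = 1" if "\<mu> \<in> imaginary_axis \<inter> U - {0}" for \<mu>
  proof -
    have m: "\<mu> \<in> U" "\<mu> \<noteq> 0" "Re \<mu> = 0" using that by (auto simp: imaginary_axis_def)
    then have "\<mu> \<notin> \<Gamma>1" "\<mu> \<notin> \<Gamma>2" using i1 i2 by auto
    then show ?thesis using mult[OF m(1,2)] m(3) by simp
  qed
  moreover have "spec_multiplicity M \<mu> = of_bool (\<mu> \<in> \<Gamma>1) + of_bool (\<mu> \<in> \<Gamma>2)" if "\<mu> \<in> U - imaginary_axis" for \<mu>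
  proof -
    have m: "\<mu> \<in> U" "\<mu> \<noteq> 0" "Re \<mu> \<noteq> 0" using that by (auto simp: imaginary_axis_def)
    then show ?thesis using mult[OF m(1,2)] by simp
  qed
  ultimately show ?thesis
    using G1(1) G2(1) by (intro exI[of _ U] exI[of _ \<Gamma>1] exI[of _ \<Gamma>2] exI[of _ L1] exI[of _ L2]) simp
qed

end

section \<open>Parameter dependence of third-order linear systems\<close>

text \<open>The weighted square exp(-(2K+1)t) |y|^2 - e^2 t is nonincreasing: 2K absorbs the linear
  bound, and the extra 1 absorbs 2 |y| e \<le> |y|^2 + e^2. Working with the square avoids
  differentiating the norm at 0.\<close>

lemma gronwall:
  fixes y y' :: "real \<Rightarrow> 'a::real_inner"
  assumes K: "0 \<le> K" and e: "0 \<le> e"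
    and der: "\<And>x. x \<in> {0..b} \<Longrightarrow> (y has_vector_derivative y' x) (at x)"
    and bound: "\<And>x. x \<in> {0..b} \<Longrightarrow> norm (y' x) \<le> K * norm (y x) + e"
    and x: "x \<in> {0..b}"
  shows "norm (y x) \<le> exp ((K + 1) * b) * (norm (y 0) + (1 + b) * e)"
proof -
  define g where "g t = exp (- (2 * K + 1) * t) * (y t \<bullet> y t) - e\<^sup>2 * t" for t
  have "g x \<le> g 0"
  proof (rule DERIV_nonpos_imp_nonincreasing[where f = g and a = 0 and b = x])
    show "0 \<le> x" using x by simp
    fix t assume t: "0 \<le> t" "t \<le> x"
    then have tb: "t \<in> {0..b}" using x by simp
    have d: "(y has_derivative (\<lambda>h. h *\<^sub>R y' t)) (at t)"
      using der[OF tb] by (simp add: has_vector_derivative_def)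
    have "(g has_real_derivative exp (- (2 * K + 1) * t) * (2 * (y t \<bullet> y' t) - (2 * K + 1) * (y t \<bullet> y t)) - e\<^sup>2) (at t)"
      unfolding g_def has_field_derivative_def
      by (rule has_derivative_eq_rhs, (rule derivative_intros d)+)
         (auto simp: fun_eq_iff inner_commute algebra_simps)
    moreover have "exp (- (2 * K + 1) * t) * (2 * (y t \<bullet> y' t) - (2 * K + 1) * (y t \<bullet> y t)) - e\<^sup>2 \<le> 0"
    proof -
      have "y t \<bullet> y' t \<le> norm (y t) * (K * norm (y t) + e)"
        using norm_cauchy_schwarz[of "y t" "y' t"] mult_left_mono[OF bound[OF tb] norm_ge_zero[of "y t"]] by linarith
      moreover have "2 * (norm (y t) * e) \<le> norm (y t) * norm (y t) + e\<^sup>2"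
        using sum_squares_bound[of "norm (y t)" e] by (simp add: power2_eq_square algebra_simps)
      ultimately have "2 * (y t \<bullet> y' t) - (2 * K + 1) * (y t \<bullet> y t) \<le> e\<^sup>2"
        by (simp add: dot_square_norm power2_eq_square algebra_simps)
      then have "exp (- (2 * K + 1) * t) * (2 * (y t \<bullet> y' t) - (2 * K + 1) * (y t \<bullet> y t)) \<le> exp (- (2 * K + 1) * t) * e\<^sup>2"
        by (rule mult_left_mono) simp
      also have "\<dots> \<le> 1 * e\<^sup>2"
      proof (rule mult_right_mono)
        have "(2 * K + 1) * t \<ge> 0" using K t by simp
        then show "exp (- (2 * K + 1) * t) \<le> 1" by (simp only: mult_minus_left exp_le_one_iff neg_le_0_iff_le)
      qed simp
      finally show ?thesis by simp
    qed
    ultimately show "\<exists>d. (g has_real_derivative d) (at t) \<and> d \<le> 0" by blast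
  qed
  then have "exp (- (2 * K + 1) * x) * (norm (y x))\<^sup>2 \<le> (norm (y 0))\<^sup>2 + e\<^sup>2 * x"
    by (simp add: g_def dot_square_norm)
  then have "exp ((2 * K + 1) * x) * (exp (- (2 * K + 1) * x) * (norm (y x))\<^sup>2) \<le> exp ((2 * K + 1) * x) * ((norm (y 0))\<^sup>2 + e\<^sup>2 * x)"
    by (rule mult_left_mono) simp
  then have "(norm (y x))\<^sup>2 \<le> exp ((2 * K + 1) * x) * ((norm (y 0))\<^sup>2 + e\<^sup>2 * x)"
    by (simp only: mult.assoc[symmetric] mult_minus_left exp_minus_inverse mult_1)
  also have "\<dots> \<le> exp (2 * ((K + 1) * b)) * (norm (y 0) + (1 + b) * e)\<^sup>2"
  proof (rule mult_mono)
    have "K * x \<le> K * b" using x K by (intro mult_left_mono) auto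
    then have "(2 * K + 1) * x \<le> 2 * ((K + 1) * b)" using x by (simp add: algebra_simps)
    then show "exp ((2 * K + 1) * x) \<le> exp (2 * ((K + 1) * b))" by simp
    have "x \<le> (1 + b)\<^sup>2" using x by (simp add: power2_eq_square algebra_simps add_increasing)
    then have "e\<^sup>2 * x \<le> e\<^sup>2 * (1 + b)\<^sup>2" by (rule mult_left_mono) simp
    moreover have "0 \<le> norm (y 0) * ((1 + b) * e)" using x e by simp
    ultimately show "(norm (y 0))\<^sup>2 + e\<^sup>2 * x \<le> (norm (y 0) + (1 + b) * e)\<^sup>2"
      unfolding power2_sum power_mult_distrib using mult.commute[of "e\<^sup>2"] by (simp only: mult.assoc)
  qed (use x in auto)
  also have "\<dots> = (exp ((K + 1) * b) * (norm (y 0) + (1 + b) * e))\<^sup>2"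
    by (simp add: power_mult_distrib exp_double)
  finally show ?thesis
    by (rule power2_le_imp_le) (use x e in auto)
qed

lemma continuous_on_Icc_bounded:
  fixes f :: "real \<Rightarrow> 'a::real_normed_vector"
  assumes "continuous_on {a..b} f"
  shows "\<exists>B\<ge>0. \<forall>x\<in>{a..b}. norm (f x) \<le> B"
proof -
  have "bounded (f ` {a..b})"
    by (intro compact_imp_bounded compact_continuous_image assms compact_Icc)
  then obtain B where "\<forall>y\<in>f ` {a..b}. norm y \<le> B" unfolding bounded_iff ..
  then show ?thesis by (intro exI[of _ "\<bar>B\<bar>"]) force
qed

lemma norm_vec3_le:
  fixes v :: "'a::real_normed_vector^3"
  shows "norm v \<le> norm (v $ 1) + norm (v $ 2) + norm (v $ 3)"
proof -
  have "norm v \<le> (\<Sum>i\<in>UNIV. norm (v $ i))"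
    unfolding norm_vec_def by (rule L2_set_le_sum) simp
  then show ?thesis by (simp add: sum_3)
qed

lemma norm_scalar_mult_vec:
  fixes v :: "complex^'n"
  shows "norm (k *s v) = norm k * norm v"
  unfolding norm_vec_def by (simp add: L2_set_right_distrib norm_mult)

lemma vec3_eq_iff: "v = w \<longleftrightarrow> v $ 1 = w $ 1 \<and> v $ 2 = w $ 2 \<and> v $ (3::3) = w $ 3"
  by (simp add: vec_eq_iff forall_3)

lemma has_vector_derivative_vec3:
  fixes Y :: "real \<Rightarrow> complex^3"
  shows "(Y has_vector_derivative D) F \<longleftrightarrow>
     ((\<lambda>x. Y x $ 1) has_vector_derivative D $ 1) F \<and> ((\<lambda>x. Y x $ 2) has_vector_derivative D $ 2) F \<and>
     ((\<lambda>x. Y x $ 3) has_vector_derivative D $ 3) F" (is "?l \<longleftrightarrow> ?r")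
proof
  assume l: ?l
  have "((\<lambda>x. Y x $ i) has_vector_derivative D $ i) F" for i
    using bounded_linear.has_vector_derivative[OF bounded_linear_vec_nth l] .
  then show ?r by blast
next
  assume r: ?r
  define f :: "complex^3 \<Rightarrow> complex^3" where "f = (\<lambda>x. x)"
  have "bounded_linear (\<lambda>z::complex. axis i z :: complex^3)" for i
    unfolding linear_conv_bounded_linear[symmetric]
    by (rule linearI) (auto simp: axis_def vec_eq_iff)
  then have "((\<lambda>x. axis i (Y x $ i) :: complex^3) has_vector_derivative axis i (D $ i)) F" if "i \<in> {1,2,3}" for i
    using r that by (auto intro: bounded_linear.has_vector_derivative)
  then have "((\<lambda>x. axis 1 (Y x $ 1) + axis 2 (Y x $ 2) + axis 3 (Y x $ 3) :: complex^3)
      has_vector_derivative axis 1 (D $ 1) + axis 2 (D $ 2) + axis 3 (D $ 3)) F"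
    by (intro has_vector_derivative_add) auto
  moreover have "axis 1 (v $ 1) + axis 2 (v $ 2) + axis 3 (v $ 3) = v" for v :: "complex^3"
    by (simp add: vec3_eq_iff axis_def)
  ultimately show ?l by simp
qed

text \<open>The matrix H with q for c - 1 - f'(u) and p for u_x f''(u) as free coefficients. In the
  application p = -q', but the linear theory below does not rely on this.\<close>

definition system_matrix :: "real \<Rightarrow> real \<Rightarrow> real \<Rightarrow> complex \<Rightarrow> complex^3^3" where
  "system_matrix c q p \<mu> = vector
     [vector [0, 1, 0],
      vector [0, 0, 1],
      vector [- (\<mu> + of_real p) / of_real c, of_real (q / c), \<mu> / of_real c]]"

lemma system_matrix_mult:
  "(system_matrix c q p \<mu> *v Y) $ 1 = Y $ 2"
  "(system_matrix c q p \<mu> *v Y) $ 2 = Y $ 3"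
  "(system_matrix c q p \<mu> *v Y) $ 3 = (- (\<mu> + of_real p) * Y $ 1 + of_real q * Y $ 2 + \<mu> * Y $ 3) / of_real c"
  by (simp_all add: system_matrix_def matrix_vector_mult_def sum_3 add_divide_distrib)

definition e3 :: "complex^3" where "e3 = vector [0, 0, 1]"

lemma e3_nth: "e3 $ 1 = 0" "e3 $ 2 = 0" "e3 $ 3 = 1"
  by (simp_all add: e3_def)

lemma norm_e3: "norm e3 \<le> 1"
  using norm_vec3_le[of e3] by (simp add: e3_nth)

text \<open>The given fundamental matrix is the only source of solutions; everything else is
  obtained from it by variation of constants.\<close>

locale third_order_system =
  fixes c :: real and q p :: "real \<Rightarrow> real" and \<Phi> :: "real \<Rightarrow> complex \<Rightarrow> complex^3^3"
  assumes c_pos: "c > 0"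
    and cont_q: "\<And>S. continuous_on S q" and cont_p: "\<And>S. continuous_on S p"
    and Phi_0: "\<And>\<mu>. \<Phi> 0 \<mu> = mat 1"
    and Phi_deriv: "\<And>\<mu> x. ((\<lambda>y. \<Phi> y \<mu>) has_vector_derivative (system_matrix c (q x) (p x) \<mu> ** \<Phi> x \<mu>)) (at x)"
begin

abbreviation A :: "real \<Rightarrow> complex \<Rightarrow> complex^3^3" where "A x \<mu> \<equiv> system_matrix c (q x) (p x) \<mu>"

text \<open>Forcing enters only the third component, since every perturbation considered changes
  only the scalar third-order equation. Solutions live on x \<ge> 0 but with two-sided derivatives,
  also at 0.\<close>

definition sol :: "complex \<Rightarrow> (real \<Rightarrow> complex) \<Rightarrow> (real \<Rightarrow> complex^3) \<Rightarrow> bool" where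
  "sol \<mu> \<rho> Y \<longleftrightarrow> (\<forall>x\<ge>0. (Y has_vector_derivative (A x \<mu> *v Y x + \<rho> x *s e3)) (at x))"

lemma sol_cont: "sol \<mu> \<rho> Y \<Longrightarrow> continuous_on {0..b} Y"
  unfolding sol_def by (intro continuous_at_imp_continuous_on ballI)
    (auto dest!: spec intro: has_vector_derivative_continuous)

lemma sol_nth:
  assumes "sol \<mu> \<rho> Y" "x \<ge> 0"
  shows "((\<lambda>x. Y x $ 1) has_vector_derivative Y x $ 2) (at x)"
    "((\<lambda>x. Y x $ 2) has_vector_derivative Y x $ 3) (at x)"
    "((\<lambda>x. Y x $ 3) has_vector_derivative
       ((- (\<mu> + of_real (p x)) * Y x $ 1 + of_real (q x) * Y x $ 2 + \<mu> * Y x $ 3) / of_real c + \<rho> x)) (at x)"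
proof -
  have "(Y has_vector_derivative (A x \<mu> *v Y x + \<rho> x *s e3)) (at x)" using assms by (simp add: sol_def)
  then show "((\<lambda>x. Y x $ 1) has_vector_derivative Y x $ 2) (at x)"
    "((\<lambda>x. Y x $ 2) has_vector_derivative Y x $ 3) (at x)"
    "((\<lambda>x. Y x $ 3) has_vector_derivative
       ((- (\<mu> + of_real (p x)) * Y x $ 1 + of_real (q x) * Y x $ 2 + \<mu> * Y x $ 3) / of_real c + \<rho> x)) (at x)"
    unfolding has_vector_derivative_vec3 by (simp_all add: system_matrix_mult e3_nth)
qed

lemma sol_vec3I:
  assumes "\<And>x. x \<ge> 0 \<Longrightarrow> ((\<lambda>x. Y x $ 1) has_vector_derivative Y x $ 2) (at x)"
    "\<And>x. x \<ge> 0 \<Longrightarrow> ((\<lambda>x. Y x $ 2) has_vector_derivative Y x $ 3) (at x)"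
    "\<And>x. x \<ge> 0 \<Longrightarrow> ((\<lambda>x. Y x $ 3) has_vector_derivative
       ((- (\<mu> + of_real (p x)) * Y x $ 1 + of_real (q x) * Y x $ 2 + \<mu> * Y x $ 3) / of_real c + \<rho> x)) (at x)"
  shows "sol \<mu> \<rho> Y"
  unfolding sol_def has_vector_derivative_vec3 using assms by (simp add: system_matrix_mult e3_nth)

lemma sol_diff:
  assumes "sol \<mu> \<rho> Y" "sol \<mu> \<rho>' Z"
  shows "sol \<mu> (\<lambda>x. \<rho> x - \<rho>' x) (\<lambda>x. Y x - Z x)"
  unfolding sol_def
proof (intro allI impI)
  fix x :: real assume "0 \<le> x"
  then have "((\<lambda>x. Y x - Z x) has_vector_derivative ((A x \<mu> *v Y x + \<rho> x *s e3) - (A x \<mu> *v Z x + \<rho>' x *s e3))) (at x)"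
    using assms unfolding sol_def by (intro has_vector_derivative_diff) auto
  then show "((\<lambda>x. Y x - Z x) has_vector_derivative A x \<mu> *v (Y x - Z x) + (\<rho> x - \<rho>' x) *s e3) (at x)"
    by (simp add: algebra_simps matrix_vector_mult_diff_distrib vector_sub_rdistrib)
qed

lemma sol_scale:
  assumes "sol \<mu> \<rho> Y"
  shows "sol \<mu> (\<lambda>x. k * \<rho> x) (\<lambda>x. k *s Y x)"
  unfolding sol_def
proof (intro allI impI)
  fix x :: real assume "0 \<le> x"
  have "bounded_linear (\<lambda>v::complex^3. k *s v)"
    unfolding linear_conv_bounded_linear[symmetric]
    by (rule linearI) (auto simp: vec_eq_iff algebra_simps)
  moreover have "(Y has_vector_derivative (A x \<mu> *v Y x + \<rho> x *s e3)) (at x)"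
    using assms \<open>0 \<le> x\<close> by (simp add: sol_def)
  ultimately have "((\<lambda>x. k *s Y x) has_vector_derivative (k *s (A x \<mu> *v Y x + \<rho> x *s e3))) (at x)"
    by (rule bounded_linear.has_vector_derivative)
  then show "((\<lambda>x. k *s Y x) has_vector_derivative A x \<mu> *v (k *s Y x) + (k * \<rho> x) *s e3) (at x)"
    by (simp only: vector_scalar_commute vector_add_ldistrib vector_smult_assoc)
qed

lemma A_bound:
  obtains K where "K \<ge> 0" "\<And>x \<mu> v. x \<in> {0..b} \<Longrightarrow> norm \<mu> \<le> R \<Longrightarrow> norm (A x \<mu> *v v) \<le> K * norm v"
proof -
  have "\<exists>B. \<forall>x\<in>{0..b}. \<bar>h x\<bar> \<le> B" if "continuous_on {0..b} h" for h :: "real \<Rightarrow> real"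
    using compact_imp_bounded[OF compact_continuous_image[OF that]] by (auto simp: bounded_iff)
  then obtain Q P where Q: "\<And>x. x \<in> {0..b} \<Longrightarrow> \<bar>q x\<bar> \<le> Q" and P: "\<And>x. x \<in> {0..b} \<Longrightarrow> \<bar>p x\<bar> \<le> P"
    using cont_q cont_p by metis
  define K where "K = 2 + ((\<bar>R\<bar> + \<bar>P\<bar>) + \<bar>Q\<bar> + \<bar>R\<bar>) / c"
  have "norm (A x \<mu> *v v) \<le> K * norm v" if x: "x \<in> {0..b}" and m: "norm \<mu> \<le> R" for x \<mu> and v :: "complex^3"
  proof -
    have n: "norm (v $ i) \<le> norm v" for i by (rule Finite_Cartesian_Product.norm_nth_le)
    have a1: "norm (- (\<mu> + of_real (p x))) \<le> \<bar>R\<bar> + \<bar>P\<bar>"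
      using norm_triangle_ineq[of \<mu> "of_real (p x)"] m P[OF x]
      unfolding norm_minus_cancel norm_of_real by linarith
    have a2: "norm (of_real (q x) :: complex) \<le> \<bar>Q\<bar>" "norm \<mu> \<le> \<bar>R\<bar>" using Q[OF x] m by auto
    have "norm (- (\<mu> + of_real (p x)) * v $ 1 + of_real (q x) * v $ 2 + \<mu> * v $ 3)
        \<le> norm (- (\<mu> + of_real (p x)) * v $ 1) + norm (of_real (q x) * v $ 2) + norm (\<mu> * v $ 3)"
      by (intro norm_triangle_le add_mono order_refl norm_triangle_ineq)
    also have "\<dots> \<le> (\<bar>R\<bar> + \<bar>P\<bar>) * norm v + \<bar>Q\<bar> * norm v + \<bar>R\<bar> * norm v"
      unfolding norm_mult by (intro add_mono mult_mono a1 a2 n) auto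
    finally have "norm ((A x \<mu> *v v) $ 3) \<le> ((\<bar>R\<bar> + \<bar>P\<bar>) * norm v + \<bar>Q\<bar> * norm v + \<bar>R\<bar> * norm v) / c"
      using c_pos unfolding system_matrix_mult norm_divide by (simp add: divide_right_mono)
    moreover have "norm ((A x \<mu> *v v) $ 1) \<le> norm v" "norm ((A x \<mu> *v v) $ 2) \<le> norm v"
      unfolding system_matrix_mult by (rule n)+
    ultimately have "norm (A x \<mu> *v v) \<le> norm v + norm v + ((\<bar>R\<bar> + \<bar>P\<bar>) * norm v + \<bar>Q\<bar> * norm v + \<bar>R\<bar> * norm v) / c"
      using norm_vec3_le[of "A x \<mu> *v v"] by linarith
    also have "\<dots> = K * norm v" using c_pos by (simp add: K_def field_simps)
    finally show ?thesis .
  qed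
  moreover have "K \<ge> 0" using c_pos by (simp add: K_def)
  ultimately show ?thesis using that by blast
qed

text \<open>One constant for all spectral parameters in a disc and all forcings: this uniformity is
  what allows differentiation in \<mu>.\<close>

definition growth_const :: "real \<Rightarrow> real \<Rightarrow> real \<Rightarrow> bool" where
  "growth_const R b C \<longleftrightarrow> C \<ge> 0 \<and> (\<forall>\<mu> \<rho> Y e x. sol \<mu> \<rho> Y \<longrightarrow> norm \<mu> \<le> R \<longrightarrow> e \<ge> 0 \<longrightarrow>
     (\<forall>x\<in>{0..b}. norm (\<rho> x) \<le> e) \<longrightarrow> x \<in> {0..b} \<longrightarrow> norm (Y x) \<le> C * (norm (Y 0) + e))"

lemma growth_constD:
  assumes "growth_const R b C" "sol \<mu> \<rho> Y" "norm \<mu> \<le> R" "e \<ge> 0"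
    "\<And>x. x \<in> {0..b} \<Longrightarrow> norm (\<rho> x) \<le> e" "x \<in> {0..b}"
  shows "norm (Y x) \<le> C * (norm (Y 0) + e)"
  using assms unfolding growth_const_def by simp

lemma growth_const_exists: "\<exists>C. growth_const R b C"
proof (cases "b \<ge> 0")
  case b: True
  obtain K where K: "K \<ge> 0" "\<And>x \<mu> v. x \<in> {0..b} \<Longrightarrow> norm \<mu> \<le> R \<Longrightarrow> norm (A x \<mu> *v v) \<le> K * norm v"
    using A_bound[of b R] by metis
  show ?thesis
    unfolding growth_const_def
  proof (intro exI[of _ "exp ((K + 1) * b) * (1 + b)"] conjI allI impI)
    show "exp ((K + 1) * b) * (1 + b) \<ge> 0" using b by simp
    fix \<mu> \<rho> Y and e x :: real
    assume s: "sol \<mu> \<rho> Y" "norm \<mu> \<le> R" "e \<ge> 0" "\<forall>x\<in>{0..b}. norm (\<rho> x) \<le> e" "x \<in> {0..b}"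
    have "norm (Y x) \<le> exp ((K + 1) * b) * (norm (Y 0) + (1 + b) * e)"
    proof (rule gronwall[OF K(1) s(3) _ _ s(5)])
      fix t assume t: "t \<in> {0..b}"
      show "(Y has_vector_derivative (A t \<mu> *v Y t + \<rho> t *s e3)) (at t)" using s(1) t by (simp add: sol_def)
      have "norm (\<rho> t *s e3) \<le> e * 1" unfolding norm_scalar_mult_vec
        using s(4) t norm_e3 s(3) by (intro mult_mono) auto
      then show "norm (A t \<mu> *v Y t + \<rho> t *s e3) \<le> K * norm (Y t) + e"
        using norm_triangle_ineq[of "A t \<mu> *v Y t" "\<rho> t *s e3"] K(2)[OF t s(2), of "Y t"] by linarith
    qed
    also have "\<dots> \<le> exp ((K + 1) * b) * ((1 + b) * norm (Y 0) + (1 + b) * e)"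
      using b by (intro mult_left_mono add_right_mono) (auto simp: algebra_simps)
    also have "\<dots> = exp ((K + 1) * b) * (1 + b) * (norm (Y 0) + e)" by (simp add: algebra_simps)
    finally show "norm (Y x) \<le> exp ((K + 1) * b) * (1 + b) * (norm (Y 0) + e)" .
  qed
next
  case False
  then show ?thesis unfolding growth_const_def by (intro exI[of _ 0]) auto
qed

lemma sol_unique:
  assumes "sol \<mu> \<rho> Y" "sol \<mu> \<rho> Z" "Y 0 = Z 0" "x \<ge> 0"
  shows "Y x = Z x"
proof -
  obtain C where C: "growth_const (norm \<mu>) x C" using growth_const_exists ..
  have "norm (Y x - Z x) \<le> C * (norm (Y 0 - Z 0) + 0)"
    by (rule growth_constD[OF C sol_diff[OF assms(1,2)]]) (use assms(4) in auto)
  then show ?thesis using assms(3) by simp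
qed

lemma Phi_sol: "sol \<mu> (\<lambda>_. 0) (\<lambda>x. \<Phi> x \<mu> *v y)"
  unfolding sol_def
proof (intro allI impI)
  fix x :: real
  have "bounded_linear (\<lambda>M::complex^3^3. M *v y)"
    unfolding linear_conv_bounded_linear[symmetric]
    by (rule linearI) (auto simp: vec_eq_iff matrix_vector_mult_def sum_3 algebra_simps)
  from bounded_linear.has_vector_derivative[OF this Phi_deriv[of \<mu> x]]
  show "((\<lambda>x. \<Phi> x \<mu> *v y) has_vector_derivative A x \<mu> *v (\<Phi> x \<mu> *v y) + 0 *s e3) (at x)"
    by (simp add: matrix_vector_mul_assoc)
qed

lemma sol_Phi:
  assumes "sol \<mu> (\<lambda>_. 0) Y" "x \<ge> 0"
  shows "Y x = \<Phi> x \<mu> *v Y 0"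
  by (rule sol_unique[OF assms(1) Phi_sol _ assms(2)]) (simp add: Phi_0)

end

section \<open>Liouville's formula, variation of constants and holomorphy in the spectral
  parameter\<close>

context third_order_system
begin

abbreviation \<phi> :: "complex \<Rightarrow> 3 \<Rightarrow> 3 \<Rightarrow> real \<Rightarrow> complex" where "\<phi> \<mu> i j x \<equiv> \<Phi> x \<mu> $ i $ j"

lemma phi_deriv:
  "((\<lambda>x. \<phi> \<mu> 1 j x) has_vector_derivative \<phi> \<mu> 2 j x) (at x)"
  "((\<lambda>x. \<phi> \<mu> 2 j x) has_vector_derivative \<phi> \<mu> 3 j x) (at x)"
  "((\<lambda>x. \<phi> \<mu> 3 j x) has_vector_derivative
     (- (\<mu> + of_real (p x)) * \<phi> \<mu> 1 j x + of_real (q x) * \<phi> \<mu> 2 j x + \<mu> * \<phi> \<mu> 3 j x) / of_real c) (at x)"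
proof -
  have "((\<lambda>x. \<phi> \<mu> i j x) has_vector_derivative ((A x \<mu> ** \<Phi> x \<mu>) $ i $ j)) (at x)" for i
    by (intro bounded_linear.has_vector_derivative[OF bounded_linear_vec_nth] Phi_deriv)
  from this[of 1] this[of 2] this[of 3]
  show "((\<lambda>x. \<phi> \<mu> 1 j x) has_vector_derivative \<phi> \<mu> 2 j x) (at x)"
    "((\<lambda>x. \<phi> \<mu> 2 j x) has_vector_derivative \<phi> \<mu> 3 j x) (at x)"
    "((\<lambda>x. \<phi> \<mu> 3 j x) has_vector_derivative
     (- (\<mu> + of_real (p x)) * \<phi> \<mu> 1 j x + of_real (q x) * \<phi> \<mu> 2 j x + \<mu> * \<phi> \<mu> 3 j x) / of_real c) (at x)"
    by (simp_all add: system_matrix_def matrix_matrix_mult_def sum_3 add_divide_distrib)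
qed

lemma phi_cont: "continuous_on S (\<phi> \<mu> i j)"
proof -
  have "continuous (at x) (\<lambda>x. \<Phi> x \<mu>)" for x
    using Phi_deriv by (rule has_vector_derivative_continuous)
  then have "continuous_on S (\<lambda>x. \<Phi> x \<mu>)" by (simp add: continuous_at_imp_continuous_on)
  then show ?thesis by (intro continuous_intros)
qed

lemma det_Phi: "det (\<Phi> x \<mu>) = exp (\<mu> * of_real x / of_real c)"
proof -
  have cc: "complex_of_real c \<noteq> 0" using c_pos by simp
  define g where "g x = det (\<Phi> x \<mu>) * exp (- (\<mu> / of_real c) * of_real x)" for x
  have e: "((\<lambda>x. exp (- (\<mu> / of_real c) * of_real x)) has_vector_derivative
      - (\<mu> / of_real c) * exp (- (\<mu> / of_real c) * of_real x)) (at x)" for x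
  proof -
    have "((\<lambda>z. exp (- (\<mu> / of_real c) * z)) has_field_derivative
      - (\<mu> / of_real c) * exp (- (\<mu> / of_real c) * of_real x)) (at (of_real x))"
      using c_pos by (auto intro!: derivative_eq_intros)
    from has_vector_derivative_real_field[OF this] show ?thesis .
  qed
  have d: "((\<lambda>x. det (\<Phi> x \<mu>)) has_vector_derivative (\<mu> / of_real c) * det (\<Phi> x \<mu>)) (at x)" for x
    unfolding det_3
    by (rule has_vector_derivative_eq_rhs,
        (rule has_vector_derivative_add has_vector_derivative_diff has_vector_derivative_mult phi_deriv)+)
       (use c_pos in \<open>simp add: field_simps\<close>)
  have "(g has_vector_derivative 0) (at x within UNIV)" for x
    unfolding g_def
    by (rule has_vector_derivative_eq_rhs, rule has_vector_derivative_mult[OF d e]) (simp add: algebra_simps)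
  then obtain k where "\<And>x. g x = k"
    using has_vector_derivative_zero_constant[of UNIV g] by auto
  then have "g x = g 0" by simp
  also have "g 0 = 1" by (simp add: g_def Phi_0)
  finally have "det (\<Phi> x \<mu>) * inverse (exp (\<mu> * of_real x / of_real c)) = 1"
    by (simp add: g_def exp_minus[symmetric])
  then show ?thesis by (simp add: field_simps)
qed

text \<open>The third column of the inverse of \<open>\<Phi> x \<mu>\<close> by Cramer's rule:
  cofactors divided by the determinant exp(\<mu> x / c).\<close>

definition G :: "complex \<Rightarrow> real \<Rightarrow> complex^3" where
  "G \<mu> x = exp (- (\<mu> * of_real x / of_real c)) *s vector
     [\<phi> \<mu> 1 2 x * \<phi> \<mu> 2 3 x - \<phi> \<mu> 1 3 x * \<phi> \<mu> 2 2 x,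
      \<phi> \<mu> 1 3 x * \<phi> \<mu> 2 1 x - \<phi> \<mu> 1 1 x * \<phi> \<mu> 2 3 x,
      \<phi> \<mu> 1 1 x * \<phi> \<mu> 2 2 x - \<phi> \<mu> 1 2 x * \<phi> \<mu> 2 1 x]"

lemma Phi_G: "\<Phi> x \<mu> *v G \<mu> x = e3"
proof -
  have "(\<Phi> x \<mu> *v G \<mu> x) $ 3 = exp (- (\<mu> * of_real x / of_real c)) * det (\<Phi> x \<mu>)"
    by (simp add: G_def matrix_vector_mult_def sum_3 det_3 algebra_simps)
  also have "\<dots> = 1" unfolding det_Phi by (simp add: exp_minus)
  finally have "(\<Phi> x \<mu> *v G \<mu> x) $ 3 = 1" .
  then show ?thesis
    by (simp add: vec3_eq_iff e3_nth) (simp add: G_def matrix_vector_mult_def sum_3 algebra_simps)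
qed

lemma G_cont: "continuous_on S (\<lambda>x. G \<mu> x $ i)"
proof -
  have "i = 1 \<or> i = 2 \<or> i = 3" by (rule exhaust_3)
  then show ?thesis using c_pos
    by (elim disjE) (simp_all add: G_def, (intro continuous_intros phi_cont; simp)+)
qed

lemma duhamel:
  assumes \<rho>: "\<And>S. continuous_on S \<rho>"
  obtains Z where "sol \<mu> \<rho> Z" "Z 0 = z0"
proof -
  \<comment> \<open>The integrals start at -1 so that 0 is an interior point and the derivative
    there is two-sided; the subtracted constant normalises \<open>J 0 = 0\<close>.\<close>
  define J where "J x = (\<chi> i. integral {-1..x} (\<lambda>t. \<rho> t * G \<mu> t $ i) - integral {-1..0} (\<lambda>t. \<rho> t * G \<mu> t $ i))" for x
  have J: "((\<lambda>x. J x $ i) has_vector_derivative \<rho> x * G \<mu> x $ i) (at x)" if "x \<ge> 0" for x i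
  proof -
    have "((\<lambda>x. integral {-1..x} (\<lambda>t. \<rho> t * G \<mu> t $ i)) has_vector_derivative \<rho> x * G \<mu> x $ i) (at x within {-1..x+1})"
      by (rule integral_has_vector_derivative) (use that in \<open>auto intro!: continuous_intros \<rho> G_cont\<close>)
    then have "((\<lambda>x. integral {-1..x} (\<lambda>t. \<rho> t * G \<mu> t $ i)) has_vector_derivative \<rho> x * G \<mu> x $ i) (at x)"
      using that by (simp add: at_within_Icc_at)
    then have "((\<lambda>x. integral {-1..x} (\<lambda>t. \<rho> t * G \<mu> t $ i) - integral {-1..0} (\<lambda>t. \<rho> t * G \<mu> t $ i))
       has_vector_derivative \<rho> x * G \<mu> x $ i - 0) (at x)"
      by (intro has_vector_derivative_diff has_vector_derivative_const)
    then show ?thesis by (simp add: J_def)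
  qed
  define Z where "Z x = \<Phi> x \<mu> *v (z0 + J x)" for x
  have Zn: "Z x $ i = \<phi> \<mu> i 1 x * (z0 $ 1 + J x $ 1) + \<phi> \<mu> i 2 x * (z0 $ 2 + J x $ 2) + \<phi> \<mu> i 3 x * (z0 $ 3 + J x $ 3)" for x i
    by (simp add: Z_def matrix_vector_mult_def sum_3)
  have PG: "\<phi> \<mu> i 1 x * G \<mu> x $ 1 + \<phi> \<mu> i 2 x * G \<mu> x $ 2 + \<phi> \<mu> i 3 x * G \<mu> x $ 3 = e3 $ i" for i x
    using arg_cong[OF Phi_G[of x \<mu>], of "\<lambda>v. v $ i"] by (simp add: matrix_vector_mult_def sum_3)
  have Jz: "((\<lambda>x. z0 $ i + J x $ i) has_vector_derivative \<rho> x * G \<mu> x $ i) (at x)" if "x \<ge> 0" for x i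
    using has_vector_derivative_add[OF has_vector_derivative_const J[OF that]] by simp
  have D: "((\<lambda>x. Z x $ i) has_vector_derivative
      (\<phi>' 1 * (z0 $ 1 + J x $ 1) + \<phi>' 2 * (z0 $ 2 + J x $ 2) + \<phi>' 3 * (z0 $ 3 + J x $ 3)) + \<rho> x * e3 $ i) (at x)"
    if x: "x \<ge> 0" and \<phi>': "\<And>j. ((\<lambda>x. \<phi> \<mu> i j x) has_vector_derivative \<phi>' j) (at x)" for x i \<phi>'
    unfolding Zn PG[where i = i and x = x, symmetric]
    by (rule has_vector_derivative_eq_rhs,
        (rule has_vector_derivative_add has_vector_derivative_mult \<phi>' Jz x)+) (simp add: algebra_simps)
  have "sol \<mu> \<rho> Z"
  proof (rule sol_vec3I)
    fix x :: real assume x: "x \<ge> 0"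
    show "((\<lambda>x. Z x $ 1) has_vector_derivative Z x $ 2) (at x)"
      using D[OF x phi_deriv(1)] by (simp add: Zn e3_nth)
    show "((\<lambda>x. Z x $ 2) has_vector_derivative Z x $ 3) (at x)"
      using D[OF x phi_deriv(2)] by (simp add: Zn e3_nth)
    have "(- (\<mu> + of_real (p x)) * Z x $ 1 + of_real (q x) * Z x $ 2 + \<mu> * Z x $ 3) / of_real c + \<rho> x =
       (- (\<mu> + of_real (p x)) * \<phi> \<mu> 1 1 x + of_real (q x) * \<phi> \<mu> 2 1 x + \<mu> * \<phi> \<mu> 3 1 x) / of_real c * (z0 $ 1 + J x $ 1) +
       (- (\<mu> + of_real (p x)) * \<phi> \<mu> 1 2 x + of_real (q x) * \<phi> \<mu> 2 2 x + \<mu> * \<phi> \<mu> 3 2 x) / of_real c * (z0 $ 2 + J x $ 2) +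
       (- (\<mu> + of_real (p x)) * \<phi> \<mu> 1 3 x + of_real (q x) * \<phi> \<mu> 2 3 x + \<mu> * \<phi> \<mu> 3 3 x) / of_real c * (z0 $ 3 + J x $ 3)
       + \<rho> x * e3 $ 3"
      using c_pos by (simp add: Zn e3_nth field_simps)
    then show "((\<lambda>x. Z x $ 3) has_vector_derivative
       ((- (\<mu> + of_real (p x)) * Z x $ 1 + of_real (q x) * Z x $ 2 + \<mu> * Z x $ 3) / of_real c + \<rho> x)) (at x)"
      using D[OF x phi_deriv(3)] by simp
  qed
  moreover have "Z 0 = z0" by (simp add: Z_def J_def Phi_0 vec_eq_iff)
  ultimately show ?thesis using that by blast
qed

lemma sol_cong: "sol \<mu> \<rho> Y \<Longrightarrow> (\<And>x. \<rho> x = \<rho>' x) \<Longrightarrow> sol \<mu> \<rho>' Y"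
  by (simp add: sol_def)

text \<open>The matrix is affine in the spectral parameter, so replacing \<nu> by \<mu> only moves a
  multiple of v_xx - v into the forcing.\<close>

lemma sol_shift:
  assumes "sol \<nu> \<rho> Y"
  shows "sol \<mu> (\<lambda>x. \<rho> x + (\<nu> - \<mu>) * ((Y x $ 3 - Y x $ 1) / of_real c)) Y"
proof (rule sol_vec3I)
  fix x :: real assume x: "x \<ge> 0"
  show "((\<lambda>x. Y x $ 1) has_vector_derivative Y x $ 2) (at x)" "((\<lambda>x. Y x $ 2) has_vector_derivative Y x $ 3) (at x)"
    using sol_nth[OF assms x] by auto
  have eq: "(- (\<mu> + of_real (p x)) * Y x $ 1 + of_real (q x) * Y x $ 2 + \<mu> * Y x $ 3) / of_real c
      + (\<rho> x + (\<nu> - \<mu>) * ((Y x $ 3 - Y x $ 1) / of_real c))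
    = (- (\<nu> + of_real (p x)) * Y x $ 1 + of_real (q x) * Y x $ 2 + \<nu> * Y x $ 3) / of_real c + \<rho> x"
    using c_pos by (simp add: field_simps)
  show "((\<lambda>x. Y x $ 3) has_vector_derivative
     (- (\<mu> + of_real (p x)) * Y x $ 1 + of_real (q x) * Y x $ 2 + \<mu> * Y x $ 3) / of_real c
      + (\<rho> x + (\<nu> - \<mu>) * ((Y x $ 3 - Y x $ 1) / of_real c))) (at x)"
    by (simp only: eq sol_nth(3)[OF assms x])
qed

lemma norm_nth_diff_le:
  fixes v :: "complex^3"
  shows "norm (k * ((v $ 3 - v $ 1) / of_real c)) \<le> norm k * (2 / c) * norm v"
proof -
  have "norm (v $ 3 - v $ 1) \<le> 2 * norm v"
    using norm_triangle_ineq4[of "v $ 3" "v $ 1"] Finite_Cartesian_Product.norm_nth_le[of v 3]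
      Finite_Cartesian_Product.norm_nth_le[of v 1] by linarith
  then have "norm (v $ 3 - v $ 1) / c \<le> 2 * norm v / c" using c_pos by (simp add: divide_right_mono)
  then have "norm k * (norm (v $ 3 - v $ 1) / c) \<le> norm k * (2 * norm v / c)" by (rule mult_left_mono) simp
  then show ?thesis using c_pos by (simp add: norm_mult norm_divide)
qed

text \<open>\<open>Z\<close> is the formal \<mu>-derivative of \<open>Y\<close>. The remainder
  solves the system at \<nu> with zero initial value and a forcing quadratic in \<nu> - \<mu>, so
  the uniform growth bound applies. A nonzero \<open>Z 0\<close> is allowed since the translation
  mode needs initial data that move with \<mu>.\<close>

lemma sol_expansion:
  assumes Y: "sol \<mu> (\<lambda>_. 0) Y"
    and Z: "sol \<mu> (\<lambda>x. (Y x $ 3 - Y x $ 1) / of_real c) Z"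
  shows "\<exists>C\<ge>0. \<forall>\<nu> x. norm (\<nu> - \<mu>) \<le> 1 \<longrightarrow> x \<in> {0..b} \<longrightarrow>
     norm (\<Phi> x \<nu> *v (Y 0 + (\<nu> - \<mu>) *s Z 0) - Y x - (\<nu> - \<mu>) *s Z x) \<le> C * (norm (\<nu> - \<mu>))\<^sup>2"
proof -
  obtain C1 where C1: "growth_const (norm \<mu> + 1) b C1" using growth_const_exists ..
  obtain S where S: "\<forall>x\<in>{0..b}. norm (Z x) \<le> S"
    using continuous_on_Icc_bounded[OF sol_cont[OF Z, of b]] by blast
  define C where "C = C1 * (2 / c * \<bar>S\<bar>)"
  have est: "norm (\<Phi> x \<nu> *v (Y 0 + (\<nu> - \<mu>) *s Z 0) - Y x - (\<nu> - \<mu>) *s Z x) \<le> C * (norm (\<nu> - \<mu>))\<^sup>2"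
    if n: "norm (\<nu> - \<mu>) \<le> 1" and x: "x \<in> {0..b}" for \<nu> x
  proof -
    define W where "W x = \<Phi> x \<nu> *v (Y 0 + (\<nu> - \<mu>) *s Z 0)" for x
    define V where "V x = W x - Y x - (\<nu> - \<mu>) *s Z x" for x
    have nu: "norm \<nu> \<le> norm \<mu> + 1" using norm_triangle_ineq[of "\<nu> - \<mu>" \<mu>] n by simp
    have W: "sol \<nu> (\<lambda>_. 0) W" unfolding W_def by (rule Phi_sol)
    note s = sol_diff[OF sol_diff[OF W sol_shift[OF Y, of \<nu>]] sol_shift[OF sol_scale[OF Z, of "\<nu> - \<mu>"], of \<nu>]]
    have "sol \<nu> (\<lambda>x. (\<nu> - \<mu>) * (\<nu> - \<mu>) * ((Z x $ 3 - Z x $ 1) / of_real c)) V"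
      unfolding V_def by (rule sol_cong[OF s]) (use c_pos in \<open>simp add: field_simps\<close>)
    then have "norm (V x) \<le> C1 * (norm (V 0) + (norm (\<nu> - \<mu>))\<^sup>2 * (2 / c * \<bar>S\<bar>))"
    proof (rule growth_constD[OF C1 _ nu _ _ x])
      show "(norm (\<nu> - \<mu>))\<^sup>2 * (2 / c * \<bar>S\<bar>) \<ge> 0" using c_pos by simp
      fix t assume t: "t \<in> {0..b}"
      have "norm ((\<nu> - \<mu>) * (\<nu> - \<mu>) * ((Z t $ 3 - Z t $ 1) / of_real c)) \<le> norm ((\<nu> - \<mu>) * (\<nu> - \<mu>)) * (2 / c) * norm (Z t)"
        by (rule norm_nth_diff_le)
      also have "\<dots> \<le> norm ((\<nu> - \<mu>) * (\<nu> - \<mu>)) * (2 / c) * \<bar>S\<bar>"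
        using S t c_pos by (intro mult_left_mono) fastforce+
      finally show "norm ((\<nu> - \<mu>) * (\<nu> - \<mu>) * ((Z t $ 3 - Z t $ 1) / of_real c)) \<le> (norm (\<nu> - \<mu>))\<^sup>2 * (2 / c * \<bar>S\<bar>)"
        by (simp add: norm_mult power2_eq_square mult_ac)
    qed
    moreover have "V 0 = 0" by (simp add: V_def W_def Phi_0)
    ultimately show ?thesis by (simp add: V_def W_def C_def mult_ac)
  qed
  have "C \<ge> 0" using C1 c_pos by (simp add: C_def growth_const_def)
  then show ?thesis using est by (intro exI[of _ C]) simp
qed

lemma Phi_has_field_derivative:
  assumes Y: "sol \<mu> (\<lambda>_. 0) Y" and x: "x \<ge> 0"
    and Z: "sol \<mu> (\<lambda>x. (Y x $ 3 - Y x $ 1) / of_real c) Z"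
  shows "((\<lambda>\<nu>. (\<Phi> x \<nu> *v (Y 0 + (\<nu> - \<mu>) *s Z 0)) $ i) has_field_derivative Z x $ i) (at \<mu>)"
proof -
  obtain C where C: "C \<ge> 0" "\<forall>\<nu> t. norm (\<nu> - \<mu>) \<le> 1 \<longrightarrow> t \<in> {0..x} \<longrightarrow>
     norm (\<Phi> t \<nu> *v (Y 0 + (\<nu> - \<mu>) *s Z 0) - Y t - (\<nu> - \<mu>) *s Z t) \<le> C * (norm (\<nu> - \<mu>))\<^sup>2"
    using sol_expansion[OF Y Z, of x] by (elim exE conjE) (rule that)
  define W where "W \<nu> = \<Phi> x \<nu> *v (Y 0 + (\<nu> - \<mu>) *s Z 0)" for \<nu>
  have W\<mu>: "W \<mu> = Y x" by (simp add: W_def sol_Phi[OF Y x, symmetric])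
  have "((\<lambda>\<nu>. (W \<nu> $ i - W \<mu> $ i) / (\<nu> - \<mu>) - Z x $ i) \<longlongrightarrow> 0) (at \<mu>)"
  proof (rule Lim_null_comparison)
    have "\<forall>\<^sub>F \<nu> in at \<mu>. norm (\<nu> - \<mu>) < 1 \<and> \<nu> \<noteq> \<mu>"
      unfolding eventually_at by (intro exI[of _ 1]) (auto simp: dist_norm)
    then show "\<forall>\<^sub>F \<nu> in at \<mu>. norm ((W \<nu> $ i - W \<mu> $ i) / (\<nu> - \<mu>) - Z x $ i) \<le> C * norm (\<nu> - \<mu>)"
    proof eventually_elim
      case (elim \<nu>)
      have "(W \<nu> $ i - W \<mu> $ i) / (\<nu> - \<mu>) - Z x $ i = (W \<nu> - Y x - (\<nu> - \<mu>) *s Z x) $ i / (\<nu> - \<mu>)"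
        using elim by (simp add: W\<mu> field_simps)
      then have "norm ((W \<nu> $ i - W \<mu> $ i) / (\<nu> - \<mu>) - Z x $ i) \<le> norm (W \<nu> - Y x - (\<nu> - \<mu>) *s Z x) / norm (\<nu> - \<mu>)"
        by (simp only: norm_divide) (intro divide_right_mono Finite_Cartesian_Product.norm_nth_le norm_ge_zero)
      also have "\<dots> \<le> C * (norm (\<nu> - \<mu>))\<^sup>2 / norm (\<nu> - \<mu>)"
        using C(2)[rule_format, of \<nu> x] elim x by (intro divide_right_mono) (auto simp: W_def)
      finally show ?case using elim by (simp add: power2_eq_square)
    qed
    show "((\<lambda>\<nu>. C * norm (\<nu> - \<mu>)) \<longlongrightarrow> 0) (at \<mu>)" by (auto intro!: tendsto_eq_intros)
  qed
  then have "((\<lambda>\<nu>. (W \<nu> $ i - W \<mu> $ i) / (\<nu> - \<mu>)) \<longlongrightarrow> Z x $ i) (at \<mu>)"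
    by (simp only: Lim_null[symmetric])
  then show ?thesis unfolding has_field_derivative_iff W_def .
qed

text \<open>Column j is the solution started at a fixed unit vector, so \<open>Z\<close> with zero
  initial value is its complex derivative.\<close>

lemma Phi_holomorphic:
  assumes "x \<ge> 0"
  shows "(\<lambda>\<nu>. \<Phi> x \<nu> $ i $ j) holomorphic_on UNIV"
proof -
  have "(\<lambda>\<nu>. \<Phi> x \<nu> $ i $ j) field_differentiable at \<mu>" for \<mu>
  proof -
    define Y where "Y x = \<Phi> x \<mu> *v axis j 1" for x
    have Y: "sol \<mu> (\<lambda>_. 0) Y" unfolding Y_def by (rule Phi_sol)
    have ax: "(M *v axis j 1) $ i = M $ i $ j" for M :: "complex^3^3" and i
      by (simp add: matrix_vector_mult_def axis_def if_distrib cong: if_cong)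
    have Yc: "continuous_on S (\<lambda>x. (Y x $ 3 - Y x $ 1) / of_real c)" for S
      unfolding Y_def ax using c_pos by (intro continuous_intros phi_cont) simp
    obtain Z where Z: "sol \<mu> (\<lambda>x. (Y x $ 3 - Y x $ 1) / of_real c) Z" "Z 0 = 0"
      by (rule duhamel[OF Yc])
    have "(\<lambda>\<nu>. (\<Phi> x \<nu> *v (Y 0 + (\<nu> - \<mu>) *s Z 0)) $ i) = (\<lambda>\<nu>. \<Phi> x \<nu> $ i $ j)"
      by (rule ext) (simp only: Z(2) Y_def Phi_0 matrix_vector_mul_lid vector_smult_rzero add_0_right ax)
    with Phi_has_field_derivative[OF Y assms Z(1), of i] show ?thesis
      unfolding field_differentiable_def by auto
  qed
  then show ?thesis by (simp add: holomorphic_on_def field_differentiable_at_within)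
qed

end

section \<open>Symmetry and expansion of the Evans function\<close>

lemma char_poly_3:
  fixes M :: "complex^3^3"
  shows "det (M - mat \<zeta>) = - (\<zeta>^3) + trace M * \<zeta>^2
    - ((M$2$2 * M$3$3 - M$2$3 * M$3$2) + (M$1$1 * M$3$3 - M$1$3 * M$3$1) + (M$1$1 * M$2$2 - M$1$2 * M$2$1)) * \<zeta> + det M"
  by (simp add: det_3 mat_def trace_def sum_3 algebra_simps power2_eq_square power3_eq_cube)

text \<open>Rows are functions of the column index, so that a row can be a functional evaluated on
  three solutions.\<close>

definition det3 :: "(3 \<Rightarrow> 'a::comm_ring_1) \<Rightarrow> (3 \<Rightarrow> 'a) \<Rightarrow> (3 \<Rightarrow> 'a) \<Rightarrow> 'a" where
  "det3 x y z = det (\<chi> i j. (if i = 1 then x j else if i = 2 then y j else z j))"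

lemma det3_eq:
  "det3 x y z = x 1 * y 2 * z 3 + x 2 * y 3 * z 1 + x 3 * y 1 * z 2 - x 1 * y 3 * z 2 - x 2 * y 1 * z 3 - x 3 * y 2 * z 1"
  by (simp add: det3_def det_3)

lemma tendsto_det3:
  fixes x y z :: "'b \<Rightarrow> 3 \<Rightarrow> complex"
  assumes "\<And>j. ((\<lambda>\<mu>. x \<mu> j) \<longlongrightarrow> x0 j) F" "\<And>j. ((\<lambda>\<mu>. y \<mu> j) \<longlongrightarrow> y0 j) F" "\<And>j. ((\<lambda>\<mu>. z \<mu> j) \<longlongrightarrow> z0 j) F"
  shows "((\<lambda>\<mu>. det3 (x \<mu>) (y \<mu>) (z \<mu>)) \<longlongrightarrow> det3 x0 y0 z0) F"
  unfolding det3_eq by (intro tendsto_intros assms)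

text \<open>The adjugate is the determinant times the inverse; taking traces turns the sum of
  principal minors into det M times the trace of the right inverse \<open>N\<close>.\<close>

lemma principal_minors_inverse:
  fixes M :: "complex^3^3" and N :: "3 \<Rightarrow> 3 \<Rightarrow> complex"
  assumes N: "\<And>i j. M$i$1 * N 1 j + M$i$2 * N 2 j + M$i$3 * N 3 j = (if i = j then 1 else 0)"
  shows "(M$2$2 * M$3$3 - M$2$3 * M$3$2) + (M$1$1 * M$3$3 - M$1$3 * M$3$1) + (M$1$1 * M$2$2 - M$1$2 * M$2$1)
    = det M * (N 1 1 + N 2 2 + N 3 3)"
proof -
  \<comment> \<open>Kept opaque so that the three diagonal identities are polynomial identities in
    the entries; the values of \<open>r\<close> are inserted only at the end.\<close>
  define r where "r i j = M$i$1 * N 1 j + M$i$2 * N 2 j + M$i$3 * N 3 j" for i j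
  have r: "r i j = (if i = j then 1 else 0)" for i j unfolding r_def by (rule N)
  have "det M * N 1 1 = (M$2$2 * M$3$3 - M$2$3 * M$3$2) * r 1 1 + (M$1$3 * M$3$2 - M$1$2 * M$3$3) * r 2 1 + (M$1$2 * M$2$3 - M$1$3 * M$2$2) * r 3 1"
    unfolding det_3 r_def by (simp add: algebra_simps)
  moreover have "det M * N 2 2 = (M$2$3 * M$3$1 - M$2$1 * M$3$3) * r 1 2 + (M$1$1 * M$3$3 - M$1$3 * M$3$1) * r 2 2 + (M$1$3 * M$2$1 - M$1$1 * M$2$3) * r 3 2"
    unfolding det_3 r_def by (simp add: algebra_simps)
  moreover have "det M * N 3 3 = (M$2$1 * M$3$2 - M$2$2 * M$3$1) * r 1 3 + (M$1$2 * M$3$1 - M$1$1 * M$3$2) * r 2 3 + (M$1$1 * M$2$2 - M$1$2 * M$2$1) * r 3 3"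
    unfolding det_3 r_def by (simp add: algebra_simps)
  ultimately show ?thesis unfolding r distrib_left by simp
qed

text \<open>A single wave with its derivative and fundamental matrix. The constant \<open>k0\<close>
  is the second derivative at the trough, nonzero because the turning point is a simple
  root.\<close>

locale wave_profile =
  fixes f f1 f2 :: "real \<Rightarrow> real" and c a T um k0 :: real and w w1 :: "real \<Rightarrow> real"
    and \<Phi> :: "real \<Rightarrow> complex \<Rightarrow> complex^3^3"
  assumes c_pos: "c > 0" and T_pos: "T > 0"
    and f_deriv: "\<And>x. (f has_real_derivative f1 x) (at x)"
    and f1_deriv: "\<And>x. (f1 has_real_derivative f2 x) (at x)"
    and f2_cont: "continuous_on UNIV f2"
    and w_deriv: "\<And>x. (w has_real_derivative w1 x) (at x)"
    and w1_deriv: "\<And>x. (w1 has_real_derivative (a + (c - 1) * w x - f (w x)) / c) (at x)"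
    and w_0: "w 0 = um" and w1_0: "w1 0 = 0"
    and k0: "(a + (c - 1) * um - f um) / c = k0" "k0 \<noteq> 0"
    and w_refl: "\<And>x. w (T - x) = w x"
    and Phi_0: "\<And>\<mu>. \<Phi> 0 \<mu> = mat 1"
    and Phi_deriv: "\<And>\<mu> x. ((\<lambda>y. \<Phi> y \<mu>) has_vector_derivative
          (system_matrix c (c - 1 - f1 (w x)) (w1 x * f2 (w x)) \<mu> ** \<Phi> x \<mu>)) (at x)"
begin

definition w2 :: "real \<Rightarrow> real" where "w2 x = (a + (c - 1) * w x - f (w x)) / c"
definition q :: "real \<Rightarrow> real" where "q x = c - 1 - f1 (w x)"
definition p :: "real \<Rightarrow> real" where "p x = w1 x * f2 (w x)"

lemma w1_deriv': "(w1 has_real_derivative w2 x) (at x)"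
  unfolding w2_def by (rule w1_deriv)

lemma w2_deriv: "(w2 has_real_derivative q x * w1 x / c) (at x)"
proof -
  have "((\<lambda>x. a + (c - 1) * w x - f (w x)) has_real_derivative (c - 1) * w1 x - f1 (w x) * w1 x) (at x)"
    by (auto intro!: derivative_eq_intros w_deriv DERIV_chain2[OF f_deriv w_deriv])
  from DERIV_cdivide[OF this, of c] show ?thesis
    by (simp add: w2_def[abs_def] q_def left_diff_distrib)
qed

lemma q_deriv: "(q has_real_derivative - p x) (at x)"
  unfolding q_def p_def
  by (auto intro!: derivative_eq_intros DERIV_chain2[OF f1_deriv w_deriv] simp: algebra_simps)

lemma w_cont: "continuous_on S w" "continuous_on S w1" "continuous_on S w2" "continuous_on S q"
  using w_deriv w1_deriv' w2_deriv q_deriv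
  by (auto intro!: continuous_at_imp_continuous_on DERIV_isCont)

lemma p_cont: "continuous_on S p"
  unfolding p_def by (intro continuous_intros w_cont continuous_on_compose2[OF f2_cont]) auto

sublocale third_order_system c q p \<Phi>
  by unfold_locales (use c_pos w_cont(4) p_cont Phi_0 Phi_deriv in \<open>auto simp: q_def p_def\<close>)

lemma w1_refl: "w1 (T - x) = - w1 x"
proof -
  have "((\<lambda>x. w (T - x)) has_real_derivative w1 (T - x) * (- 1)) (at x)"
    by (rule DERIV_chain2[OF w_deriv]) (auto intro!: derivative_eq_intros)
  then have "(w has_real_derivative - w1 (T - x)) (at x)" by (simp add: w_refl)
  then show ?thesis using DERIV_unique[OF w_deriv] by fastforce
qed

lemma w_T: "w T = um" "w1 T = 0" "w2 T = k0" "w2 0 = k0" "q T = q 0"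
  using w_refl[of 0] w1_refl[of 0] k0(1) by (auto simp: w_0 w1_0 w2_def q_def)

lemma p_refl: "p (T - x) = - p x" "q (T - x) = q x"
  by (simp_all add: p_def q_def w1_refl w_refl)

definition sg :: "3 \<Rightarrow> complex" where "sg i = (if i = 2 then - 1 else 1)"

lemma sg_simps: "sg 1 = 1" "sg 2 = - 1" "sg 3 = 1"
  by (simp_all add: sg_def)

text \<open>The wave is even about T/2, so x -> T - x maps solutions at -\<mu> to solutions at \<mu>
  and flips the sign of v_x. Hence M(\<mu>) has inverse S M(-\<mu>) S with S = diag(1, -1,
  1).\<close>

lemma monodromy_reflect:
  "\<Phi> T \<mu> $ i $ 1 * (sg 1 * sg j * \<Phi> T (- \<mu>) $ 1 $ j) + \<Phi> T \<mu> $ i $ 2 * (sg 2 * sg j * \<Phi> T (- \<mu>) $ 2 $ j)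
    + \<Phi> T \<mu> $ i $ 3 * (sg 3 * sg j * \<Phi> T (- \<mu>) $ 3 $ j) = (if i = j then 1 else 0)"
proof -
  define Y :: "real \<Rightarrow> complex^3" where
    "Y x = vector [\<phi> (- \<mu>) 1 j (T - x), - \<phi> (- \<mu>) 2 j (T - x), \<phi> (- \<mu>) 3 j (T - x)]" for x
  have ch: "((\<lambda>x. g (T - x)) has_vector_derivative - D) (at x)"
    if "(g has_vector_derivative D) (at (T - x))" for g :: "real \<Rightarrow> complex" and D x
  proof -
    have "((\<lambda>x. T - x) has_vector_derivative - 1) (at x)"
      by (auto intro!: derivative_eq_intros)
    from vector_diff_chain_at[OF this that] show ?thesis by (simp add: o_def)
  qed
  have "sol \<mu> (\<lambda>_. 0) Y"
  proof (rule sol_vec3I)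
    fix x :: real
    show "((\<lambda>x. Y x $ 1) has_vector_derivative Y x $ 2) (at x)"
      unfolding Y_def using ch[OF phi_deriv(1)] by simp
    have "((\<lambda>x. - \<phi> (- \<mu>) 2 j (T - x)) has_vector_derivative - (- \<phi> (- \<mu>) 3 j (T - x))) (at x)"
      by (intro has_vector_derivative_minus ch phi_deriv(2))
    then show "((\<lambda>x. Y x $ 2) has_vector_derivative Y x $ 3) (at x)"
      unfolding Y_def by simp
    have eq: "(- (\<mu> + of_real (p x)) * Y x $ 1 + of_real (q x) * Y x $ 2 + \<mu> * Y x $ 3) / of_real c + 0
      = - ((- (- \<mu> + of_real (p (T - x))) * \<phi> (- \<mu>) 1 j (T - x) + of_real (q (T - x)) * \<phi> (- \<mu>) 2 j (T - x)
          + (- \<mu>) * \<phi> (- \<mu>) 3 j (T - x)) / of_real c)"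
      using c_pos by (simp add: Y_def p_refl field_simps)
    show "((\<lambda>x. Y x $ 3) has_vector_derivative
       (- (\<mu> + of_real (p x)) * Y x $ 1 + of_real (q x) * Y x $ 2 + \<mu> * Y x $ 3) / of_real c + 0) (at x)"
      unfolding eq using ch[OF phi_deriv(3)[where \<mu> = "- \<mu>" and j = j and x = "T - x"]] unfolding Y_def by simp
  qed
  then have YT: "Y T = \<Phi> T \<mu> *v Y 0" using T_pos by (intro sol_Phi) auto
  have "Y T $ i = sg i * (if i = j then 1 else 0)"
    using exhaust_3[of i] by (elim disjE) (simp_all add: Y_def Phi_0 mat_def sg_simps)
  also have "Y T $ i = \<Phi> T \<mu> $ i $ 1 * \<Phi> T (- \<mu>) $ 1 $ j - \<Phi> T \<mu> $ i $ 2 * \<Phi> T (- \<mu>) $ 2 $ j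
     + \<Phi> T \<mu> $ i $ 3 * \<Phi> T (- \<mu>) $ 3 $ j"
    unfolding YT by (simp add: matrix_vector_mult_def sum_3 Y_def)
  finally have e: "\<Phi> T \<mu> $ i $ 1 * \<Phi> T (- \<mu>) $ 1 $ j - \<Phi> T \<mu> $ i $ 2 * \<Phi> T (- \<mu>) $ 2 $ j
     + \<Phi> T \<mu> $ i $ 3 * \<Phi> T (- \<mu>) $ 3 $ j = sg i * (if i = j then 1 else 0)" .
  have "\<Phi> T \<mu> $ i $ 1 * (sg 1 * sg j * \<Phi> T (- \<mu>) $ 1 $ j) + \<Phi> T \<mu> $ i $ 2 * (sg 2 * sg j * \<Phi> T (- \<mu>) $ 2 $ j)
    + \<Phi> T \<mu> $ i $ 3 * (sg 3 * sg j * \<Phi> T (- \<mu>) $ 3 $ j)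
    = sg j * (\<Phi> T \<mu> $ i $ 1 * \<Phi> T (- \<mu>) $ 1 $ j - \<Phi> T \<mu> $ i $ 2 * \<Phi> T (- \<mu>) $ 2 $ j
     + \<Phi> T \<mu> $ i $ 3 * \<Phi> T (- \<mu>) $ 3 $ j)"
    by (simp add: sg_simps algebra_simps)
  also have "\<dots> = (if i = j then 1 else 0)" unfolding e by (simp add: sg_def)
  finally show ?thesis .
qed

lemma evans_monodromy:
  "evans (\<Phi> T) \<mu> \<zeta> = - (\<zeta>^3) + trace (\<Phi> T \<mu>) * \<zeta>^2 - trace (\<Phi> T (- \<mu>)) * exp (of_real (T / c) * \<mu>) * \<zeta>
     + exp (of_real (T / c) * \<mu>)"
proof -
  have d: "det (\<Phi> T \<mu>) = exp (of_real (T / c) * \<mu>)" by (simp add: det_Phi mult.commute)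
  define N where "N i j = sg i * sg j * \<Phi> T (- \<mu>) $ i $ j" for i j
  have m: "(\<Phi> T \<mu>$2$2 * \<Phi> T \<mu>$3$3 - \<Phi> T \<mu>$2$3 * \<Phi> T \<mu>$3$2)
      + (\<Phi> T \<mu>$1$1 * \<Phi> T \<mu>$3$3 - \<Phi> T \<mu>$1$3 * \<Phi> T \<mu>$3$1)
      + (\<Phi> T \<mu>$1$1 * \<Phi> T \<mu>$2$2 - \<Phi> T \<mu>$1$2 * \<Phi> T \<mu>$2$1) = det (\<Phi> T \<mu>) * (N 1 1 + N 2 2 + N 3 3)"
    by (rule principal_minors_inverse) (unfold N_def, rule monodromy_reflect)
  have N: "N 1 1 + N 2 2 + N 3 3 = trace (\<Phi> T (- \<mu>))"
    by (simp add: N_def sg_simps trace_def sum_3)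
  show ?thesis
    unfolding evans_def char_poly_3 m N d by (simp only: mult.commute)
qed

lemma monodromy_cnj: "\<Phi> T (cnj \<mu>) $ i $ j = cnj (\<Phi> T \<mu> $ i $ j)"
proof -
  define Y :: "real \<Rightarrow> complex^3" where
    "Y x = vector [cnj (\<phi> (cnj \<mu>) 1 j x), cnj (\<phi> (cnj \<mu>) 2 j x), cnj (\<phi> (cnj \<mu>) 3 j x)]" for x
  have Yn: "Y x $ i = cnj (\<phi> (cnj \<mu>) i j x)" for x i
    using exhaust_3[of i] by (elim disjE) (simp_all add: Y_def)
  note ch = bounded_linear.has_vector_derivative[OF bounded_linear_cnj]
  have "sol \<mu> (\<lambda>_. 0) Y"
  proof (rule sol_vec3I)
    fix x :: real
    show "((\<lambda>x. Y x $ 1) has_vector_derivative Y x $ 2) (at x)"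
      unfolding Yn by (rule ch[OF phi_deriv(1)])
    show "((\<lambda>x. Y x $ 2) has_vector_derivative Y x $ 3) (at x)"
      unfolding Yn by (rule ch[OF phi_deriv(2)])
    show "((\<lambda>x. Y x $ 3) has_vector_derivative
       (- (\<mu> + of_real (p x)) * Y x $ 1 + of_real (q x) * Y x $ 2 + \<mu> * Y x $ 3) / of_real c + 0) (at x)"
      unfolding Yn using ch[OF phi_deriv(3)[where \<mu> = "cnj \<mu>" and j = j and x = x]] by simp
  qed
  then have YT: "Y T = \<Phi> T \<mu> *v Y 0" using T_pos by (intro sol_Phi) auto
  have "Y 0 = axis j 1" by (simp add: vec_eq_iff Yn Phi_0 mat_def axis_def)
  then have "Y T $ i = \<Phi> T \<mu> $ i $ j" unfolding YT
    by (simp add: matrix_vector_mult_def axis_def if_distrib cong: if_cong)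
  then have "cnj (Y T $ i) = cnj (\<Phi> T \<mu> $ i $ j)" by simp
  then show ?thesis unfolding Yn by simp
qed

section \<open>Conserved functionals and the determinant at \<zeta> = 1\<close>

lemma of_real_vd:
  "(g has_real_derivative D) (at x) \<Longrightarrow> ((\<lambda>x. of_real (g x) :: complex) has_vector_derivative of_real D) (at x)"
  by (rule bounded_linear.has_vector_derivative[OF bounded_linear_of_real])
     (simp add: has_real_derivative_iff_has_vector_derivative)

text \<open>As p = -q', the equation reads (L v)_x = \<mu> (v - v_xx). It is integrated over a
  period, with the v_xx term kept as the boundary contribution \<mu> v_x.\<close>

lemma monodromy_Lv:
  assumes Y: "sol \<mu> (\<lambda>_. 0) Y"
  shows "- of_real c * (Y T $ 3 - Y 0 $ 3) + of_real (q 0) * (Y T $ 1 - Y 0 $ 1) + \<mu> * (Y T $ 2 - Y 0 $ 2)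
    = \<mu> * integral {0..T} (\<lambda>x. Y x $ 1)"
proof -
  have c: "complex_of_real c \<noteq> 0" using c_pos by simp
  define g where "g x = - of_real c * Y x $ 3 + of_real (q x) * Y x $ 1 + \<mu> * Y x $ 2" for x
  have "(g has_vector_derivative \<mu> * Y x $ 1) (at x)" if x: "x \<ge> 0" for x
    unfolding g_def
    by (rule has_vector_derivative_eq_rhs,
        (rule has_vector_derivative_add has_vector_derivative_mult has_vector_derivative_const sol_nth[OF Y x] of_real_vd q_deriv)+)
       (use c in \<open>simp add: field_simps\<close>)
  then have "((\<lambda>x. \<mu> * Y x $ 1) has_integral g T - g 0) {0..T}"
    using T_pos by (intro fundamental_theorem_of_calculus) (auto intro: has_vector_derivative_at_within)
  then have "integral {0..T} (\<lambda>x. \<mu> * Y x $ 1) = g T - g 0" by (rule integral_unique)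
  then show ?thesis by (simp add: g_def w_T algebra_simps)
qed

text \<open>The equation (L v)_x = \<mu> (v - v_xx) is tested against w. Integration by parts and L
  w_x = 0 leave only boundary terms on the left and v (w - w_xx) on the right; subtracting
  \<open>um\<close> times the previous identity leaves only the jump of v.\<close>

lemma monodromy_v:
  assumes Y: "sol \<mu> (\<lambda>_. 0) Y"
  shows "of_real (c * k0) * (Y T $ 1 - Y 0 $ 1)
    = \<mu> * (of_real um * integral {0..T} (\<lambda>x. Y x $ 1) - integral {0..T} (\<lambda>x. Y x $ 1 * of_real (w x - w2 x)))"
proof -
  have c: "complex_of_real c \<noteq> 0" using c_pos by simp
  define g where "g x = of_real (w x) * (- of_real c * Y x $ 3 + of_real (q x) * Y x $ 1) + of_real c * (of_real (w1 x) * Y x $ 2)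
     - of_real c * (of_real (w2 x) * Y x $ 1) + \<mu> * (of_real (w x) * Y x $ 2 - of_real (w1 x) * Y x $ 1)" for x
  have "(g has_vector_derivative \<mu> * (Y x $ 1 * of_real (w x - w2 x))) (at x)" if x: "x \<ge> 0" for x
    unfolding g_def
    by (rule has_vector_derivative_eq_rhs,
        (rule has_vector_derivative_add has_vector_derivative_diff has_vector_derivative_mult has_vector_derivative_const
          sol_nth[OF Y x] of_real_vd q_deriv w_deriv w1_deriv' w2_deriv)+)
       (use c in \<open>simp add: field_simps\<close>)
  then have "((\<lambda>x. \<mu> * (Y x $ 1 * of_real (w x - w2 x))) has_integral g T - g 0) {0..T}"
    using T_pos by (intro fundamental_theorem_of_calculus) (auto intro: has_vector_derivative_at_within)
  then have "integral {0..T} (\<lambda>x. \<mu> * (Y x $ 1 * of_real (w x - w2 x))) = g T - g 0" by (rule integral_unique)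
  moreover define J where "J = integral {0..T} (\<lambda>x. Y x $ 1 * of_real (w x - w2 x))"
  ultimately have "\<mu> * J = g T - g 0" by (simp only: integral_mult_right)
  then have "\<mu> * J
     = of_real um * (- of_real c * (Y T $ 3 - Y 0 $ 3) + of_real (q 0) * (Y T $ 1 - Y 0 $ 1) + \<mu> * (Y T $ 2 - Y 0 $ 2))
      - of_real (c * k0) * (Y T $ 1 - Y 0 $ 1)"
    by (simp add: g_def w_T w_0 w1_0 algebra_simps)
  then show ?thesis unfolding monodromy_Lv[OF Y] J_def[symmetric] by (simp add: algebra_simps)
qed

text \<open>At \<mu> = 0 the two functionals fix rows 1 and 3 as rows of the identity, so the
  determinant, equal to 1, is the remaining diagonal entry.\<close>

lemma trace_monodromy_0: "trace (\<Phi> T 0) = 3"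
proof -
  have ck: "complex_of_real (c * k0) \<noteq> 0" "complex_of_real c \<noteq> 0" using c_pos k0 by auto
  have col: "\<Phi> T 0 $ 1 $ j = mat 1 $ 1 $ j \<and> \<Phi> T 0 $ 3 $ j = mat 1 $ 3 $ j" for j
  proof -
    define Y where "Y x = \<Phi> x 0 *v axis j 1" for x
    have ax: "(M *v axis j 1) $ i = M $ i $ j" for M :: "complex^3^3" and i
      by (simp add: matrix_vector_mult_def axis_def if_distrib cong: if_cong)
    have Y: "sol 0 (\<lambda>_. 0) Y" unfolding Y_def by (rule Phi_sol)
    have 1: "Y T $ 1 - Y 0 $ 1 = 0" using monodromy_v[OF Y] ck by simp
    then have 3: "Y T $ 3 - Y 0 $ 3 = 0" using monodromy_Lv[OF Y] ck by simp
    show ?thesis using 1 3 unfolding Y_def ax Phi_0 by simp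
  qed
  have "det (\<Phi> T 0) = 1" by (simp add: det_Phi)
  moreover have "det (\<Phi> T 0) = \<Phi> T 0 $ 2 $ 2"
    unfolding det_3 by (simp add: col mat_def)
  ultimately show ?thesis by (simp add: trace_def sum_3 col mat_def)
qed

text \<open>The jump of v_x over a period. Together with \<open>li\<close> at the weights 1 and w -
  w_xx it gives the three functionals that encode M - 1.\<close>

definition lv :: "(real \<Rightarrow> complex^3) \<Rightarrow> complex" where "lv Y = Y T $ 2 - Y 0 $ 2"
definition li :: "(real \<Rightarrow> real) \<Rightarrow> (real \<Rightarrow> complex^3) \<Rightarrow> complex" where
  "li g Y = integral {0..T} (\<lambda>x. Y x $ 1 * of_real (g x))"

text \<open>The determinant of M - 1 is computed on three arbitrary initial vectors. By the two
  conservation laws its first and third rows reduce, by row operations, to \<mu> times the integral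
  functionals; this gives the factor \<mu>^2.\<close>

lemma evans_one_times_det:
  fixes y :: "3 \<Rightarrow> complex^3" and \<mu> :: complex
  defines "Y \<equiv> \<lambda>j x. \<Phi> x \<mu> *v y j"
  shows "evans (\<Phi> T) \<mu> 1 * det3 (\<lambda>j. y j $ 1) (\<lambda>j. y j $ 2) (\<lambda>j. y j $ 3)
    = \<mu>^2 / of_real (c^2 * k0) * det3 (\<lambda>j. lv (Y j)) (\<lambda>j. li (\<lambda>_. 1) (Y j)) (\<lambda>j. li (\<lambda>x. w x - w2 x) (Y j))"
proof -
  define C K where "C = complex_of_real c" and "K = complex_of_real k0"
  have CK: "C \<noteq> 0" "K \<noteq> 0" "complex_of_real (c * k0) = C * K" "complex_of_real (c^2 * k0) = C^2 * K"
    using c_pos k0 by (auto simp: C_def K_def)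
  have s: "sol \<mu> (\<lambda>_. 0) (Y j)" for j unfolding Y_def by (rule Phi_sol)
  have Y0: "Y j 0 = y j" for j by (simp add: Y_def Phi_0)
  define d where "d i j = Y j T $ i - y j $ i" for i j
  define b where "b j = lv (Y j)" for j
  define m1 where "m1 j = li (\<lambda>_. 1) (Y j)" for j
  define m2 where "m2 j = li (\<lambda>x. w x - w2 x) (Y j)" for j
  have d2: "d 2 j = b j" for j by (simp add: d_def b_def lv_def Y0)
  have "C * K * d 1 j = \<mu> * (of_real um * m1 j - m2 j)" for j
    using monodromy_v[OF s[of j]] by (simp add: d_def m1_def m2_def li_def Y0 CK C_def K_def)
  then have d1: "d 1 j = \<mu> * (of_real um * m1 j - m2 j) / (C * K)" for j
    using CK by (simp add: field_simps)
  have "- C * d 3 j + of_real (q 0) * d 1 j + \<mu> * b j = \<mu> * m1 j" for j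
    using monodromy_Lv[OF s[of j]] by (simp add: d_def b_def lv_def m1_def li_def Y0 C_def)
  then have "C * d 3 j = of_real (q 0) * d 1 j + \<mu> * b j - \<mu> * m1 j" for j
    by (simp add: algebra_simps)
  then have d3: "d 3 j = (of_real (q 0) * d 1 j + \<mu> * b j - \<mu> * m1 j) / C" for j
    using CK by (simp add: field_simps)
  have "evans (\<Phi> T) \<mu> 1 * det3 (\<lambda>j. y j $ 1) (\<lambda>j. y j $ 2) (\<lambda>j. y j $ 3)
     = det ((\<Phi> T \<mu> - mat 1) ** (\<chi> i j. (if i = 1 then y j $ 1 else if i = 2 then y j $ 2 else y j $ 3)))"
    by (simp add: evans_def det3_def det_mul)
  also have "(\<Phi> T \<mu> - mat 1) ** (\<chi> i j. (if i = 1 then y j $ 1 else if i = 2 then y j $ 2 else y j $ 3))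
     = (\<chi> i j. d i j)"
    by (simp add: vec_eq_iff matrix_matrix_mult_def sum_3 d_def Y_def matrix_vector_mult_def mat_def forall_3 algebra_simps)
  also have "det (\<chi> i j. d i j) = det3 (d 1) (d 2) (d 3)" by (simp add: det3_eq det_3)
  also have "\<dots> = \<mu> / (C * K) * (\<mu> / C) * det3 b m1 m2"
    unfolding det3_eq d3 d2 d1 using CK(1,2) by (simp add: field_simps)
  finally show ?thesis unfolding b_def m1_def m2_def CK(4) by (simp add: power2_eq_square mult_ac)
qed

text \<open>A uniform quadratic remainder of the solutions passes to the functionals, since the
  integrals run over a fixed compact interval.\<close>

lemma li_lim:
  assumes W: "\<And>\<nu>. continuous_on {0..T} (W \<nu>)" and Y: "continuous_on {0..T} Y" and Z: "continuous_on {0..T} Z"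
    and g: "continuous_on {0..T} g"
    and C: "\<And>\<nu> x. norm \<nu> \<le> 1 \<Longrightarrow> x \<in> {0..T} \<Longrightarrow> norm (W \<nu> x - Y x - \<nu> *s Z x) \<le> C * (norm \<nu>)\<^sup>2"
  shows "((\<lambda>\<nu>. (li g (W \<nu>) - li g Y) / \<nu>) \<longlongrightarrow> li g Z) (at 0)"
    and "((\<lambda>\<nu>. (lv (W \<nu>) - lv Y) / \<nu>) \<longlongrightarrow> lv Z) (at 0)"
proof -
  obtain Bg where Bg: "Bg \<ge> 0" "\<forall>x\<in>{0..T}. norm (g x) \<le> Bg"
    using continuous_on_Icc_bounded[OF g] by blast
  have C0: "C \<ge> 0" using C[of 1 0] T_pos order_trans[OF norm_ge_zero, of "W 1 0 - Y 0 - 1 *s Z 0" C] by simp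
  have lim0: "((\<lambda>\<nu>. (F \<nu> - F0) / \<nu>) \<longlongrightarrow> F1) (at 0)"
    if b: "\<And>\<nu>. norm \<nu> \<le> 1 \<Longrightarrow> norm (F \<nu> - F0 - \<nu> * F1) \<le> K * (norm \<nu>)\<^sup>2" for F :: "complex \<Rightarrow> complex" and F0 F1 K
  proof -
    have "((\<lambda>\<nu>. (F \<nu> - F0) / \<nu> - F1) \<longlongrightarrow> 0) (at 0)"
    proof (rule Lim_null_comparison)
      have "\<forall>\<^sub>F \<nu> in at 0. norm \<nu> < (1::real) \<and> \<nu> \<noteq> (0::complex)"
        unfolding eventually_at by (intro exI[of _ 1]) auto
      then show "\<forall>\<^sub>F \<nu> in at 0. norm ((F \<nu> - F0) / \<nu> - F1) \<le> K * norm \<nu>"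
      proof eventually_elim
        case (elim \<nu>)
        have "(F \<nu> - F0) / \<nu> - F1 = (F \<nu> - F0 - \<nu> * F1) / \<nu>" using elim by (simp add: field_simps)
        then have "norm ((F \<nu> - F0) / \<nu> - F1) = norm (F \<nu> - F0 - \<nu> * F1) / norm \<nu>" by (simp only: norm_divide)
        also have "\<dots> \<le> K * (norm \<nu>)\<^sup>2 / norm \<nu>" using b elim by (intro divide_right_mono) auto
        finally show ?case using elim by (simp add: power2_eq_square)
      qed
    qed (auto intro!: tendsto_eq_intros)
    then show ?thesis by (simp only: Lim_null[symmetric])
  qed
  have n1: "norm (W \<nu> x $ i - Y x $ i - \<nu> * Z x $ i) \<le> C * (norm \<nu>)\<^sup>2" if "norm \<nu> \<le> 1" "x \<in> {0..T}" for \<nu> x i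
    using order_trans[OF Finite_Cartesian_Product.norm_nth_le[of "W \<nu> x - Y x - \<nu> *s Z x" i] C[OF that]] by simp
  show "((\<lambda>\<nu>. (lv (W \<nu>) - lv Y) / \<nu>) \<longlongrightarrow> lv Z) (at 0)"
  proof (rule lim0)
    fix \<nu> :: complex assume n: "norm \<nu> \<le> 1"
    have "lv (W \<nu>) - lv Y - \<nu> * lv Z = (W \<nu> T $ 2 - Y T $ 2 - \<nu> * Z T $ 2) - (W \<nu> 0 $ 2 - Y 0 $ 2 - \<nu> * Z 0 $ 2)"
      by (simp add: lv_def algebra_simps)
    also have "norm \<dots> \<le> C * (norm \<nu>)\<^sup>2 + C * (norm \<nu>)\<^sup>2"
      by (rule order_trans[OF norm_triangle_ineq4 add_mono[OF n1[OF n] n1[OF n]]]) (use T_pos in auto)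
    finally show "norm (lv (W \<nu>) - lv Y - \<nu> * lv Z) \<le> (2 * C) * (norm \<nu>)\<^sup>2" by simp
  qed
  show "((\<lambda>\<nu>. (li g (W \<nu>) - li g Y) / \<nu>) \<longlongrightarrow> li g Z) (at 0)"
  proof (rule lim0)
    fix \<nu> :: complex assume n: "norm \<nu> \<le> 1"
    have int: "(\<lambda>x. V x $ 1 * of_real (g x)) integrable_on {0..T}" if "continuous_on {0..T} V" for V :: "real \<Rightarrow> complex^3"
      by (intro integrable_continuous_interval continuous_intros that g)
    have "li g (W \<nu>) - li g Y - \<nu> * li g Z = integral {0..T} (\<lambda>x. W \<nu> x $ 1 * of_real (g x) - Y x $ 1 * of_real (g x) - \<nu> * (Z x $ 1 * of_real (g x)))"
      unfolding li_def
      by (subst integral_diff integral_mult_right; (intro integrable_diff integrable_on_mult_right int W Y Z)?)+ simp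
    also have "norm \<dots> \<le> (C * (norm \<nu>)\<^sup>2 * Bg) * (T - 0)"
    proof (rule integral_bound)
      show "0 \<le> T" using T_pos by simp
      show "continuous_on {0..T} (\<lambda>x. W \<nu> x $ 1 * of_real (g x) - Y x $ 1 * of_real (g x) - \<nu> * (Z x $ 1 * of_real (g x)))"
        by (intro continuous_intros W Y Z g)
      fix x assume x: "x \<in> {0..T}"
      have "W \<nu> x $ 1 * of_real (g x) - Y x $ 1 * of_real (g x) - \<nu> * (Z x $ 1 * of_real (g x))
         = (W \<nu> x $ 1 - Y x $ 1 - \<nu> * Z x $ 1) * of_real (g x)" by (simp add: algebra_simps)
      then have "norm (W \<nu> x $ 1 * of_real (g x) - Y x $ 1 * of_real (g x) - \<nu> * (Z x $ 1 * of_real (g x)))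
         = norm (W \<nu> x $ 1 - Y x $ 1 - \<nu> * Z x $ 1) * norm (g x)" by (simp add: norm_mult)
      also have "\<dots> \<le> C * (norm \<nu>)\<^sup>2 * Bg"
        using n1[OF n x] Bg x C0 by (intro mult_mono) auto
      finally show "norm (W \<nu> x $ 1 * of_real (g x) - Y x $ 1 * of_real (g x) - \<nu> * (Z x $ 1 * of_real (g x))) \<le> C * (norm \<nu>)\<^sup>2 * Bg" .
    qed
    finally show "norm (li g (W \<nu>) - li g Y - \<nu> * li g Z) \<le> (C * Bg * T) * (norm \<nu>)\<^sup>2" by (simp add: mult_ac)
  qed
qed

text \<open>The profile equation differentiated in a parameter: (h1, h3) = (1, 0), (0, 0), (0, 1)
  are the directions a, E, c. The number d is the derivative of the trough value, and the slope
  starts at 0 because every wave starts at its trough.\<close>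

definition variational :: "real \<Rightarrow> real \<Rightarrow> real \<Rightarrow> (real \<Rightarrow> real) \<Rightarrow> (real \<Rightarrow> real) \<Rightarrow> bool" where
  "variational h1 h3 d U U1 \<longleftrightarrow> U 0 = d \<and> U1 0 = 0 \<and>
     (\<forall>x\<ge>0. (U has_real_derivative U1 x) (at x) \<and>
       (U1 has_real_derivative (q x * U x + h1 + h3 * (w x - w2 x)) / c) (at x))"

definition vec_of :: "real \<Rightarrow> real \<Rightarrow> (real \<Rightarrow> real) \<Rightarrow> (real \<Rightarrow> real) \<Rightarrow> real \<Rightarrow> complex^3" where
  "vec_of h1 h3 U U1 x = vector [of_real (U x), of_real (U1 x), of_real ((q x * U x + h1 + h3 * (w x - w2 x)) / c)]"

text \<open>One x-derivative removes \<open>h1\<close> and turns \<open>h3\<close> into a multiple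
  of w_x - w_xxx. For h3 = 1 this is minus the forcing that the translation mode produces at first
  order in \<mu>, so -u_c is the generalised eigenvector above w_x.\<close>

lemma variational_sol:
  assumes "variational h1 h3 d U U1"
  shows "sol 0 (\<lambda>x. of_real (h3 * (w1 x - q x * w1 x / c) / c)) (vec_of h1 h3 U U1)"
proof (rule sol_vec3I)
  fix x :: real assume x: "x \<ge> 0"
  have d: "(U has_real_derivative U1 x) (at x)" "(U1 has_real_derivative (q x * U x + h1 + h3 * (w x - w2 x)) / c) (at x)"
    using assms x by (auto simp: variational_def)
  show "((\<lambda>x. vec_of h1 h3 U U1 x $ 1) has_vector_derivative vec_of h1 h3 U U1 x $ 2) (at x)"
    "((\<lambda>x. vec_of h1 h3 U U1 x $ 2) has_vector_derivative vec_of h1 h3 U U1 x $ 3) (at x)"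
    unfolding vec_of_def using of_real_vd[OF d(1)] of_real_vd[OF d(2)] by simp_all
  have "((\<lambda>x. q x * U x + h1 + h3 * (w x - w2 x)) has_real_derivative
      (- p x) * U x + q x * U1 x + h3 * (w1 x - q x * w1 x / c)) (at x)"
    by (auto intro!: derivative_eq_intros q_deriv d w_deriv w2_deriv)
  from of_real_vd[OF DERIV_cdivide[OF this, of c]]
  show "((\<lambda>x. vec_of h1 h3 U U1 x $ 3) has_vector_derivative
     (- (0 + of_real (p x)) * vec_of h1 h3 U U1 x $ 1 + of_real (q x) * vec_of h1 h3 U U1 x $ 2
       + 0 * vec_of h1 h3 U U1 x $ 3) / of_real c + of_real (h3 * (w1 x - q x * w1 x / c) / c)) (at x)"
    unfolding vec_of_def by (simp add: add_divide_distrib)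
qed

text \<open>The differentiated equation is solved by variation of constants and integrated back
  once: the quantity \<open>g\<close> is constant, and the third entry of \<open>z0\<close> is
  chosen so that this constant is \<open>- h1\<close>.\<close>

lemma variational_exists: "\<exists>U U1. variational h1 h3 d U U1"
proof -
  define \<rho> where "\<rho> x = complex_of_real (h3 * (w1 x - q x * w1 x / c) / c)" for x
  define z0 :: "complex^3" where "z0 = vector [of_real d, 0, of_real ((q 0 * d + h1 + h3 * (um - k0)) / c)]"
  have "continuous_on S \<rho>" for S
    unfolding \<rho>_def using c_pos by (intro continuous_intros w_cont) auto
  then obtain Z where Z: "sol 0 \<rho> Z" "Z 0 = z0" by (rule duhamel)
  have c: "complex_of_real c \<noteq> 0" using c_pos by simp
  define g where "g x = - of_real c * Z x $ 3 + of_real (q x) * Z x $ 1 + of_real h3 * of_real (w x - w2 x)" for x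
  have "(g has_vector_derivative 0) (at x)" if x: "x \<ge> 0" for x
    unfolding g_def of_real_diff
    by (rule has_vector_derivative_eq_rhs,
        (rule has_vector_derivative_add has_vector_derivative_diff has_vector_derivative_mult has_vector_derivative_const
          sol_nth[OF Z(1) x] of_real_vd q_deriv w_deriv w2_deriv)+)
       (use c in \<open>simp add: field_simps \<rho>_def\<close>)
  then have gd: "\<And>x. x \<in> {0..} \<Longrightarrow> (g has_vector_derivative 0) (at x within {0..})"
    by (simp add: has_vector_derivative_at_within)
  obtain k where "\<And>x. x \<in> {0..} \<Longrightarrow> g x = k"
    by (rule has_vector_derivative_zero_constant[OF _ gd]) auto
  then have "g x = g 0" if "x \<ge> 0" for x using that by simp
  moreover have "g 0 = - of_real h1" using c by (simp add: g_def Z(2) z0_def w_0 w_T field_simps)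
  ultimately have g: "g x = - of_real h1" if "x \<ge> 0" for x using that by simp
  have Z3: "Z x $ 3 = (of_real (q x) * Z x $ 1 + of_real h1 + of_real (h3 * (w x - w2 x))) / of_real c" if "x \<ge> 0" for x
    using g[OF that] c by (simp add: g_def field_simps)
  have re: "((\<lambda>x. Re (h x)) has_real_derivative Re D) (at x)" if "(h has_vector_derivative D) (at x)" for h D x
    using bounded_linear.has_vector_derivative[OF bounded_linear_Re that]
    by (simp add: has_real_derivative_iff_has_vector_derivative)
  have "variational h1 h3 d (\<lambda>x. Re (Z x $ 1)) (\<lambda>x. Re (Z x $ 2))"
    unfolding variational_def
  proof (intro conjI allI impI)
    fix x :: real assume x: "x \<ge> 0"
    show "((\<lambda>x. Re (Z x $ 1)) has_real_derivative Re (Z x $ 2)) (at x)"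
      by (rule re[OF sol_nth(1)[OF Z(1) x]])
    have "Re (Z x $ 3) = (q x * Re (Z x $ 1) + h1 + h3 * (w x - w2 x)) / c"
      unfolding Z3[OF x] Re_divide_of_real by simp
    then show "((\<lambda>x. Re (Z x $ 2)) has_real_derivative (q x * Re (Z x $ 1) + h1 + h3 * (w x - w2 x)) / c) (at x)"
      using re[OF sol_nth(2)[OF Z(1) x]] by simp
  qed (simp_all add: Z(2) z0_def)
  then show ?thesis by blast
qed

definition rv :: "(real \<Rightarrow> real) \<Rightarrow> real" where "rv U1 = U1 T"
definition ri :: "(real \<Rightarrow> real) \<Rightarrow> (real \<Rightarrow> real) \<Rightarrow> real" where "ri g U = integral {0..T} (\<lambda>x. U x * g x)"

lemma variational_cont:
  assumes "variational h1 h3 d U U1"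
  shows "continuous_on {0..b} U" "continuous_on {0..b} U1"
  using assms unfolding variational_def
  by (auto intro!: continuous_at_imp_continuous_on DERIV_isCont)

lemma lv_vec_of: "variational h1 h3 d U U1 \<Longrightarrow> lv (vec_of h1 h3 U U1) = of_real (rv U1)"
  by (simp add: lv_def vec_of_def rv_def variational_def)

lemma li_vec_of:
  assumes "variational h1 h3 d U U1" "continuous_on {0..T} g"
  shows "li g (vec_of h1 h3 U U1) = of_real (ri g U)"
proof -
  have "(\<lambda>x. U x * g x) integrable_on {0..T}"
    by (intro integrable_continuous_interval continuous_intros variational_cont[OF assms(1)] assms(2))
  have "((\<lambda>x. complex_of_real (U x * g x)) has_integral of_real (integral {0..T} (\<lambda>x. U x * g x))) {0..T}"
    by (rule has_integral_of_real[OF integrable_integral]) fact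
  from integral_unique[OF this] show ?thesis unfolding li_def ri_def by (simp add: vec_of_def)
qed

lemma branch_lim:
  assumes Y: "sol 0 (\<lambda>_. 0) Y" and Z: "sol 0 (\<lambda>x. (Y x $ 3 - Y x $ 1) / of_real c) Z"
    and g: "continuous_on {0..T} g"
  shows "((\<lambda>\<nu>. (li g (\<lambda>x. \<Phi> x \<nu> *v (Y 0 + \<nu> *s Z 0)) - li g Y) / \<nu>) \<longlongrightarrow> li g Z) (at 0)"
    and "((\<lambda>\<nu>. (lv (\<lambda>x. \<Phi> x \<nu> *v (Y 0 + \<nu> *s Z 0)) - lv Y) / \<nu>) \<longlongrightarrow> lv Z) (at 0)"
proof -
  obtain C where C: "\<forall>\<nu> x. norm (\<nu> - 0) \<le> 1 \<longrightarrow> x \<in> {0..T} \<longrightarrow>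
     norm (\<Phi> x \<nu> *v (Y 0 + (\<nu> - 0) *s Z 0) - Y x - (\<nu> - 0) *s Z x) \<le> C * (norm (\<nu> - 0))\<^sup>2"
    using sol_expansion[OF Y Z, of T] by (elim exE conjE) (rule that)
  have C': "norm (\<Phi> x \<nu> *v (Y 0 + \<nu> *s Z 0) - Y x - \<nu> *s Z x) \<le> C * (norm \<nu>)\<^sup>2"
    if "norm \<nu> \<le> 1" "x \<in> {0..T}" for \<nu> x
    using C[rule_format, of \<nu> x] that by simp
  note l = li_lim[where W = "\<lambda>\<nu> x. \<Phi> x \<nu> *v (Y 0 + \<nu> *s Z 0)", OF sol_cont[OF Phi_sol] sol_cont[OF Y] sol_cont[OF Z] g C']
  show "((\<lambda>\<nu>. (li g (\<lambda>x. \<Phi> x \<nu> *v (Y 0 + \<nu> *s Z 0)) - li g Y) / \<nu>) \<longlongrightarrow> li g Z) (at 0)"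
    by (rule l(1))
  show "((\<lambda>\<nu>. (lv (\<lambda>x. \<Phi> x \<nu> *v (Y 0 + \<nu> *s Z 0)) - lv Y) / \<nu>) \<longlongrightarrow> lv Z) (at 0)"
    by (rule l(2))
qed

lemma homogeneous_lim:
  assumes U: "variational h1 0 d U U1" and g: "continuous_on {0..T} g"
  shows "((\<lambda>\<nu>. li g (\<lambda>x. \<Phi> x \<nu> *v vec_of h1 0 U U1 0)) \<longlongrightarrow> of_real (ri g U)) (at 0)"
    and "((\<lambda>\<nu>. lv (\<lambda>x. \<Phi> x \<nu> *v vec_of h1 0 U U1 0)) \<longlongrightarrow> of_real (rv U1)) (at 0)"
proof -
  define Y where "Y = vec_of h1 0 U U1"
  have Y: "sol 0 (\<lambda>_. 0) Y"
    unfolding Y_def by (rule sol_cong[OF variational_sol[OF U]]) simp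
  have Yc: "continuous_on S (\<lambda>x. (\<Phi> x 0 *v Y 0) $ 3 - (\<Phi> x 0 *v Y 0) $ 1)" for S
    unfolding matrix_vector_mult_def sum_3 by (simp, intro continuous_intros phi_cont)
  have YP: "Y x = \<Phi> x 0 *v Y 0" if "x \<ge> 0" for x by (rule sol_Phi[OF Y that])
  \<comment> \<open>Variation of constants needs a forcing continuous on the whole line, whereas
    \<open>Y\<close> is controlled only for x \<ge> 0; hence the forcing is written through
    \<open>\<Phi>\<close>, which agrees with \<open>Y\<close> there.\<close>
  obtain Z where Z': "sol 0 (\<lambda>x. ((\<Phi> x 0 *v Y 0) $ 3 - (\<Phi> x 0 *v Y 0) $ 1) / of_real c) Z" and Z0: "Z 0 = 0"
    by (rule duhamel[of "\<lambda>x. ((\<Phi> x 0 *v Y 0) $ 3 - (\<Phi> x 0 *v Y 0) $ 1) / of_real c"])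
       (use c_pos in \<open>intro continuous_on_divide Yc continuous_on_const; simp\<close>)
  have Z: "sol 0 (\<lambda>x. (Y x $ 3 - Y x $ 1) / of_real c) Z"
    using Z' unfolding sol_def by (simp add: YP[symmetric])
  have conv: "((\<lambda>\<nu>. h \<nu>) \<longlongrightarrow> h0) (at 0)" if "((\<lambda>\<nu>. (h \<nu> - h0) / \<nu>) \<longlongrightarrow> l) (at 0)" for h :: "complex \<Rightarrow> complex" and h0 l
  proof -
    have "((\<lambda>\<nu>. (h \<nu> - h0) / \<nu> * \<nu> + h0) \<longlongrightarrow> l * 0 + h0) (at 0)"
      by (intro tendsto_intros that)
    then have "((\<lambda>\<nu>. h \<nu>) \<longlongrightarrow> l * 0 + h0) (at 0)"
      by (rule Lim_transform_eventually) (simp add: eventually_at_filter)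
    then show ?thesis by simp
  qed
  have y: "Y 0 + \<nu> *s Z 0 = vec_of h1 0 U U1 0" for \<nu> by (simp add: Z0 Y_def)
  show "((\<lambda>\<nu>. li g (\<lambda>x. \<Phi> x \<nu> *v vec_of h1 0 U U1 0)) \<longlongrightarrow> of_real (ri g U)) (at 0)"
    using conv[OF branch_lim(1)[OF Y Z g]] unfolding y unfolding Y_def li_vec_of[OF U g] .
  show "((\<lambda>\<nu>. lv (\<lambda>x. \<Phi> x \<nu> *v vec_of h1 0 U U1 0)) \<longlongrightarrow> of_real (rv U1)) (at 0)"
    using conv[OF branch_lim(2)[OF Y Z g]] unfolding y unfolding Y_def lv_vec_of[OF U] .
qed

definition Yt :: "real \<Rightarrow> complex^3" where "Yt x = vector [of_real (w1 x), of_real (w2 x), of_real (q x * w1 x / c)]"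

lemma Yt_sol: "sol 0 (\<lambda>_. 0) Yt"
proof (rule sol_vec3I)
  fix x :: real
  show "((\<lambda>x. Yt x $ 1) has_vector_derivative Yt x $ 2) (at x)" "((\<lambda>x. Yt x $ 2) has_vector_derivative Yt x $ 3) (at x)"
    unfolding Yt_def using of_real_vd[OF w1_deriv'] of_real_vd[OF w2_deriv] by simp_all
  have "((\<lambda>x. q x * w1 x) has_real_derivative - p x * w1 x + q x * w2 x) (at x)"
    by (auto intro!: derivative_eq_intros q_deriv w1_deriv')
  from of_real_vd[OF DERIV_cdivide[OF this, of c]]
  show "((\<lambda>x. Yt x $ 3) has_vector_derivative
     (- (0 + of_real (p x)) * Yt x $ 1 + of_real (q x) * Yt x $ 2 + 0 * Yt x $ 3) / of_real c + 0) (at x)"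
    unfolding Yt_def by simp
qed

text \<open>The mode w_x and its derivative have equal values at 0 and T, and both integrands are
  total derivatives, of w and of (w^2 - w_x^2) / 2, whose values at 0 and T agree.\<close>

lemma Yt_functionals: "lv Yt = 0" "li (\<lambda>_. 1) Yt = 0" "li (\<lambda>x. w x - w2 x) Yt = 0"
proof -
  show "lv Yt = 0" by (simp add: lv_def Yt_def w_T)
  have "((\<lambda>x. Yt x $ 1 * of_real 1) has_integral of_real (w T) - of_real (w 0)) {0..T}"
    using T_pos by (intro fundamental_theorem_of_calculus)
      (auto simp: Yt_def intro!: has_vector_derivative_at_within of_real_vd w_deriv)
  then show "li (\<lambda>_. 1) Yt = 0" by (simp add: li_def integral_unique w_T w_0)
  have "((\<lambda>x. ((w x)\<^sup>2 - (w1 x)\<^sup>2) / 2) has_real_derivative w1 x * (w x - w2 x)) (at x)" for x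
    by (auto intro!: derivative_eq_intros w_deriv w1_deriv' simp: field_simps)
  from of_real_vd[OF this]
  have "((\<lambda>x. of_real (w1 x * (w x - w2 x)) :: complex) has_integral of_real (((w T)\<^sup>2 - (w1 T)\<^sup>2) / 2) - of_real (((w 0)\<^sup>2 - (w1 0)\<^sup>2) / 2)) {0..T}"
    using T_pos by (intro fundamental_theorem_of_calculus) (auto intro: has_vector_derivative_at_within)
  then have "integral {0..T} (\<lambda>x. of_real (w1 x * (w x - w2 x)) :: complex) = 0"
    by (simp add: integral_unique w_T w_0 w1_0)
  then show "li (\<lambda>x. w x - w2 x) Yt = 0" by (simp add: li_def Yt_def)
qed

text \<open>The zeroth-order terms vanish, so division by \<mu> leaves the functionals of the
  first-order term, which is minus the c-variation.\<close>

lemma translation_lim: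
  assumes U: "variational 0 1 d U U1" and g: "continuous_on {0..T} g" "li g Yt = 0"
  shows "((\<lambda>\<nu>. li g (\<lambda>x. \<Phi> x \<nu> *v (Yt 0 + \<nu> *s ((- 1) *s vec_of 0 1 U U1 0))) / \<nu>) \<longlongrightarrow> - of_real (ri g U)) (at 0)"
    and "((\<lambda>\<nu>. lv (\<lambda>x. \<Phi> x \<nu> *v (Yt 0 + \<nu> *s ((- 1) *s vec_of 0 1 U U1 0))) / \<nu>) \<longlongrightarrow> - of_real (rv U1)) (at 0)"
proof -
  define Z where "Z x = (- 1) *s vec_of 0 1 U U1 x" for x
  have Z: "sol 0 (\<lambda>x. (Yt x $ 3 - Yt x $ 1) / of_real c) Z"
    unfolding Z_def by (rule sol_cong[OF sol_scale[OF variational_sol[OF U]]]) (simp add: Yt_def diff_divide_distrib)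
  have "li g Z = - li g (vec_of 0 1 U U1)" "lv Z = - lv (vec_of 0 1 U U1)"
    by (simp_all add: li_def lv_def Z_def)
  then have "li g Z = - of_real (ri g U)" "lv Z = - of_real (rv U1)"
    by (simp_all add: li_vec_of[OF U g(1)] lv_vec_of[OF U])
  then show "((\<lambda>\<nu>. li g (\<lambda>x. \<Phi> x \<nu> *v (Yt 0 + \<nu> *s ((- 1) *s vec_of 0 1 U U1 0))) / \<nu>) \<longlongrightarrow> - of_real (ri g U)) (at 0)"
    "((\<lambda>\<nu>. lv (\<lambda>x. \<Phi> x \<nu> *v (Yt 0 + \<nu> *s ((- 1) *s vec_of 0 1 U U1 0))) / \<nu>) \<longlongrightarrow> - of_real (rv U1)) (at 0)"
    using branch_lim[OF Yt_sol Z g(1)] by (simp_all only: g(2) Yt_functionals(1) diff_zero Z_def)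
qed

text \<open>Two factors \<mu> come from the rows and one from the column of the translation mode;
  the other two columns are the a- and E-variations.\<close>

lemma evans_cubic_coefficient:
  assumes Ua: "variational 1 0 da Ua Ua1" and Ue: "variational 0 0 de Ue Ue1" and Uc: "variational 0 1 dc Uc Uc1"
    and de: "de = - 1 / (c * k0)"
  defines "J \<equiv> \<lambda>l. (\<lambda>j::3. if j = 1 then l Ua Ua1 else if j = 2 then l Ue Ue1 else l Uc Uc1 :: real)"
  shows "((\<lambda>\<mu>. evans (\<Phi> T) \<mu> 1 / \<mu>^3) \<longlongrightarrow>
     of_real (1 / k0 * det3 (J (\<lambda>U U1. rv U1)) (J (\<lambda>U U1. ri (\<lambda>_. 1) U)) (J (\<lambda>U U1. ri (\<lambda>x. w x - w2 x) U)))) (at 0)"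
proof -
  define C K where "C = complex_of_real c" and "K = complex_of_real k0"
  have CK: "C \<noteq> 0" "K \<noteq> 0" using c_pos k0 by (auto simp: C_def K_def)
  define y where "y \<mu> j = (if j = (1::3) then Yt 0 + \<mu> *s ((- 1) *s vec_of 0 1 Uc Uc1 0)
     else if j = 2 then vec_of 1 0 Ua Ua1 0 else vec_of 0 0 Ue Ue1 0)" for \<mu> j
  define W where "W \<mu> j x = \<Phi> x \<mu> *v y \<mu> j" for \<mu> j x
  define D0 where "D0 \<mu> = det3 (\<lambda>j. y \<mu> j $ 1) (\<lambda>j. y \<mu> j $ 2) (\<lambda>j. y \<mu> j $ 3)" for \<mu>
  have U0: "Ua 0 = da" "Ua1 0 = 0" "Ue 0 = de" "Ue1 0 = 0" "Uc 0 = dc" "Uc1 0 = 0"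
    using Ua Ue Uc by (auto simp: variational_def)
  have y1: "y \<mu> 1 = vector [- \<mu> * of_real dc, K, - \<mu> * of_real ((q 0 * dc + (um - k0)) / c)]" for \<mu>
    by (simp add: y_def vec3_eq_iff Yt_def vec_of_def U0 w_0 w1_0 w_T K_def)
  have y2: "y \<mu> 2 = vector [of_real da, 0, of_real ((q 0 * da + 1) / c)]" for \<mu>
    by (simp add: y_def vec3_eq_iff vec_of_def U0)
  have y3: "y \<mu> 3 = vector [of_real de, 0, of_real (q 0 * de / c)]" for \<mu>
    by (simp add: y_def vec3_eq_iff vec_of_def U0)
  \<comment> \<open>The initial vectors have a determinant independent of \<mu>: expansion along the
    second row leaves \<open>k0 * de / c\<close>, and \<open>de\<close> is the E-derivative of the
    trough value.\<close>
  have D0: "D0 \<mu> = - 1 / C^2" for \<mu>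
    unfolding D0_def det3_eq y1 y2 y3 vector_3 de using c_pos k0
    by (simp add: C_def K_def field_simps power2_eq_square)
  have e: "evans (\<Phi> T) \<mu> 1 / \<mu>^3 = - 1 / K * det3 (\<lambda>j. if j = 1 then lv (W \<mu> j) / \<mu> else lv (W \<mu> j))
      (\<lambda>j. if j = 1 then li (\<lambda>_. 1) (W \<mu> j) / \<mu> else li (\<lambda>_. 1) (W \<mu> j))
      (\<lambda>j. if j = 1 then li (\<lambda>x. w x - w2 x) (W \<mu> j) / \<mu> else li (\<lambda>x. w x - w2 x) (W \<mu> j))" if "\<mu> \<noteq> 0" for \<mu>
  proof -
    have "evans (\<Phi> T) \<mu> 1 * D0 \<mu> = \<mu>^2 / (C^2 * K) * det3 (\<lambda>j. lv (W \<mu> j)) (\<lambda>j. li (\<lambda>_. 1) (W \<mu> j)) (\<lambda>j. li (\<lambda>x. w x - w2 x) (W \<mu> j))"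
      unfolding D0_def W_def C_def K_def using evans_one_times_det[of \<mu> "y \<mu>"] by simp
    then have eq: "evans (\<Phi> T) \<mu> 1 * (- 1 / C^2) = \<mu>^2 / (C^2 * K) * det3 (\<lambda>j. lv (W \<mu> j)) (\<lambda>j. li (\<lambda>_. 1) (W \<mu> j)) (\<lambda>j. li (\<lambda>x. w x - w2 x) (W \<mu> j))"
      unfolding D0 .
    have "evans (\<Phi> T) \<mu> 1 = - (C^2) * (evans (\<Phi> T) \<mu> 1 * (- 1 / C^2))" using CK by simp
    also have "\<dots> = - (\<mu>^2) / K * det3 (\<lambda>j. lv (W \<mu> j)) (\<lambda>j. li (\<lambda>_. 1) (W \<mu> j)) (\<lambda>j. li (\<lambda>x. w x - w2 x) (W \<mu> j))"
      unfolding eq using CK by (simp add: field_simps)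
    finally have E: "evans (\<Phi> T) \<mu> 1 = - (\<mu>^2) / K * det3 (\<lambda>j. lv (W \<mu> j)) (\<lambda>j. li (\<lambda>_. 1) (W \<mu> j)) (\<lambda>j. li (\<lambda>x. w x - w2 x) (W \<mu> j))" .
    show ?thesis unfolding E using that CK by (simp add: det3_eq field_simps power2_eq_square power3_eq_cube)
  qed
  have gc: "continuous_on {0..T} (\<lambda>x. w x - w2 x)" "continuous_on {0..T} (\<lambda>_. 1::real)"
    by (intro continuous_intros w_cont)+
  have W1: "W \<mu> 1 = (\<lambda>x. \<Phi> x \<mu> *v (Yt 0 + \<mu> *s ((- 1) *s vec_of 0 1 Uc Uc1 0)))"
    and W2: "W \<mu> 2 = (\<lambda>x. \<Phi> x \<mu> *v vec_of 1 0 Ua Ua1 0)" and W3: "W \<mu> 3 = (\<lambda>x. \<Phi> x \<mu> *v vec_of 0 0 Ue Ue1 0)" for \<mu>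
    by (simp_all add: W_def[abs_def] y_def)
  have "((\<lambda>\<mu>. - 1 / K * det3 (\<lambda>j. if j = 1 then lv (W \<mu> j) / \<mu> else lv (W \<mu> j))
      (\<lambda>j. if j = 1 then li (\<lambda>_. 1) (W \<mu> j) / \<mu> else li (\<lambda>_. 1) (W \<mu> j))
      (\<lambda>j. if j = 1 then li (\<lambda>x. w x - w2 x) (W \<mu> j) / \<mu> else li (\<lambda>x. w x - w2 x) (W \<mu> j))) \<longlongrightarrow>
    - 1 / K * det3 (\<lambda>j. if j = 1 then - of_real (rv Uc1) else if j = 2 then of_real (rv Ua1) else of_real (rv Ue1))
     (\<lambda>j. if j = 1 then - of_real (ri (\<lambda>_. 1) Uc) else if j = 2 then of_real (ri (\<lambda>_. 1) Ua) else of_real (ri (\<lambda>_. 1) Ue))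
     (\<lambda>j. if j = 1 then - of_real (ri (\<lambda>x. w x - w2 x) Uc) else if j = 2 then of_real (ri (\<lambda>x. w x - w2 x) Ua) else of_real (ri (\<lambda>x. w x - w2 x) Ue))) (at 0)"
  proof (intro tendsto_mult tendsto_const tendsto_det3)
    fix j :: 3
    note t = translation_lim[OF Uc gc(1) Yt_functionals(3), folded W1] translation_lim(1)[OF Uc gc(2) Yt_functionals(2), folded W1]
      homogeneous_lim[OF Ua gc(1), folded W2] homogeneous_lim(1)[OF Ua gc(2), folded W2]
      homogeneous_lim[OF Ue gc(1), folded W3] homogeneous_lim(1)[OF Ue gc(2), folded W3]
    have ne: "((2::3) = 1) = False" "((3::3) = 1) = False" "((3::3) = 2) = False" by simp_all
    have j: "j = 1 \<or> j = 2 \<or> j = 3" by (rule exhaust_3)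
    show "((\<lambda>\<mu>. if j = 1 then lv (W \<mu> j) / \<mu> else lv (W \<mu> j)) \<longlongrightarrow>
        (if j = 1 then - of_real (rv Uc1) else if j = 2 then of_real (rv Ua1) else of_real (rv Ue1))) (at 0)"
      using j by (elim disjE) (simp_all only: ne simp_thms if_True if_False t)
    show "((\<lambda>\<mu>. if j = 1 then li (\<lambda>_. 1) (W \<mu> j) / \<mu> else li (\<lambda>_. 1) (W \<mu> j)) \<longlongrightarrow>
        (if j = 1 then - of_real (ri (\<lambda>_. 1) Uc) else if j = 2 then of_real (ri (\<lambda>_. 1) Ua) else of_real (ri (\<lambda>_. 1) Ue))) (at 0)"
      using j by (elim disjE) (simp_all only: ne simp_thms if_True if_False t)
    show "((\<lambda>\<mu>. if j = 1 then li (\<lambda>x. w x - w2 x) (W \<mu> j) / \<mu> else li (\<lambda>x. w x - w2 x) (W \<mu> j)) \<longlongrightarrow>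
        (if j = 1 then - of_real (ri (\<lambda>x. w x - w2 x) Uc) else if j = 2 then of_real (ri (\<lambda>x. w x - w2 x) Ua) else of_real (ri (\<lambda>x. w x - w2 x) Ue))) (at 0)"
      using j by (elim disjE) (simp_all only: ne simp_thms if_True if_False t)
  qed
  \<comment> \<open>Moving the c-column from first to last place is an even permutation; the minus
    sign of that column cancels the one in front.\<close>
  also have "- 1 / K * det3 (\<lambda>j. if j = 1 then - of_real (rv Uc1) else if j = 2 then of_real (rv Ua1) else of_real (rv Ue1))
     (\<lambda>j. if j = 1 then - of_real (ri (\<lambda>_. 1) Uc) else if j = 2 then of_real (ri (\<lambda>_. 1) Ua) else of_real (ri (\<lambda>_. 1) Ue))
     (\<lambda>j. if j = 1 then - of_real (ri (\<lambda>x. w x - w2 x) Uc) else if j = 2 then of_real (ri (\<lambda>x. w x - w2 x) Ua) else of_real (ri (\<lambda>x. w x - w2 x) Ue))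
    = of_real (1 / k0 * det3 (J (\<lambda>U U1. rv U1)) (J (\<lambda>U U1. ri (\<lambda>_. 1) U)) (J (\<lambda>U U1. ri (\<lambda>x. w x - w2 x) U)))"
    unfolding det3_eq J_def K_def using k0 by (simp add: field_simps)
  finally show ?thesis
    by (rule Lim_transform_eventually) (simp add: eventually_at_filter e)
qed

end

section \<open>Wave families\<close>

lemma gronwall_second_order:
  fixes r r1 r2 :: "real \<Rightarrow> real"
  assumes K: "0 \<le> K" and e: "0 \<le> e"
    and d: "\<And>x. x \<in> {0..b} \<Longrightarrow> (r has_real_derivative r1 x) (at x)"
      "\<And>x. x \<in> {0..b} \<Longrightarrow> (r1 has_real_derivative r2 x) (at x)"
    and bd: "\<And>x. x \<in> {0..b} \<Longrightarrow> \<bar>r2 x\<bar> \<le> K * (\<bar>r x\<bar> + \<bar>r1 x\<bar>) + e"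
    and x: "x \<in> {0..b}"
  shows "\<bar>r x\<bar> \<le> exp ((2 * K + 2) * b) * (1 + b) * (\<bar>r 0\<bar> + \<bar>r1 0\<bar> + e)"
    and "\<bar>r1 x\<bar> \<le> exp ((2 * K + 2) * b) * (1 + b) * (\<bar>r 0\<bar> + \<bar>r1 0\<bar> + e)"
proof -
  define y where "y t = (r t, r1 t)" for t
  have n: "\<bar>r t\<bar> \<le> norm (y t)" "\<bar>r1 t\<bar> \<le> norm (y t)" "norm (y t) \<le> \<bar>r t\<bar> + \<bar>r1 t\<bar>" for t
    using norm_fst_le[of "r t" "r1 t"] norm_snd_le[of "r1 t" "r t"] norm_Pair_le[of "r t" "r1 t"] by (auto simp: y_def)
  have "norm (y x) \<le> exp (((1 + 2 * K) + 1) * b) * (norm (y 0) + (1 + b) * e)"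
  proof (rule gronwall[OF _ e _ _ x])
    fix t assume t: "t \<in> {0..b}"
    show "(y has_vector_derivative (r1 t, r2 t)) (at t)"
      unfolding y_def using d[OF t]
      by (intro has_vector_derivative_Pair) (simp_all add: has_real_derivative_iff_has_vector_derivative)
    have "norm (r1 t, r2 t) \<le> \<bar>r1 t\<bar> + \<bar>r2 t\<bar>" using norm_Pair_le[of "r1 t" "r2 t"] by simp
    also have "\<dots> \<le> norm (y t) + (K * (norm (y t) + norm (y t)) + e)"
      using n[of t] bd[OF t] mult_left_mono[OF add_mono[OF n(1)[of t] n(2)[of t]] K] by linarith
    finally show "norm (r1 t, r2 t) \<le> (1 + 2 * K) * norm (y t) + e" by (simp add: algebra_simps)
  qed (use K in simp)
  also have "\<dots> \<le> exp (((1 + 2 * K) + 1) * b) * ((1 + b) * (\<bar>r 0\<bar> + \<bar>r1 0\<bar>) + (1 + b) * e)"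
  proof (intro mult_left_mono add_right_mono)
    have "norm (y 0) \<le> 1 * (\<bar>r 0\<bar> + \<bar>r1 0\<bar>)" using n(3)[of 0] by simp
    also have "\<dots> \<le> (1 + b) * (\<bar>r 0\<bar> + \<bar>r1 0\<bar>)" using x by (intro mult_right_mono) auto
    finally show "norm (y 0) \<le> (1 + b) * (\<bar>r 0\<bar> + \<bar>r1 0\<bar>)" .
  qed simp
  also have "\<dots> = exp ((2 * K + 2) * b) * (1 + b) * (\<bar>r 0\<bar> + \<bar>r1 0\<bar> + e)"
    by (simp add: algebra_simps)
  finally show "\<bar>r x\<bar> \<le> exp ((2 * K + 2) * b) * (1 + b) * (\<bar>r 0\<bar> + \<bar>r1 0\<bar> + e)"
    "\<bar>r1 x\<bar> \<le> exp ((2 * K + 2) * b) * (1 + b) * (\<bar>r 0\<bar> + \<bar>r1 0\<bar> + e)"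
    using n[of x] by linarith+
qed

lemma C1_imp_has_real_derivative:
  fixes f :: "real \<Rightarrow> real"
  assumes "f C1_differentiable_on UNIV"
  shows "(f has_real_derivative deriv f x) (at x)" "continuous_on S (deriv f)"
proof -
  obtain D where D: "\<And>x. (f has_vector_derivative D x) (at x)" "continuous_on UNIV D"
    using assms unfolding C1_differentiable_on_def by auto
  have "(f has_real_derivative D x) (at x)" for x
    using D(1) by (simp add: has_real_derivative_iff_has_vector_derivative)
  moreover from this have "deriv f = D" by (intro ext DERIV_imp_deriv)
  ultimately show "(f has_real_derivative deriv f x) (at x)" "continuous_on S (deriv f)"
    using D(2) by (auto intro: continuous_on_subset)
qed

locale wave_parameters =
  fixes f F :: "real \<Rightarrow> real" and \<Omega> :: "(real^3) set" and um up :: "real^3 \<Rightarrow> real" and u :: "real^3 \<Rightarrow> real \<Rightarrow> real"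
  assumes f_C2: "C2_real f" and F_deriv: "\<And>x. (F has_real_derivative f x) (at x)"
    and family: "wave_family f F \<Omega> um up u"
begin

abbreviation f1 :: "real \<Rightarrow> real" where "f1 \<equiv> deriv f"
abbreviation f2 :: "real \<Rightarrow> real" where "f2 \<equiv> deriv (deriv f)"
abbreviation du :: "real^3 \<Rightarrow> real \<Rightarrow> real" where "du q \<equiv> deriv (u q)"

definition acc :: "real^3 \<Rightarrow> real \<Rightarrow> real" where "acc q y = (q$1 + (q$3 - 1) * y - f y) / q$3"

lemma f_deriv: "(f has_real_derivative f1 x) (at x)" "(f1 has_real_derivative f2 x) (at x)"
  and f2_cont: "continuous_on S f2"
  using f_C2 unfolding C2_real_def by (auto intro: C1_imp_has_real_derivative)

lemma f_cont: "continuous_on S f" "continuous_on S f1"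
  using f_deriv by (auto intro!: continuous_at_imp_continuous_on DERIV_isCont)

lemma \<Omega>_open: "open \<Omega>" and um_cont: "continuous_on \<Omega> um" and up_cont: "continuous_on \<Omega> up"
  using family by (auto simp: wave_family_def)

lemma potential_deriv: "(potential F q has_real_derivative f y - (q$3 - 1) * y - q$1) (at y)"
  unfolding potential_def[abs_def] by (auto intro!: derivative_eq_intros F_deriv)

context
  fixes q assumes q: "q \<in> \<Omega>"
begin

lemma wq: "well F q (um q) (up q)" "periodic_wave f F q (um q) (up q) (u q)"
  using family q by (auto simp: wave_family_def)

lemma c_gt: "q$3 > 1" and um_less_up: "um q < up q"
  using wq(1) by (auto simp: well_def)

lemma u_deriv: "(u q has_real_derivative du q x) (at x)"
  using wq(2) unfolding periodic_wave_def by (simp add: DERIV_deriv_iff_real_differentiable)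

lemma du_deriv: "(du q has_real_derivative acc q (u q x)) (at x)"
proof -
  have "(du q has_real_derivative deriv (du q) x) (at x)"
    using wq(2) unfolding periodic_wave_def by (simp add: DERIV_deriv_iff_real_differentiable)
  moreover have "q$3 * deriv (du q) x - (q$3 - 1) * u q x + f (u q x) = q$1"
    using wq(2) unfolding periodic_wave_def by simp
  then have "deriv (du q) x = acc q (u q x)" using c_gt by (simp add: acc_def field_simps)
  ultimately show ?thesis by simp
qed

lemma energy: "q$3 / 2 * (du q x)\<^sup>2 + potential F q (u q x) = q$2"
  using wq(2) unfolding periodic_wave_def by simp

lemma u_0: "u q 0 = um q" "du q 0 = 0"
  using wq(2) unfolding periodic_wave_def by simp_all

lemma u_range: "um q \<le> u q x" "u q x \<le> up q"
proof -
  have "u q x \<in> range (u q)" by simp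
  then show "um q \<le> u q x" "u q x \<le> up q" using wq(2) unfolding periodic_wave_def by auto
qed

lemma u_cont: "continuous_on S (u q)" "continuous_on S (du q)"
  using u_deriv du_deriv by (auto intro!: continuous_at_imp_continuous_on DERIV_isCont)

lemma acc_deriv: "(acc q has_real_derivative (q$3 - 1 - f1 y) / q$3) (at y)"
  unfolding acc_def[abs_def]
  by (rule DERIV_cdivide) (auto intro!: derivative_eq_intros f_deriv)

text \<open>The potential lies below the energy inside the well and equals it at the ends, which
  excludes one sign of its slope there; simplicity of the roots excludes zero.\<close>

lemma acc_um: "acc q (um q) > 0" and acc_up: "acc q (up q) < 0"
proof -
  define V' where "V' y = f y - (q$3 - 1) * y - q$1" for y
  have V: "(potential F q has_real_derivative V' y) (at y)" for y unfolding V'_def by (rule potential_deriv)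
  have acc: "acc q y = - V' y / q$3" for y using c_gt by (simp add: acc_def V'_def field_simps)
  have w: "potential F q (um q) = q$2" "potential F q (up q) = q$2" "V' (um q) \<noteq> 0" "V' (up q) \<noteq> 0"
    "\<And>y. um q < y \<Longrightarrow> y < up q \<Longrightarrow> potential F q y < q$2"
    using wq(1) DERIV_imp_deriv[OF V] by (auto simp: well_def)
  have "\<not> V' (um q) > 0"
  proof
    assume "V' (um q) > 0"
    from DERIV_pos_inc_right[OF V this] obtain d where d: "d > 0"
      "\<And>h. 0 < h \<Longrightarrow> h < d \<Longrightarrow> potential F q (um q) < potential F q (um q + h)" by blast
    define h where "h = min d (up q - um q) / 2"
    have "0 < h" "h < d" "um q + h < up q" using d(1) um_less_up by (auto simp: h_def min_def field_simps)
    then show False using d(2)[of h] w(1) w(5)[of "um q + h"] by simp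
  qed
  with w(3) have "V' (um q) < 0" by simp
  then show "acc q (um q) > 0" using c_gt by (simp add: acc divide_neg_pos)
  have "\<not> V' (up q) < 0"
  proof
    assume "V' (up q) < 0"
    from DERIV_neg_dec_left[OF V this] obtain d where d: "d > 0"
      "\<And>h. 0 < h \<Longrightarrow> h < d \<Longrightarrow> potential F q (up q) < potential F q (up q - h)" by blast
    define h where "h = min d (up q - um q) / 2"
    have "0 < h" "h < d" "um q < up q - h" using d(1) um_less_up by (auto simp: h_def min_def field_simps)
    then show False using d(2)[of h] w(2) w(5)[of "up q - h"] by simp
  qed
  with w(4) have "V' (up q) > 0" by simp
  then show "acc q (up q) < 0" using c_gt by (simp add: acc divide_pos_pos)
qed

lemma du_zero: "du q x = 0 \<Longrightarrow> u q x = um q \<or> u q x = up q"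
proof (rule ccontr)
  assume "du q x = 0" and "\<not> (u q x = um q \<or> u q x = up q)"
  then have "potential F q (u q x) = q$2" "u q x \<in> {um q<..<up q}"
    using energy[of x] u_range[of x] by auto
  then show False using wq(1) unfolding well_def by fastforce
qed

lemma du_at_um: "u q x = um q \<Longrightarrow> du q x = 0"
  using energy[of x] wq(1) c_gt by (auto simp: well_def)

text \<open>The nonlinearity is only locally Lipschitz, so both trajectories are confined to the
  well, where a single Lipschitz constant serves for all x.\<close>

lemma wave_unique:
  assumes v: "\<And>x. (v has_real_derivative v1 x) (at x)" "\<And>x. (v1 has_real_derivative acc q (v x)) (at x)"
    and v0: "v 0 = um q" "v1 0 = 0" and rng: "\<And>x. v x \<in> {um q..up q}" and x: "x \<ge> 0"
  shows "v x = u q x"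
proof -
  have "continuous_on {um q..up q} (\<lambda>y. (q$3 - 1 - f1 y) / q$3)"
    using c_gt by (intro continuous_intros f_cont) simp
  then obtain K where K: "K \<ge> 0" "\<forall>y\<in>{um q..up q}. norm ((q$3 - 1 - f1 y) / q$3) \<le> K"
    using continuous_on_Icc_bounded by blast
  have lip: "\<bar>acc q y - acc q z\<bar> \<le> K * \<bar>y - z\<bar>" if "y \<in> {um q..up q}" "z \<in> {um q..up q}" for y z
    using field_differentiable_bound[of "{um q..up q}" "acc q" "\<lambda>y. (q$3 - 1 - f1 y) / q$3" K y z] that K
    by (auto intro: has_field_derivative_at_within acc_deriv)
  have "\<bar>v x - u q x\<bar> \<le> exp ((2 * K + 2) * x) * (1 + x) * (\<bar>v 0 - u q 0\<bar> + \<bar>v1 0 - du q 0\<bar> + 0)"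
  proof (rule gronwall_second_order(1)[where ?r2.0 = "\<lambda>x. acc q (v x) - acc q (u q x)" and K = K])
    fix t
    show "((\<lambda>x. v x - u q x) has_real_derivative v1 t - du q t) (at t)" by (intro DERIV_diff v u_deriv)
    show "((\<lambda>x. v1 x - du q x) has_real_derivative acc q (v t) - acc q (u q t)) (at t)" by (intro DERIV_diff v du_deriv)
    have "\<bar>acc q (v t) - acc q (u q t)\<bar> \<le> K * \<bar>v t - u q t\<bar>" using rng u_range by (intro lip) auto
    also have "\<dots> \<le> K * (\<bar>v t - u q t\<bar> + \<bar>v1 t - du q t\<bar>) + 0" using K by (simp add: mult_left_mono)
    finally show "\<bar>acc q (v t) - acc q (u q t)\<bar> \<le> K * (\<bar>v t - u q t\<bar> + \<bar>v1 t - du q t\<bar>) + 0" .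
  qed (use K x in auto)
  then show ?thesis by (simp add: v0 u_0)
qed

text \<open>At a time when the wave is at its trough its slope vanishes, so the shifted and the
  reflected wave solve the same initial value problem as the wave itself.\<close>

lemma wave_shift:
  assumes t: "u q t = um q"
  shows "u q (t + x) = u q x" "u q (t - x) = u q x"
proof -
  have r: "u q y \<in> {um q..up q}" for y using u_range by simp
  have plus: "u q (s + y) = u q y" if "u q s = um q" "y \<ge> 0" for s y
  proof (rule wave_unique[where v = "\<lambda>y. u q (s + y)" and ?v1.0 = "\<lambda>y. du q (s + y)"])
    fix z
    have s: "((\<lambda>y. s + y) has_real_derivative 1) (at z)" by (auto intro!: derivative_eq_intros)
    show "((\<lambda>y. u q (s + y)) has_real_derivative du q (s + z)) (at z)"
      using DERIV_chain2[OF u_deriv s] by simp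
    show "((\<lambda>y. du q (s + y)) has_real_derivative acc q (u q (s + z))) (at z)"
      using DERIV_chain2[OF du_deriv s] by simp
  qed (use that r du_at_um[OF that(1)] in auto)
  have minus: "u q (s - y) = u q y" if "u q s = um q" "y \<ge> 0" for s y
  proof (rule wave_unique[where v = "\<lambda>y. u q (s - y)" and ?v1.0 = "\<lambda>y. - du q (s - y)"])
    fix z
    have s: "((\<lambda>y. s - y) has_real_derivative - 1) (at z)" by (auto intro!: derivative_eq_intros)
    show "((\<lambda>y. u q (s - y)) has_real_derivative - du q (s - z)) (at z)"
      using DERIV_chain2[OF u_deriv s] by simp
    show "((\<lambda>y. - du q (s - y)) has_real_derivative acc q (u q (s - z))) (at z)"
      using DERIV_minus[OF DERIV_chain2[OF du_deriv s]] by simp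
  qed (use that r du_at_um[OF that(1)] in auto)
  have even: "u q (- y) = u q y" for y
    using minus[of 0 y] minus[of 0 "- y"] u_0 by (cases "y \<ge> 0") auto
  have p: "u q (t + y) = u q y" for y
    using plus[OF t, of y] minus[OF t, of "- y"] even[of y] by (cases "y \<ge> 0") auto
  show "u q (t + x) = u q x" by (rule p)
  show "u q (t - x) = u q x" using p[of "- x"] even[of x] by simp
qed

lemma u_gt_near_0:
  assumes "\<And>x. x \<in> {0..d} \<Longrightarrow> acc q (u q x) > 0" "0 < x" "x \<le> d"
  shows "u q x > um q"
proof -
  have pos: "du q y > 0" if y: "0 < y" "y \<le> d" for y
  proof -
    have "du q 0 < du q y"
    proof (rule DERIV_pos_imp_increasing_open[where f = "du q" and a = 0 and b = y])
      fix z assume "0 < z" "z < y"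
      then show "\<exists>l. (du q has_real_derivative l) (at z) \<and> 0 < l"
        using du_deriv[of z] assms(1)[of z] y by (intro exI[of _ "acc q (u q z)"]) auto
    qed (use y u_cont in auto)
    then show ?thesis by (simp add: u_0)
  qed
  have "u q 0 < u q x"
  proof (rule DERIV_pos_imp_increasing_open[where f = "u q" and a = 0 and b = x])
    fix z assume "0 < z" "z < x"
    then show "\<exists>l. (u q has_real_derivative l) (at z) \<and> 0 < l"
      using u_deriv[of z] pos[of z] assms(3) by (intro exI[of _ "du q z"]) auto
  qed (use assms u_cont in auto)
  then show ?thesis by (simp add: u_0)
qed

text \<open>Returning to the trough value is the same as being a period. Positive acceleration near
  0 keeps positive return times away from 0, so the closed set of returns has a positive least
  element, which is the \<open>LEAST\<close> in \<open>period\<close>.\<close>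

lemma period_props:
  shows "period (u q) > 0" "u q (period (u q)) = um q" "\<And>x. 0 < x \<Longrightarrow> x < period (u q) \<Longrightarrow> u q x > um q"
proof -
  have "isCont (\<lambda>x. acc q (u q x)) 0"
    by (rule isCont_o2[OF DERIV_isCont[OF u_deriv] DERIV_isCont[OF acc_deriv]])
  then have "((\<lambda>x. acc q (u q x)) \<longlongrightarrow> acc q (u q 0)) (nhds 0)"
    by (simp only: isCont_def tendsto_at_iff_tendsto_nhds[of "\<lambda>x. acc q (u q x)" 0])
  then have "\<forall>\<^sub>F x in nhds 0. acc q (u q x) > 0" using acc_um u_0 by (intro order_tendstoD) auto
  then obtain e where e: "e > 0" "\<And>x. \<bar>x\<bar> < e \<Longrightarrow> acc q (u q x) > 0"
    unfolding eventually_nhds_metric by (auto simp: dist_real_def)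
  define d where "d = e / 2"
  have d: "d > 0" "\<And>x. 0 < x \<Longrightarrow> x \<le> d \<Longrightarrow> u q x > um q"
    using e u_gt_near_0[of d] by (auto simp: d_def)
  obtain t0 where t0: "t0 > 0" "\<forall>x. u q (x + t0) = u q x" using wq(2) unfolding periodic_wave_def by blast
  then have ut0: "u q t0 = um q" using t0(2)[rule_format, of 0] u_0 by simp
  then have dt0: "d < t0" using d(2)[of t0] t0(1) by (cases "t0 \<le> d") auto
  define S where "S = {x \<in> {d..t0}. u q x = um q}"
  have "closed S" unfolding S_def using u_cont(1) by (intro continuous_closed_preimage_constant closed_atLeastAtMost)
  moreover have "S \<noteq> {}" "bdd_below S" using ut0 dt0 by (auto simp: S_def intro: bdd_belowI[of _ d])
  ultimately have IS: "Inf S \<in> S" by (intro closed_contains_Inf)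
  define T where "T = Inf S"
  have T: "T \<ge> d" "T \<le> t0" "u q T = um q" using IS by (auto simp: S_def T_def)
  have low: "u q x > um q" if "0 < x" "x < T" for x
  proof (cases "x \<le> d")
    case False
    have "x \<notin> S" using cInf_lower[of x S] \<open>bdd_below S\<close> that by (force simp: T_def)
    then have "u q x \<noteq> um q" using False that T by (auto simp: S_def)
    then show ?thesis using u_range(1)[of x] by simp
  qed (use d that in auto)
  have "period (u q) = T"
    unfolding period_def
  proof (rule Least_equality)
    show "0 < T \<and> (\<forall>x. u q (x + T) = u q x)" using T d wave_shift(1)[OF T(3)] by (auto simp: add.commute)
    fix t assume t: "0 < t \<and> (\<forall>x. u q (x + t) = u q x)"
    then have "u q t = um q" using spec[OF conjunct2[OF t], of 0] u_0 by simp
    then show "T \<le> t" using low[of t] t by force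
  qed
  then show "period (u q) > 0" "u q (period (u q)) = um q" "\<And>x. 0 < x \<Longrightarrow> x < period (u q) \<Longrightarrow> u q x > um q"
    using T d low by auto
qed

end

end

section \<open>Differentiability in the wave parameters\<close>

text \<open>The coefficients may depend on q as long as they converge. This suits implicitly defined
  quantities, whose increments are naturally expressed with slopes evaluated at the nearby
  parameter.\<close>

lemma caratheodory_derivative:
  fixes g :: "real^3 \<Rightarrow> real" and k :: "3 \<Rightarrow> real^3 \<Rightarrow> real"
  assumes rem: "\<And>e. e > 0 \<Longrightarrow> \<forall>\<^sub>F q in nhds p. \<bar>g q - g p - (\<Sum>i\<in>UNIV. k i q * (q - p)$i)\<bar> \<le> e * norm (q - p)"
    and k: "\<And>i. (k i \<longlongrightarrow> k0 i) (nhds p)"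
  shows "(g has_derivative (\<lambda>h. \<Sum>i\<in>UNIV. k0 i * h$i)) (at p)"
  unfolding has_derivative_at_alt
proof (intro conjI allI impI)
  show "bounded_linear (\<lambda>h::real^3. \<Sum>i\<in>UNIV. k0 i * h$i)"
    by (intro bounded_linear_sum bounded_linear_const_mult bounded_linear_vec_nth)
  fix e :: real assume e: "e > 0"
  have "\<forall>\<^sub>F q in nhds p. \<forall>i\<in>UNIV. \<bar>k i q - k0 i\<bar> < e / 6"
  proof (intro eventually_ball_finite ballI)
    fix i :: 3
    have "\<forall>\<^sub>F q in nhds p. dist (k i q) (k0 i) < e / 6" using k[of i] e by (intro tendstoD) auto
    then show "\<forall>\<^sub>F q in nhds p. \<bar>k i q - k0 i\<bar> < e / 6" by (simp add: dist_real_def)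
  qed simp
  moreover have "\<forall>\<^sub>F q in nhds p. \<bar>g q - g p - (\<Sum>i\<in>UNIV. k i q * (q - p)$i)\<bar> \<le> e / 2 * norm (q - p)"
    using e by (intro rem) auto
  ultimately have "\<forall>\<^sub>F q in nhds p. norm (g q - g p - (\<Sum>i\<in>UNIV. k0 i * (q - p)$i)) \<le> e * norm (q - p)"
  proof eventually_elim
    case (elim q)
    have "\<bar>\<Sum>i\<in>UNIV. (k i q - k0 i) * (q - p)$i\<bar> \<le> (\<Sum>i\<in>(UNIV::3 set). e / 6 * norm (q - p))"
    proof (rule order_trans[OF sum_abs sum_mono])
      fix i :: 3
      show "\<bar>(k i q - k0 i) * (q - p)$i\<bar> \<le> e / 6 * norm (q - p)"
        unfolding abs_mult using elim(1) component_le_norm_cart[of "q - p" i] e by (intro mult_mono) (auto intro: less_imp_le)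
    qed
    also have "\<dots> = e / 2 * norm (q - p)" by (simp add: sum_3)
    finally have 1: "\<bar>\<Sum>i\<in>UNIV. (k i q - k0 i) * (q - p)$i\<bar> \<le> e / 2 * norm (q - p)" .
    have eq: "g q - g p - (\<Sum>i\<in>UNIV. k0 i * (q - p)$i)
      = (g q - g p - (\<Sum>i\<in>UNIV. k i q * (q - p)$i)) + (\<Sum>i\<in>UNIV. (k i q - k0 i) * (q - p)$i)"
      by (simp add: sum_3 algebra_simps)
    show ?case unfolding eq real_norm_def using 1 elim(2) abs_triangle_ineq[of "g q - g p - (\<Sum>i\<in>UNIV. k i q * (q - p)$i)" "\<Sum>i\<in>UNIV. (k i q - k0 i) * (q - p)$i"]
      by linarith
  qed
  then show "\<exists>d>0. \<forall>y. norm (y - p) < d \<longrightarrow> norm (g y - g p - (\<Sum>i\<in>UNIV. k0 i * (y - p)$i)) \<le> e * norm (y - p)"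
    unfolding eventually_nhds_metric by (auto simp: dist_norm)
qed

section \<open>The lower turning point as a function of the parameters\<close>

context wave_parameters
begin

context
  fixes p assumes p: "p \<in> \<Omega>"
begin

definition "k0 = acc p (um p)"
definition "T = period (u p)"

lemma k0_pos: "k0 > 0" unfolding k0_def by (rule acc_um[OF p])

lemma T_pos: "T > 0" "u p T = um p" "du p T = 0"
  unfolding T_def using period_props[OF p] du_at_um[OF p] by auto

lemma ev_\<Omega>: "\<forall>\<^sub>F q in nhds p. q \<in> \<Omega>"
  using \<Omega>_open p by (rule eventually_nhds_in_open)

lemma tendsto_um_up: "(um \<longlongrightarrow> um p) (nhds p)" "(up \<longlongrightarrow> up p) (nhds p)"
proof -
  have "isCont um p" "isCont up p"
    using um_cont up_cont \<Omega>_open p by (simp_all add: continuous_on_eq_continuous_at)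
  then show "(um \<longlongrightarrow> um p) (nhds p)" "(up \<longlongrightarrow> up p) (nhds p)"
    by (simp_all only: isCont_def tendsto_at_iff_tendsto_nhds[of um p] tendsto_at_iff_tendsto_nhds[of up p])
qed

text \<open>Implicit differentiation of V(um; a, c) = E, with V'(um) = -c k0.\<close>

definition um_grad :: "3 \<Rightarrow> real" where
  "um_grad i = - (if i = 1 then um p else if i = 2 then 1 else (um p)\<^sup>2 / 2) / (p$3 * k0)"

text \<open>\<open>S\<close> is the slope function of the potential at the fixed parameter p. The
  potential depends affinely on a and c, so the two root equations subtract to an exact identity,
  with no remainder.\<close>

lemma um_expansion:
  "\<exists>k :: 3 \<Rightarrow> real^3 \<Rightarrow> real. (\<forall>\<^sub>F q in nhds p. um q - um p = (\<Sum>i\<in>UNIV. k i q * (q - p)$i)) \<and>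
    (\<forall>i. (k i \<longlongrightarrow> um_grad i) (nhds p))"
proof -
  obtain S where S: "\<And>z. potential F p z - potential F p (um p) = S z * (z - um p)"
    "isCont S (um p)" "S (um p) = f (um p) - (p$3 - 1) * um p - p$1"
    using potential_deriv[of p "um p"] unfolding CARAT_DERIV by blast
  have S0: "S (um p) = - (p$3 * k0)" using c_gt[OF p] by (simp add: S(3) k0_def acc_def field_simps)
  have Sne: "- (p$3 * k0) \<noteq> 0" using c_gt[OF p] k0_pos by simp
  have St: "((\<lambda>q. S (um q)) \<longlongrightarrow> - (p$3 * k0)) (nhds p)"
    using isCont_tendsto_compose[OF S(2) tendsto_um_up(1)] S0 by simp
  define k where "k i q = (if i = (1::3) then um q else if i = 2 then 1 else (um q)\<^sup>2 / 2) / S (um q)" for i q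
  have kl: "(k i \<longlongrightarrow> um_grad i) (nhds p)" for i
  proof -
    have "((\<lambda>q. (if i = (1::3) then um q else if i = 2 then 1 else (um q)\<^sup>2 / 2) / S (um q)) \<longlongrightarrow>
      (if i = (1::3) then um p else if i = 2 then 1 else (um p)\<^sup>2 / 2) / (- (p$3 * k0))) (nhds p)"
      by (rule tendsto_divide[OF _ St Sne]) (auto intro!: tendsto_intros tendsto_um_up(1))
    then show ?thesis by (simp add: k_def[abs_def] um_grad_def)
  qed
  have "\<forall>\<^sub>F q in nhds p. S (um q) \<noteq> 0" using St Sne by (rule tendsto_imp_eventually_ne)
  with ev_\<Omega> have "\<forall>\<^sub>F q in nhds p. um q - um p = (\<Sum>i\<in>UNIV. k i q * (q - p)$i)"
  proof eventually_elim
    case (elim q)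
    have "potential F q (um q) = q$2" "potential F p (um p) = p$2"
      using wq(1)[OF elim(1)] wq(1)[OF p] by (auto simp: well_def)
    then have "S (um q) * (um q - um p) = (q - p)$2 + (q - p)$3 * (um q)\<^sup>2 / 2 + (q - p)$1 * um q"
      unfolding S(1)[symmetric] by (simp add: potential_def field_simps)
    then have "um q - um p = ((q - p)$2 + (q - p)$3 * (um q)\<^sup>2 / 2 + (q - p)$1 * um q) / S (um q)"
      using elim(2) by (simp add: nonzero_eq_divide_eq mult.commute)
    then show ?case by (simp add: sum_3 k_def add_divide_distrib mult_ac)
  qed
  with kl show ?thesis by blast
qed

lemma um_lipschitz: "\<exists>C\<ge>0. \<forall>\<^sub>F q in nhds p. \<bar>um q - um p\<bar> \<le> C * norm (q - p)"
  and um_derivative: "e > 0 \<Longrightarrow> \<forall>\<^sub>F q in nhds p. \<bar>um q - um p - (\<Sum>i\<in>UNIV. um_grad i * (q - p)$i)\<bar> \<le> e * norm (q - p)"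
proof -
  obtain k :: "3 \<Rightarrow> real^3 \<Rightarrow> real" where k: "\<forall>\<^sub>F q in nhds p. um q - um p = (\<Sum>i\<in>UNIV. k i q * (q - p)$i)"
    "\<forall>i. (k i \<longlongrightarrow> um_grad i) (nhds p)" using um_expansion by blast
  have "(um has_derivative (\<lambda>h. \<Sum>i\<in>UNIV. um_grad i * h$i)) (at p)"
  proof (rule caratheodory_derivative[OF _ k(2)[rule_format]])
    fix e :: real assume e: "e > 0"
    show "\<forall>\<^sub>F q in nhds p. \<bar>um q - um p - (\<Sum>i\<in>UNIV. k i q * (q - p)$i)\<bar> \<le> e * norm (q - p)"
      using k(1) by (rule eventually_mono) (use e in simp)
  qed
  then have D: "bounded_linear (\<lambda>h. \<Sum>i\<in>UNIV. um_grad i * h$i)"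
    "\<forall>e>0. \<exists>d>0. \<forall>q. norm (q - p) < d \<longrightarrow> norm (um q - um p - (\<Sum>i\<in>UNIV. um_grad i * (q - p)$i)) \<le> e * norm (q - p)"
    unfolding has_derivative_at_alt by auto
  show E: "\<forall>\<^sub>F q in nhds p. \<bar>um q - um p - (\<Sum>i\<in>UNIV. um_grad i * (q - p)$i)\<bar> \<le> e * norm (q - p)" if "e > 0" for e
    using D(2) that unfolding eventually_nhds_metric by (simp add: dist_norm)
  obtain K where K: "K > 0" "\<forall>h. norm (\<Sum>i\<in>UNIV. um_grad i * h$i) \<le> norm h * K"
    using bounded_linear.pos_bounded[OF D(1)] by (elim exE conjE) (rule that)
  have "\<forall>\<^sub>F q in nhds p. \<bar>um q - um p\<bar> \<le> (1 + K) * norm (q - p)"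
    using E[OF zero_less_one]
  proof eventually_elim
    case (elim q)
    then show ?case using K(2)[rule_format, of "q - p"]
      unfolding real_norm_def distrib_right mult_1 mult.commute[of K] by linarith
  qed
  then show "\<exists>C\<ge>0. \<forall>\<^sub>F q in nhds p. \<bar>um q - um p\<bar> \<le> C * norm (q - p)"
    using K(1) by (intro exI[of _ "1 + K"]) simp
qed

end

section \<open>Lipschitz dependence and differentiability of the profile on compact
  intervals\<close>

lemma acc_diff:
  assumes "p \<in> \<Omega>" "q \<in> \<Omega>"
  shows "p$3 * (acc q y - acc p z) = (q - p)$1 + (p$3 - 1) * (y - z) + (q - p)$3 * y - (f y - f z) - (q - p)$3 * acc q y"
proof -
  have "q$3 * acc q y = q$1 + (q$3 - 1) * y - f y" "p$3 * acc p z = p$1 + (p$3 - 1) * z - f z"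
    using c_gt[OF assms(1)] c_gt[OF assms(2)] by (simp_all add: acc_def)
  then show ?thesis by (simp add: algebra_simps)
qed

lemma f_bounds:
  obtains Kf where "Kf \<ge> 0" "\<forall>y\<in>{A..B}. \<bar>f y\<bar> \<le> Kf \<and> \<bar>f1 y\<bar> \<le> Kf \<and> \<bar>f2 y\<bar> \<le> Kf"
    "\<forall>y\<in>{A..B}. \<forall>z\<in>{A..B}. \<bar>f y - f z\<bar> \<le> Kf * \<bar>y - z\<bar> \<and> \<bar>f y - f z - f1 z * (y - z)\<bar> \<le> Kf * (y - z)\<^sup>2"
proof -
  obtain K0 where K0: "K0 \<ge> 0" "\<forall>x\<in>{A..B}. norm (f x) \<le> K0" using continuous_on_Icc_bounded[OF f_cont(1)] by blast
  obtain K1 where K1: "K1 \<ge> 0" "\<forall>x\<in>{A..B}. norm (f1 x) \<le> K1" using continuous_on_Icc_bounded[OF f_cont(2)] by blast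
  obtain K2 where K2: "K2 \<ge> 0" "\<forall>x\<in>{A..B}. norm (f2 x) \<le> K2" using continuous_on_Icc_bounded[OF f2_cont] by blast
  define K where "K = K0 + K1 + K2"
  have K: "K \<ge> 0" using K0(1) K1(1) K2(1) by (simp add: K_def)
  have Kb: "\<bar>f y\<bar> \<le> K \<and> \<bar>f1 y\<bar> \<le> K \<and> \<bar>f2 y\<bar> \<le> K" if "y \<in> {A..B}" for y
    using K0(1) K1(1) K2(1) bspec[OF K0(2) that] bspec[OF K1(2) that] bspec[OF K2(2) that]
    unfolding K_def real_norm_def by linarith
  have lip: "\<bar>f y - f z\<bar> \<le> K * \<bar>y - z\<bar>" "\<bar>f1 y - f1 z\<bar> \<le> K * \<bar>y - z\<bar>" if "y \<in> {A..B}" "z \<in> {A..B}" for y z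
  proof -
    have "norm (f y - f z) \<le> K * norm (y - z)"
      by (rule field_differentiable_bound[where S = "{A..B}" and f' = f1, OF _ has_field_derivative_at_within[OF f_deriv(1)]])
         (use that Kb in auto)
    moreover have "norm (f1 y - f1 z) \<le> K * norm (y - z)"
      by (rule field_differentiable_bound[where S = "{A..B}" and f' = f2, OF _ has_field_derivative_at_within[OF f_deriv(2)]])
         (use that Kb in auto)
    ultimately show "\<bar>f y - f z\<bar> \<le> K * \<bar>y - z\<bar>" "\<bar>f1 y - f1 z\<bar> \<le> K * \<bar>y - z\<bar>" by simp_all
  qed
  have tay: "\<bar>f y - f z - f1 z * (y - z)\<bar> \<le> K * (y - z)\<^sup>2" if yz: "y \<in> {A..B}" "z \<in> {A..B}" for y z
  proof -
    have sub: "closed_segment z y \<subseteq> {A..B}" using yz by (intro closed_segment_subset) auto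
    have "norm ((f y - f1 z * y) - (f z - f1 z * z)) \<le> (K * \<bar>y - z\<bar>) * norm (y - z)"
    proof (rule field_differentiable_bound[where S = "closed_segment z y" and f' = "\<lambda>s. f1 s - f1 z" and f = "\<lambda>s. f s - f1 z * s"])
      fix s assume s: "s \<in> closed_segment z y"
      have "((\<lambda>s. f s - f1 z * s) has_field_derivative f1 s - f1 z * 1) (at s within closed_segment z y)"
        by (intro DERIV_diff DERIV_cmult DERIV_ident has_field_derivative_at_within[OF f_deriv(1)])
      then show "((\<lambda>s. f s - f1 z * s) has_field_derivative f1 s - f1 z) (at s within closed_segment z y)" by simp
      have "\<bar>f1 s - f1 z\<bar> \<le> K * \<bar>s - z\<bar>" using sub s yz by (intro lip) auto
      also have "\<dots> \<le> K * \<bar>y - z\<bar>" using segment_bound1[OF s] K by (intro mult_left_mono) auto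
      finally show "norm (f1 s - f1 z) \<le> K * \<bar>y - z\<bar>" by simp
    qed auto
    then show ?thesis by (simp add: power2_eq_square algebra_simps abs_mult[symmetric])
  qed
  show ?thesis by (rule that[of K]) (use K Kb lip tay in auto)
qed

context
  fixes p assumes p: "p \<in> \<Omega>"
begin

lemma ev_norm_less: "e > 0 \<Longrightarrow> \<forall>\<^sub>F q in nhds p. norm (q - p) < e"
  unfolding eventually_nhds_metric by (auto simp: dist_norm)

lemma ev_range: "\<forall>\<^sub>F q in nhds p. q \<in> \<Omega> \<and> norm (q - p) < 1 \<and> (\<forall>x. u q x \<in> {um p - 1..up p + 1})"
proof -
  have "\<forall>\<^sub>F q in nhds p. um q > um p - 1" "\<forall>\<^sub>F q in nhds p. up q < up p + 1"
    using tendsto_um_up[OF p] by (auto intro: order_tendstoD)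
  then show ?thesis using ev_\<Omega>[OF p] ev_norm_less[OF zero_less_one]
  proof eventually_elim
    case (elim q)
    have "u q x \<in> {um p - 1..up p + 1}" for x using u_range[OF elim(3), of x] elim(1,2) by simp
    then show ?case using elim by simp
  qed
qed

lemma wave_lipschitz:
  assumes b: "b \<ge> 0"
  shows "\<exists>C\<ge>0. \<forall>\<^sub>F q in nhds p. \<forall>x\<in>{0..b}. \<bar>u q x - u p x\<bar> \<le> C * norm (q - p) \<and>
     \<bar>du q x - du p x\<bar> \<le> C * norm (q - p) \<and> \<bar>acc q (u q x) - acc p (u p x)\<bar> \<le> C * norm (q - p)"
proof -
  define A B where "A = um p - 1" and "B = up p + 1"
  define N where "N = \<bar>A\<bar> + \<bar>B\<bar>"
  obtain Kf where Kf: "Kf \<ge> 0" "\<forall>y\<in>{A..B}. \<bar>f y\<bar> \<le> Kf \<and> \<bar>f1 y\<bar> \<le> Kf \<and> \<bar>f2 y\<bar> \<le> Kf"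
    "\<forall>y\<in>{A..B}. \<forall>z\<in>{A..B}. \<bar>f y - f z\<bar> \<le> Kf * \<bar>y - z\<bar> \<and> \<bar>f y - f z - f1 z * (y - z)\<bar> \<le> Kf * (y - z)\<^sup>2"
    by (rule f_bounds)
  obtain C0 where C0: "C0 \<ge> 0" "\<forall>\<^sub>F q in nhds p. \<bar>um q - um p\<bar> \<le> C0 * norm (q - p)"
    using um_lipschitz[OF p] by (elim exE conjE) (rule that)
  \<comment> \<open>\<open>S\<close> bounds the acceleration of nearby waves, using that
    \<open>q$3 > 1\<close> makes division harmless; \<open>K1\<close> is a Lipschitz constant in the
    state, \<open>K2\<close> one in the parameter.\<close>
  define S where "S = \<bar>p$1\<bar> + 1 + (\<bar>p$3\<bar> + 2) * N + Kf"
  define K1 K2 where "K1 = \<bar>p$3\<bar> + Kf" and "K2 = 1 + N + S"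
  define G where "G = exp ((2 * K1 + 2) * b) * (1 + b)"
  have N0: "N \<ge> 0" "S \<ge> 0" "K1 \<ge> 0" "K2 \<ge> 0" "G \<ge> 0"
    using Kf(1) b by (auto simp: N_def S_def K1_def K2_def G_def)
  have c1: "p$3 > 1" by (rule c_gt[OF p])
  define C where "C = G * (C0 + K2) + K1 * (G * (C0 + K2)) + K2"
  have parts: "0 \<le> G * (C0 + K2)" "0 \<le> K1 * (G * (C0 + K2))" using N0 C0(1) by auto
  have C: "C \<ge> 0" using parts N0 by (simp add: C_def)
  have "\<forall>\<^sub>F q in nhds p. \<forall>x\<in>{0..b}. \<bar>u q x - u p x\<bar> \<le> C * norm (q - p) \<and>
     \<bar>du q x - du p x\<bar> \<le> C * norm (q - p) \<and> \<bar>acc q (u q x) - acc p (u p x)\<bar> \<le> C * norm (q - p)"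
    using ev_range C0(2)
  proof eventually_elim
    case (elim q)
    define n where "n = norm (q - p)"
    have q: "q \<in> \<Omega>" "n < 1" "\<And>x. u q x \<in> {A..B}" using elim by (auto simp: A_def B_def n_def)
    have pr: "u p x \<in> {A..B}" for x using u_range[OF p, of x] by (auto simp: A_def B_def)
    have h: "\<bar>(q - p)$i\<bar> \<le> n" "n \<ge> 0" for i using component_le_norm_cart[of "q - p" i] by (auto simp: n_def)
    have ab: "\<bar>acc q (u q x) - acc p (u p x)\<bar> \<le> K1 * \<bar>u q x - u p x\<bar> + K2 * n" for x
    proof -
      define y z where "y = u q x" and "z = u p x"
      have y: "y \<in> {A..B}" "z \<in> {A..B}" using q pr by (auto simp: y_def z_def)
      have yN: "\<bar>y\<bar> \<le> N" using y by (auto simp: N_def)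
      have q13: "\<bar>q$1\<bar> \<le> \<bar>p$1\<bar> + 1" "\<bar>q$3 - 1\<bar> \<le> \<bar>p$3\<bar> + 2" using h(1)[of 1] h(1)[of 3] q(2) by auto
      have "\<bar>q$1 + (q$3 - 1) * y - f y\<bar> \<le> \<bar>q$1\<bar> + \<bar>(q$3 - 1) * y\<bar> + \<bar>f y\<bar>" by linarith
      also have "\<dots> \<le> (\<bar>p$1\<bar> + 1) + (\<bar>p$3\<bar> + 2) * N + Kf"
        unfolding abs_mult using q13 yN Kf(2) y by (intro add_mono mult_mono) auto
      finally have "\<bar>q$1 + (q$3 - 1) * y - f y\<bar> \<le> S" by (simp add: S_def)
      moreover have "\<bar>acc q y\<bar> \<le> \<bar>q$1 + (q$3 - 1) * y - f y\<bar>"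
        using c_gt[OF q(1)] divide_left_mono[of 1 "q$3" "\<bar>q$1 + (q$3 - 1) * y - f y\<bar>"]
        unfolding acc_def abs_divide by simp
      ultimately have aS: "\<bar>acc q y\<bar> \<le> S" by linarith
      have "\<bar>p$3 * (acc q y - acc p z)\<bar> \<le> \<bar>(q - p)$1\<bar> + \<bar>(p$3 - 1) * (y - z)\<bar> + \<bar>(q - p)$3 * y\<bar> + \<bar>f y - f z\<bar> + \<bar>(q - p)$3 * acc q y\<bar>"
        unfolding acc_diff[OF p q(1)] by linarith
      also have "\<dots> \<le> n + \<bar>p$3\<bar> * \<bar>y - z\<bar> + n * N + Kf * \<bar>y - z\<bar> + n * S"
        unfolding abs_mult using h yN aS Kf(3) y c1 N0 by (intro add_mono mult_mono) auto
      also have "\<dots> = K1 * \<bar>y - z\<bar> + K2 * n" by (simp add: K1_def K2_def algebra_simps)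
      finally have 1: "p$3 * \<bar>acc q y - acc p z\<bar> \<le> K1 * \<bar>y - z\<bar> + K2 * n" using c1 by (simp add: abs_mult)
      have "1 * \<bar>acc q y - acc p z\<bar> \<le> p$3 * \<bar>acc q y - acc p z\<bar>" using c1 by (intro mult_right_mono) auto
      with 1 show ?thesis by (simp add: y_def z_def)
    qed
    have r: "\<bar>u q x - u p x\<bar> \<le> G * (C0 + K2) * n \<and> \<bar>du q x - du p x\<bar> \<le> G * (C0 + K2) * n" if x: "x \<in> {0..b}" for x
    proof -
      have K2n: "0 \<le> K2 * n" using N0 h by simp
      have bd: "\<bar>acc q (u q t) - acc p (u p t)\<bar> \<le> K1 * (\<bar>u q t - u p t\<bar> + \<bar>du q t - du p t\<bar>) + K2 * n" for t
        using ab[of t] mult_nonneg_nonneg[OF N0(3) abs_ge_zero, of "du q t - du p t"] by (simp add: distrib_left)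
      note g = gronwall_second_order[where r = "\<lambda>x. u q x - u p x" and ?r1.0 = "\<lambda>x. du q x - du p x" and ?r2.0 = "\<lambda>x. acc q (u q x) - acc p (u p x)",
          OF N0(3) K2n DERIV_diff[OF u_deriv[OF q(1)] u_deriv[OF p]] DERIV_diff[OF du_deriv[OF q(1)] du_deriv[OF p]] bd x]
      have i: "\<bar>u q 0 - u p 0\<bar> + \<bar>du q 0 - du p 0\<bar> + K2 * n \<le> (C0 + K2) * n"
        using elim(2) by (simp add: u_0[OF p] u_0[OF q(1)] n_def algebra_simps)
      have "G * (\<bar>u q 0 - u p 0\<bar> + \<bar>du q 0 - du p 0\<bar> + K2 * n) \<le> G * ((C0 + K2) * n)"
        using i N0(5) by (rule mult_left_mono)
      then show ?thesis using g unfolding G_def[symmetric] by (simp only: mult.assoc) linarith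
    qed
    show ?case
    proof
      fix x assume x: "x \<in> {0..b}"
      have "K1 * \<bar>u q x - u p x\<bar> \<le> K1 * (G * (C0 + K2) * n)" using r[OF x] N0 by (intro mult_left_mono) auto
      then have a: "\<bar>acc q (u q x) - acc p (u p x)\<bar> \<le> (K1 * (G * (C0 + K2)) + K2) * n"
        using ab[of x] by (simp add: algebra_simps)
      have "G * (C0 + K2) * n \<le> C * n" "(K1 * (G * (C0 + K2)) + K2) * n \<le> C * n"
        using h(2) parts N0 by (auto intro!: mult_right_mono simp: C_def)
      with a r[OF x] show "\<bar>u q x - u p x\<bar> \<le> C * norm (q - p) \<and>
         \<bar>du q x - du p x\<bar> \<le> C * norm (q - p) \<and> \<bar>acc q (u q x) - acc p (u p x)\<bar> \<le> C * norm (q - p)"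
        unfolding n_def[symmetric] by linarith
    qed
  qed
  with C show ?thesis by blast
qed

end

context
  fixes p assumes p: "p \<in> \<Omega>"
begin

text \<open>The candidates for the derivatives of the wave, with indices 1, 2, 3 for a, E, c. That
  they are derivatives is the content of \<open>wave_derivative\<close>.\<close>

definition variation :: "(3 \<Rightarrow> real \<Rightarrow> real) \<Rightarrow> (3 \<Rightarrow> real \<Rightarrow> real) \<Rightarrow> bool" where
  "variation U U1 \<longleftrightarrow> (\<forall>i. U i 0 = um_grad p i \<and> U1 i 0 = 0 \<and>
     (\<forall>x\<ge>0. (U i has_real_derivative U1 i x) (at x) \<and>
       (U1 i has_real_derivative ((p$3 - 1 - f1 (u p x)) * U i x + of_bool (i = 1) + of_bool (i = 3) * (u p x - acc p (u p x))) / p$3) (at x)))"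

lemma variation_isCont:
  assumes "variation U U1" "x \<ge> 0"
  shows "isCont (U i) x" "isCont (U1 i) x"
proof -
  have "(U i has_real_derivative U1 i x) (at x)"
    "(U1 i has_real_derivative ((p$3 - 1 - f1 (u p x)) * U i x + of_bool (i = 1) + of_bool (i = 3) * (u p x - acc p (u p x))) / p$3) (at x)"
    using assms by (auto simp: variation_def)
  then show "isCont (U i) x" "isCont (U1 i) x" by (blast intro: DERIV_isCont)+
qed

lemma variation_cont:
  assumes "variation U U1"
  shows "continuous_on {0..b} (U i)" "continuous_on {0..b} (U1 i)"
  using variation_isCont[OF assms] by (auto intro!: continuous_at_imp_continuous_on)

text \<open>The remainder solves the linearised equation up to an error quadratic in the parameter
  increment, with initial value controlled by differentiability of the trough value. Gronwall
  carries both bounds to [0, b].\<close>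

lemma wave_derivative:
  assumes b: "b \<ge> 0" and U: "variation U U1" and e: "e > 0"
  shows "\<forall>\<^sub>F q in nhds p. \<forall>x\<in>{0..b}.
     \<bar>u q x - u p x - (\<Sum>i\<in>UNIV. U i x * (q - p)$i)\<bar> \<le> e * norm (q - p) \<and>
     \<bar>du q x - du p x - (\<Sum>i\<in>UNIV. U1 i x * (q - p)$i)\<bar> \<le> e * norm (q - p)"
proof -
  define A B where "A = um p - 1" and "B = up p + 1"
  obtain Kf where Kf: "Kf \<ge> 0" "\<forall>y\<in>{A..B}. \<bar>f y\<bar> \<le> Kf \<and> \<bar>f1 y\<bar> \<le> Kf \<and> \<bar>f2 y\<bar> \<le> Kf"
    "\<forall>y\<in>{A..B}. \<forall>z\<in>{A..B}. \<bar>f y - f z\<bar> \<le> Kf * \<bar>y - z\<bar> \<and> \<bar>f y - f z - f1 z * (y - z)\<bar> \<le> Kf * (y - z)\<^sup>2"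
    by (rule f_bounds)
  obtain C where C: "C \<ge> 0" "\<forall>\<^sub>F q in nhds p. \<forall>x\<in>{0..b}. \<bar>u q x - u p x\<bar> \<le> C * norm (q - p) \<and>
     \<bar>du q x - du p x\<bar> \<le> C * norm (q - p) \<and> \<bar>acc q (u q x) - acc p (u p x)\<bar> \<le> C * norm (q - p)"
    using wave_lipschitz[OF p b] by (elim exE conjE) (rule that)
  define K where "K = \<bar>p$3\<bar> + Kf"
  \<comment> \<open>The term with \<open>Kf\<close> is the Taylor remainder of f;
    \<open>2 * C\<close> covers the two products of the c-increment with a Lipschitz difference; the
    1 keeps \<open>K3\<close> positive for the division below.\<close>
  define K3 where "K3 = Kf * C\<^sup>2 + 2 * C + 1"
  define G where "G = exp ((2 * K + 2) * b) * (1 + b)"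
  have N: "K \<ge> 0" "K3 > 0" "G > 0" using Kf(1) C(1) b by (auto simp: K_def K3_def G_def add_nonneg_pos)
  have c1: "p$3 > 1" by (rule c_gt[OF p])
  \<comment> \<open>Half of the error is spent on the initial value and half on the quadratic
    forcing; \<open>G\<close> is the Gronwall factor.\<close>
  have pos: "e / (2 * G) > 0" "e / (2 * G * K3) > 0" using e N by auto
  show ?thesis
    using ev_range[OF p] C(2) um_derivative[OF p pos(1)] ev_norm_less[OF p pos(2)]
  proof eventually_elim
    case (elim q)
    define n where "n = norm (q - p)"
    define h where "h = q - p"
    define r where "r x = u q x - u p x - (\<Sum>i\<in>UNIV. U i x * h$i)" for x
    define r1 where "r1 x = du q x - du p x - (\<Sum>i\<in>UNIV. U1 i x * h$i)" for x
    define r2 where "r2 x = acc q (u q x) - acc p (u p x)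
      - ((p$3 - 1 - f1 (u p x)) * (\<Sum>i\<in>UNIV. U i x * h$i) + h$1 + h$3 * (u p x - acc p (u p x))) / p$3" for x
    have q: "q \<in> \<Omega>" "\<And>x. u q x \<in> {A..B}" using elim(1) by (auto simp: A_def B_def)
    have pr: "u p x \<in> {A..B}" for x using u_range[OF p, of x] by (auto simp: A_def B_def)
    have hn: "\<bar>h$i\<bar> \<le> n" "n \<ge> 0" for i using component_le_norm_cart[of "q - p" i] by (auto simp: n_def h_def)
    have Ud: "(U i has_real_derivative U1 i x) (at x)"
      "(U1 i has_real_derivative ((p$3 - 1 - f1 (u p x)) * U i x + of_bool (i = 1) + of_bool (i = 3) * (u p x - acc p (u p x))) / p$3) (at x)"
      if "x \<ge> 0" for i x using U that by (auto simp: variation_def)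
    have d1: "(r has_real_derivative r1 x) (at x)" if x: "x \<in> {0..b}" for x
      unfolding r_def r1_def
      by (intro DERIV_diff DERIV_sum DERIV_cmult_right u_deriv[OF q(1)] u_deriv[OF p] Ud) (use x in auto)
    have d2: "(r1 has_real_derivative r2 x) (at x)" if x: "x \<in> {0..b}" for x
    proof -
      have "(r1 has_real_derivative acc q (u q x) - acc p (u p x)
        - (\<Sum>i\<in>UNIV. ((p$3 - 1 - f1 (u p x)) * U i x + of_bool (i = 1) + of_bool (i = 3) * (u p x - acc p (u p x))) / p$3 * h$i)) (at x)"
        unfolding r1_def
        by (intro DERIV_diff DERIV_sum DERIV_cmult_right du_deriv[OF q(1)] du_deriv[OF p] Ud) (use x in auto)
      moreover have "(\<Sum>i\<in>UNIV. ((p$3 - 1 - f1 (u p x)) * U i x + of_bool (i = 1) + of_bool (i = 3) * (u p x - acc p (u p x))) / p$3 * h$i)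
        = ((p$3 - 1 - f1 (u p x)) * (\<Sum>i\<in>UNIV. U i x * h$i) + h$1 + h$3 * (u p x - acc p (u p x))) / p$3"
        using c1 by (simp add: sum_3 field_simps)
      ultimately show ?thesis unfolding r2_def by simp
    qed
    have bd: "\<bar>r2 x\<bar> \<le> K * (\<bar>r x\<bar> + \<bar>r1 x\<bar>) + K3 * n\<^sup>2" if x: "x \<in> {0..b}" for x
    proof -
      define y z where "y = u q x" and "z = u p x"
      have yz: "y \<in> {A..B}" "z \<in> {A..B}" using q pr by (auto simp: y_def z_def)
      have l: "\<bar>y - z\<bar> \<le> C * n" "\<bar>acc q y - acc p z\<bar> \<le> C * n" using bspec[OF elim(2) x] by (auto simp: y_def z_def n_def)
      have s: "(\<Sum>i\<in>UNIV. U i x * h$i) = (y - z) - r x" by (simp add: r_def y_def z_def)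
      have "p$3 * r2 x = p$3 * (acc q y - acc p z) - ((p$3 - 1 - f1 z) * ((y - z) - r x) + h$1 + h$3 * (z - acc p z))"
        unfolding r2_def s using c1 by (simp add: y_def z_def field_simps)
      also have "\<dots> = (p$3 - 1) * r x - f1 z * r x - (f y - f z - f1 z * (y - z)) + h$3 * (y - z) - h$3 * (acc q y - acc p z)"
        unfolding acc_diff[OF p q(1)] h_def[symmetric] by (simp add: algebra_simps)
      finally have "\<bar>p$3 * r2 x\<bar> \<le> \<bar>(p$3 - 1) * r x\<bar> + \<bar>f1 z * r x\<bar> + \<bar>f y - f z - f1 z * (y - z)\<bar> + \<bar>h$3 * (y - z)\<bar> + \<bar>h$3 * (acc q y - acc p z)\<bar>"
        by linarith
      also have "\<dots> \<le> \<bar>p$3\<bar> * \<bar>r x\<bar> + Kf * \<bar>r x\<bar> + Kf * (C * n)\<^sup>2 + n * (C * n) + n * (C * n)"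
      proof -
        have "\<bar>f y - f z - f1 z * (y - z)\<bar> \<le> Kf * (y - z)\<^sup>2" using Kf(3) yz by simp
        also have "\<dots> \<le> Kf * (C * n)\<^sup>2"
          using l(1) Kf(1) power_mono[OF l(1), of 2] by (intro mult_left_mono) auto
        finally have t: "\<bar>f y - f z - f1 z * (y - z)\<bar> \<le> Kf * (C * n)\<^sup>2" .
        have "\<bar>f1 z\<bar> \<le> Kf" using Kf(2) yz by simp
        then show ?thesis unfolding abs_mult using c1 l hn t by (intro add_mono mult_mono) auto
      qed
      also have "\<dots> \<le> K * (\<bar>r x\<bar> + \<bar>r1 x\<bar>) + K3 * n\<^sup>2"
      proof -
        have "0 \<le> K * \<bar>r1 x\<bar>" "0 \<le> n\<^sup>2" using N by auto
        then show ?thesis by (simp add: K_def K3_def algebra_simps power2_eq_square)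
      qed
      finally have 1: "p$3 * \<bar>r2 x\<bar> \<le> K * (\<bar>r x\<bar> + \<bar>r1 x\<bar>) + K3 * n\<^sup>2" using c1 by (simp add: abs_mult)
      have "1 * \<bar>r2 x\<bar> \<le> p$3 * \<bar>r2 x\<bar>" using c1 by (intro mult_right_mono) auto
      with 1 show ?thesis by simp
    qed
    have "r 0 = um q - um p - (\<Sum>i\<in>UNIV. um_grad p i * (q - p)$i)" "r1 0 = 0"
      using U by (simp_all add: r_def r1_def u_0[OF p] u_0[OF q(1)] variation_def h_def)
    then have r0: "\<bar>r 0\<bar> \<le> e / (2 * G) * n" "r1 0 = 0" using elim(3) by (simp_all add: n_def)
    have "K3 * n * n \<le> K3 * (e / (2 * G * K3)) * n"
      using elim(4) N hn by (intro mult_right_mono mult_left_mono) (auto simp: n_def)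
    then have "K3 * n\<^sup>2 \<le> e / (2 * G) * n" using N by (simp add: power2_eq_square mult.assoc)
    with r0 have "\<bar>r 0\<bar> + \<bar>r1 0\<bar> + K3 * n\<^sup>2 \<le> e / G * n" by simp
    then have "G * (\<bar>r 0\<bar> + \<bar>r1 0\<bar> + K3 * n\<^sup>2) \<le> G * (e / G * n)" using N by (intro mult_left_mono) auto
    also have "\<dots> = e * n" using N by simp
    finally have Gb: "G * (\<bar>r 0\<bar> + \<bar>r1 0\<bar> + K3 * n\<^sup>2) \<le> e * n" .
    have K3n: "0 \<le> K3 * n\<^sup>2" using N by simp
    show ?case
    proof
      fix x assume x: "x \<in> {0..b}"
      have "\<bar>r x\<bar> \<le> G * (\<bar>r 0\<bar> + \<bar>r1 0\<bar> + K3 * n\<^sup>2)" "\<bar>r1 x\<bar> \<le> G * (\<bar>r 0\<bar> + \<bar>r1 0\<bar> + K3 * n\<^sup>2)"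
        unfolding G_def using gronwall_second_order[OF N(1) K3n d1 d2 bd x] by auto
      then have "\<bar>r x\<bar> \<le> e * n \<and> \<bar>r1 x\<bar> \<le> e * n" using Gb by linarith
      then show "\<bar>u q x - u p x - (\<Sum>i\<in>UNIV. U i x * (q - p)$i)\<bar> \<le> e * norm (q - p) \<and>
         \<bar>du q x - du p x - (\<Sum>i\<in>UNIV. U1 i x * (q - p)$i)\<bar> \<le> e * norm (q - p)"
        by (simp add: r_def r1_def n_def h_def)
    qed
  qed
qed

end

section \<open>The period and integrals over a period as functions of the parameters\<close>

lemma IVT_zero:
  fixes g :: "real \<Rightarrow> real"
  assumes "continuous_on {a..b} g" "g a < 0" "g b > 0" "a \<le> b"
  obtains t where "t \<in> {a..b}" "g t = 0"
  using IVT'[of g a 0 b] assms by force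

context
  fixes p assumes p: "p \<in> \<Omega>"
begin

lemma acc_pos_near:
  assumes "u p t = um p"
  shows "\<exists>d>0. \<forall>x. \<bar>x - t\<bar> < d \<longrightarrow> acc p (u p x) > k0 p / 2"
proof -
  have "isCont (\<lambda>x. acc p (u p x)) t"
    by (rule isCont_o2[OF DERIV_isCont[OF u_deriv[OF p]] DERIV_isCont[OF acc_deriv[OF p]]])
  then have "((\<lambda>x. acc p (u p x)) \<longlongrightarrow> acc p (u p t)) (nhds t)"
    by (simp only: isCont_def tendsto_at_iff_tendsto_nhds[of "\<lambda>x. acc p (u p x)" t])
  moreover have "acc p (u p t) > k0 p / 2" using k0_pos[OF p] by (simp add: assms k0_def[OF p])
  ultimately have "\<forall>\<^sub>F x in nhds t. acc p (u p x) > k0 p / 2" by (rule order_tendstoD(1))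
  then show ?thesis unfolding eventually_nhds_metric by (simp add: dist_real_def)
qed

text \<open>The first return is trapped. Near 0 positive acceleration makes a nearby wave rise, in
  the middle it stays above its trough, and near T its increasing slope changes sign.\<close>

lemma period_near:
  assumes \<delta>: "\<delta> > 0"
  shows "\<forall>\<^sub>F q in nhds p. \<bar>period (u q) - T p\<bar> \<le> \<delta>"
proof -
  obtain d1 where d1: "d1 > 0" "\<forall>x. \<bar>x - 0\<bar> < d1 \<longrightarrow> acc p (u p x) > k0 p / 2"
    using acc_pos_near[OF u_0(1)[OF p]] by blast
  obtain d2 where d2: "d2 > 0" "\<forall>x. \<bar>x - T p\<bar> < d2 \<longrightarrow> acc p (u p x) > k0 p / 2"
    using acc_pos_near[OF T_pos(2)[OF p]] by blast
  define d where "d = Min {\<delta>, d1 / 2, d2 / 2, T p / 3, 1}"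
  have d: "d > 0" "d \<le> \<delta>" "d < d1" "d < d2" "d < T p / 2" "d \<le> 1"
    using \<delta> d1(1) d2(1) T_pos(1)[OF p] by (auto simp: d_def min_def)
  define b where "b = T p + 1"
  have b: "b \<ge> 0" using T_pos(1)[OF p] by (simp add: b_def)
  obtain C where C: "C \<ge> 0" "\<forall>\<^sub>F q in nhds p. \<forall>x\<in>{0..b}. \<bar>u q x - u p x\<bar> \<le> C * norm (q - p) \<and>
     \<bar>du q x - du p x\<bar> \<le> C * norm (q - p) \<and> \<bar>acc q (u q x) - acc p (u p x)\<bar> \<le> C * norm (q - p)"
    using wave_lipschitz[OF p b] by (elim exE conjE) (rule that)
  have "{d..T p - d} \<noteq> {}" using d by auto
  then obtain x0 where x0: "x0 \<in> {d..T p - d}" "\<forall>x\<in>{d..T p - d}. u p x0 \<le> u p x"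
    using continuous_attains_inf[OF compact_Icc _ u_cont(1)[OF p]] by blast
  define \<eta> where "\<eta> = u p x0 - um p"
  have \<eta>: "\<eta> > 0" using x0(1) d period_props(3)[OF p, of x0] by (simp add: \<eta>_def T_def[OF p])
  have inc: "du p x < du p y" if "T p - d \<le> x" "x < y" "y \<le> T p + d" for x y
  proof (rule DERIV_pos_imp_increasing[where f = "du p" and a = x and b = y])
    fix z assume z: "x \<le> z" "z \<le> y"
    then have "\<bar>z - T p\<bar> < d2" using that d by auto
    then have "acc p (u p z) > 0" using d2(2) k0_pos[OF p] by (meson half_gt_zero less_trans)
    then show "\<exists>l. (du p has_real_derivative l) (at z) \<and> 0 < l" using du_deriv[OF p, of z] by blast
  qed (use that in simp)
  define m where "m = min (- du p (T p - d)) (du p (T p + d))"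
  have m: "m > 0" using inc[of "T p - d" "T p"] inc[of "T p" "T p + d"] d(1) T_pos(3)[OF p] by (simp add: m_def)
  \<comment> \<open>The entries keep, in this order, the acceleration positive near 0 and T, the
    wave above its trough in the middle (two errors of size n against \<eta>), and the signs of the
    slope around T. Dividing by C + 1 also covers C = 0.\<close>
  define E where "E = Min {k0 p / 2, \<eta> / 3, m / 2} / (C + 1)"
  have E: "E > 0" using k0_pos[OF p] \<eta> m C(1) by (auto simp: E_def)
  show ?thesis using ev_\<Omega>[OF p] C(2) ev_norm_less[OF p E]
  proof eventually_elim
    case (elim q)
    define n where "n = C * norm (q - p)"
    have "(C + 1) * norm (q - p) < Min {k0 p / 2, \<eta> / 3, m / 2}"
      using elim(3) C(1) unfolding E_def by (simp add: pos_less_divide_eq mult.commute)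
    moreover have "n \<le> (C + 1) * norm (q - p)" by (simp add: n_def distrib_right)
    ultimately have n: "n < k0 p / 2" "n < \<eta> / 3" "n < m / 2" by (auto simp del: Min_less_iff)
    have l: "\<bar>u q x - u p x\<bar> \<le> n" "\<bar>du q x - du p x\<bar> \<le> n" "\<bar>acc q (u q x) - acc p (u p x)\<bar> \<le> n"
      if "0 \<le> x" "x \<le> b" for x using elim(2) that by (auto simp: n_def)
    have a1: "acc q (u q x) > 0" if "x \<in> {0..d}" for x
      using l(3)[of x] d1(2)[rule_format, of x] that d n(1) T_pos(1)[OF p] by (auto simp: b_def)
    have a2: "acc q (u q x) > 0" if "x \<in> {T p - d..T p + d}" for x
    proof -
      have "\<bar>x - T p\<bar> < d2" using that d by (auto simp: abs_less_iff)
      then have "acc p (u p x) > k0 p / 2" using d2(2) by blast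
      moreover have "\<bar>acc q (u q x) - acc p (u p x)\<bar> \<le> n" using that d by (intro l) (auto simp: b_def)
      ultimately show ?thesis using n(1) by linarith
    qed
    have mid: "u q x \<noteq> um q" if "x \<in> {d..T p - d}" for x
    proof -
      have "\<bar>um q - um p\<bar> \<le> n" using l(1)[of 0] b by (simp add: u_0(1)[OF p] u_0(1)[OF elim(1)])
      moreover have "\<bar>u q x - u p x\<bar> \<le> n" using that d by (intro l) (auto simp: b_def)
      moreover have "u p x - um p \<ge> \<eta>" using x0(2) that by (simp add: \<eta>_def)
      ultimately show ?thesis using n(2) \<eta> by linarith
    qed
    have "du q (T p - d) < 0" "du q (T p + d) > 0"
      using l(2)[of "T p - d"] l(2)[of "T p + d"] d n(3) m by (auto simp: b_def m_def)
    then obtain t where t: "t \<in> {T p - d..T p + d}" "du q t = 0"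
      using d(1) by (elim IVT_zero[OF u_cont(2)[OF elim(1)], rotated]) auto
    \<comment> \<open>A zero of the slope is a trough or a crest, and positive acceleration excludes
      a crest.\<close>
    have "u q t \<noteq> up q" using a2[OF t(1)] acc_up[OF elim(1)] by auto
    then have ut: "u q t = um q" using du_zero[OF elim(1) t(2)] by blast
    note P = period_props[OF elim(1)]
    have "t > 0" using t d by auto
    then have "period (u q) \<le> t" using P(3)[of t] ut by (cases "t < period (u q)") auto
    then have up: "period (u q) \<le> T p + d" using t by simp
    have "\<not> period (u q) \<le> d" using u_gt_near_0[OF elim(1) a1 P(1)] P(2) by auto
    then have "period (u q) > T p - d" using mid[of "period (u q)"] P(2) by (cases "period (u q) \<le> T p - d") auto
    then show ?case using up d(2) by simp
  qed
qed

lemma period_tendsto: "((\<lambda>q. period (u q)) \<longlongrightarrow> T p) (nhds p)"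
proof (rule tendstoI)
  fix e :: real assume "e > 0"
  then have "\<forall>\<^sub>F q in nhds p. \<bar>period (u q) - T p\<bar> \<le> e / 2" by (intro period_near) simp
  then show "\<forall>\<^sub>F q in nhds p. dist (period (u q)) (T p) < e"
    by (rule eventually_mono) (use \<open>e > 0\<close> in \<open>simp add: dist_real_def\<close>)
qed

lemma ev_period: "\<forall>\<^sub>F q in nhds p. period (u q) \<in> {0<..<T p + 1}"
  using period_tendsto T_pos(1)[OF p] by (intro topological_tendstoD) auto

text \<open>Implicit differentiation of u_x(T) = 0 in the parameters.\<close>

definition T_grad :: "(3 \<Rightarrow> real \<Rightarrow> real) \<Rightarrow> 3 \<Rightarrow> real" where
  "T_grad U1 i = - U1 i (T p) / k0 p"

text \<open>The return condition u(T) = um is degenerate, as u_x vanishes at T. The equation u_x(T)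
  = 0 has a simple zero there, with slope \<open>k0\<close>, and determines the period to first
  order.\<close>

lemma period_derivative:
  assumes U: "variation p U U1"
  shows "((\<lambda>q. period (u q)) has_derivative (\<lambda>h. \<Sum>i\<in>UNIV. T_grad U1 i * h$i)) (at p)"
proof -
  define \<theta> where "\<theta> q = period (u q)" for q
  obtain S where S: "\<And>z. du p z - du p (T p) = S z * (z - T p)" "isCont S (T p)" "S (T p) = acc p (u p (T p))"
    using du_deriv[OF p, of "T p"] unfolding CARAT_DERIV by blast
  have S0: "S (T p) = k0 p" "k0 p \<noteq> 0" using k0_pos[OF p] T_pos(2)[OF p] S(3) by (auto simp: k0_def[OF p])
  have St: "((\<lambda>q. S (\<theta> q)) \<longlongrightarrow> k0 p) (nhds p)"
    using isCont_tendsto_compose[OF S(2) period_tendsto] S0 by (simp add: \<theta>_def)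
  have b: "T p + 1 \<ge> 0" using T_pos(1)[OF p] by simp
  have U1t: "((\<lambda>q. U1 i (\<theta> q)) \<longlongrightarrow> U1 i (T p)) (nhds p)" for i
  proof -
    have "isCont (U1 i) (T p)" using variation_isCont(2)[OF p U] T_pos(1)[OF p] by simp
    from isCont_tendsto_compose[OF this period_tendsto] show ?thesis by (simp add: \<theta>_def)
  qed
  have \<theta>p: "\<theta> p = T p" by (simp add: \<theta>_def T_def[OF p])
  have "(\<theta> has_derivative (\<lambda>h. \<Sum>i\<in>UNIV. T_grad U1 i * h$i)) (at p)"
  proof (rule caratheodory_derivative)
    show "((\<lambda>q. - U1 i (\<theta> q) / S (\<theta> q)) \<longlongrightarrow> T_grad U1 i) (nhds p)" for i
      unfolding T_grad_def by (intro tendsto_intros U1t St S0)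
    fix e :: real assume e: "e > 0"
    \<comment> \<open>The slope \<open>S\<close> exceeds \<open>k0 p / 2\<close> for nearby
      parameters, so an error of this size in u_x costs at most \<open>e\<close> in the
      period.\<close>
    have e': "e * (k0 p / 2) > 0" using e k0_pos[OF p] by simp
    have "\<forall>\<^sub>F q in nhds p. S (\<theta> q) > k0 p / 2" using St k0_pos[OF p] by (intro order_tendstoD) auto
    then show "\<forall>\<^sub>F q in nhds p. \<bar>\<theta> q - \<theta> p - (\<Sum>i\<in>UNIV. (- U1 i (\<theta> q) / S (\<theta> q)) * (q - p)$i)\<bar> \<le> e * norm (q - p)"
      using wave_derivative[OF p b U e'] ev_period ev_\<Omega>[OF p]
    proof eventually_elim
      case (elim q)
      define W where "W = (\<Sum>i\<in>UNIV. U1 i (\<theta> q) * (q - p)$i)"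
      have S1: "S (\<theta> q) > 0" using elim(1) k0_pos[OF p] by linarith
      have "du q (\<theta> q) = 0" unfolding \<theta>_def using period_props(2)[OF elim(4)] by (rule du_at_um[OF elim(4)])
      then have "S (\<theta> q) * (\<theta> q - T p) + W = - (du q (\<theta> q) - du p (\<theta> q) - W)"
        using S(1)[of "\<theta> q"] T_pos(3)[OF p] by simp
      moreover have "\<theta> q \<in> {0..T p + 1}" using elim(3) by (auto simp: \<theta>_def)
      ultimately have "\<bar>S (\<theta> q) * (\<theta> q - T p) + W\<bar> \<le> e * (k0 p / 2) * norm (q - p)"
        using elim(2) unfolding W_def by (simp only: abs_minus_cancel)
      also have "\<dots> \<le> e * S (\<theta> q) * norm (q - p)" using elim(1) e by (intro mult_right_mono mult_left_mono) auto
      finally have 1: "\<bar>S (\<theta> q) * (\<theta> q - T p) + W\<bar> \<le> S (\<theta> q) * (e * norm (q - p))" by (simp add: mult_ac)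
      have "\<theta> q - \<theta> p - (\<Sum>i\<in>UNIV. (- U1 i (\<theta> q) / S (\<theta> q)) * (q - p)$i) = (S (\<theta> q) * (\<theta> q - T p) + W) / S (\<theta> q)"
        using S1 by (simp add: W_def \<theta>p sum_3 field_simps)
      then show ?case using 1 S1 by (simp add: abs_divide pos_divide_le_eq mult.commute)
    qed
  qed
  then show ?thesis by (simp only: \<theta>_def[abs_def])
qed

text \<open>Leibniz' rule with a moving endpoint. Splitting the integrand into
  \<open>\<rho> q - \<rho> p\<close> and \<open>\<rho> p\<close> separates the change of the
  integrand from that of the endpoint; estimates on [0, T + 1] cover every nearby period.\<close>

lemma period_integral_derivative:
  fixes \<rho> :: "real^3 \<Rightarrow> real \<Rightarrow> real" and R :: "3 \<Rightarrow> real \<Rightarrow> real"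
  assumes U: "variation p U U1"
    and \<rho>c: "\<And>q. q \<in> \<Omega> \<Longrightarrow> continuous_on {0..T p + 1} (\<rho> q)"
    and Rc: "\<And>i. continuous_on {0..T p + 1} (R i)"
    and d: "\<And>e. e > 0 \<Longrightarrow> \<forall>\<^sub>F q in nhds p. \<forall>x\<in>{0..T p + 1}. \<bar>\<rho> q x - \<rho> p x - (\<Sum>i\<in>UNIV. R i x * (q - p)$i)\<bar> \<le> e * norm (q - p)"
  shows "((\<lambda>q. integral {0..period (u q)} (\<rho> q)) has_derivative
     (\<lambda>h. \<Sum>i\<in>UNIV. (integral {0..T p} (R i) + \<rho> p (T p) * T_grad U1 i) * h$i)) (at p)"
proof -
  define \<theta> where "\<theta> q = period (u q)" for q
  define b where "b = T p + 1"
  have b: "b > 0" "T p \<in> {0<..<b}" using T_pos(1)[OF p] by (auto simp: b_def)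
  have \<theta>p: "\<theta> p = T p" by (simp add: \<theta>_def T_def[OF p])
  have ii: "(\<lambda>x. g x) integrable_on {0..t}" if "continuous_on {0..b} g" "t \<le> b" for g :: "real \<Rightarrow> real" and t
    using that by (intro integrable_continuous_interval) (auto elim: continuous_on_subset)
  have cint: "isCont (\<lambda>t. integral {0..t} g) (T p) \<and> ((\<lambda>t. integral {0..t} g) has_real_derivative g (T p)) (at (T p))"
    if g: "continuous_on {0..b} g" for g :: "real \<Rightarrow> real"
  proof -
    have "((\<lambda>t. integral {0..t} g) has_real_derivative g (T p)) (at (T p) within {0..b})"
      using integral_has_vector_derivative[OF g, of "T p"] b(2) by (simp add: has_real_derivative_iff_has_vector_derivative)
    then have "((\<lambda>t. integral {0..t} g) has_real_derivative g (T p)) (at (T p))"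
      using b(2) by (simp add: at_within_Icc_at)
    then show ?thesis by (auto intro: DERIV_isCont)
  qed
  have A: "((\<lambda>q. integral {0..\<theta> q} (\<rho> p)) has_derivative (\<lambda>h. \<rho> p (T p) * (\<Sum>i\<in>UNIV. T_grad U1 i * h$i))) (at p)"
  proof -
    have 1: "((\<lambda>t. integral {0..t} (\<rho> p)) has_derivative (\<lambda>x. \<rho> p (T p) * x)) (at (\<theta> p))"
      using cint[of "\<rho> p"] \<rho>c[OF p] by (simp add: b_def \<theta>p has_field_derivative_def)
    have 2: "(\<theta> has_derivative (\<lambda>h. \<Sum>i\<in>UNIV. T_grad U1 i * h$i)) (at p)"
      using period_derivative[OF U] by (simp add: \<theta>_def[abs_def])
    from has_derivative_compose[OF 2 1] show ?thesis .
  qed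
  have B: "((\<lambda>q. integral {0..\<theta> q} (\<lambda>x. \<rho> q x - \<rho> p x)) has_derivative (\<lambda>h. \<Sum>i\<in>UNIV. integral {0..T p} (R i) * h$i)) (at p)"
  proof (rule caratheodory_derivative)
    show "((\<lambda>q. integral {0..\<theta> q} (R i)) \<longlongrightarrow> integral {0..T p} (R i)) (nhds p)" for i
      using isCont_tendsto_compose[OF conjunct1[OF cint[of "R i"]] period_tendsto] Rc[of i] by (simp add: b_def \<theta>_def)
    fix e :: real assume e: "e > 0"
    then have "e / b > 0" using b by simp
    from d[OF this] ev_period ev_\<Omega>[OF p]
    show "\<forall>\<^sub>F q in nhds p. \<bar>integral {0..\<theta> q} (\<lambda>x. \<rho> q x - \<rho> p x) - integral {0..\<theta> p} (\<lambda>x. \<rho> p x - \<rho> p x)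
        - (\<Sum>i\<in>UNIV. integral {0..\<theta> q} (R i) * (q - p)$i)\<bar> \<le> e * norm (q - p)"
    proof eventually_elim
      case (elim q)
      have \<theta>: "0 \<le> \<theta> q" "\<theta> q \<le> b" using elim(2) by (auto simp: \<theta>_def b_def)
      have c: "continuous_on {0..b} (\<lambda>x. \<rho> q x - \<rho> p x)" "continuous_on {0..b} (\<lambda>x. \<Sum>i\<in>UNIV. R i x * (q - p)$i)"
        using \<rho>c[OF elim(3)] \<rho>c[OF p] Rc by (auto intro!: continuous_intros simp: b_def)
      have "(\<Sum>i\<in>UNIV. integral {0..\<theta> q} (R i) * (q - p)$i) = integral {0..\<theta> q} (\<lambda>x. \<Sum>i\<in>UNIV. R i x * (q - p)$i)"
        by (subst integral_sum) (auto intro!: integrable_on_mult_left ii Rc[folded b_def] \<theta>)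
      then have "integral {0..\<theta> q} (\<lambda>x. \<rho> q x - \<rho> p x) - (\<Sum>i\<in>UNIV. integral {0..\<theta> q} (R i) * (q - p)$i)
         = integral {0..\<theta> q} (\<lambda>x. (\<rho> q x - \<rho> p x) - (\<Sum>i\<in>UNIV. R i x * (q - p)$i))"
        using integral_diff[OF ii[OF c(1) \<theta>(2)] ii[OF c(2) \<theta>(2)]] by simp
      also have "norm \<dots> \<le> (e / b * norm (q - p)) * (\<theta> q - 0)"
      proof (rule integral_bound)
        show "continuous_on {0..\<theta> q} (\<lambda>x. (\<rho> q x - \<rho> p x) - (\<Sum>i\<in>UNIV. R i x * (q - p)$i))"
          using continuous_on_diff[OF c] by (rule continuous_on_subset) (use \<theta> in auto)
      qed (use elim(1) \<theta> in \<open>auto simp: b_def\<close>)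
      also have "\<dots> \<le> (e / b * norm (q - p)) * b" using \<theta> e b by (intro mult_left_mono) auto
      finally show ?case using b by simp
    qed
  qed
  have AB: "((\<lambda>q. integral {0..\<theta> q} (\<lambda>x. \<rho> q x - \<rho> p x) + integral {0..\<theta> q} (\<rho> p)) has_derivative
     (\<lambda>h. (\<Sum>i\<in>UNIV. integral {0..T p} (R i) * h$i) + \<rho> p (T p) * (\<Sum>i\<in>UNIV. T_grad U1 i * h$i))) (at p)"
    by (rule has_derivative_add[OF B A])
  have "\<forall>\<^sub>F q in nhds p. integral {0..\<theta> q} (\<lambda>x. \<rho> q x - \<rho> p x) + integral {0..\<theta> q} (\<rho> p) = integral {0..\<theta> q} (\<rho> q)"
    using ev_period ev_\<Omega>[OF p]
  proof eventually_elim
    case (elim q)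
    have \<theta>: "\<theta> q \<le> b" using elim(1) by (auto simp: \<theta>_def b_def)
    show ?case
      using integral_diff[OF ii[OF \<rho>c[OF elim(2), folded b_def] \<theta>] ii[OF \<rho>c[OF p, folded b_def] \<theta>]] by simp
  qed
  then have "((\<lambda>q. integral {0..\<theta> q} (\<rho> q)) has_derivative
     (\<lambda>h. (\<Sum>i\<in>UNIV. integral {0..T p} (R i) * h$i) + \<rho> p (T p) * (\<Sum>i\<in>UNIV. T_grad U1 i * h$i))) (at p)"
    using AB by (intro has_derivative_transform_eventually[OF AB]) (auto simp: eventually_at_filter eventually_mono dest: eventually_nhds_x_imp_x)
  then show ?thesis by (simp add: \<theta>_def sum_distrib_left distrib_right sum.distrib mult.assoc)
qed

end

end

section \<open>The bracket of period, mass and momentum\<close>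

context wave_parameters
begin

context
  fixes p assumes p: "p \<in> \<Omega>"
begin

lemma energy_density_derivative:
  assumes U: "variation p U U1" and e: "e > 0"
  shows "\<forall>\<^sub>F q in nhds p. \<forall>x\<in>{0..T p + 1}. \<bar>((u q x)\<^sup>2 + (du q x)\<^sup>2) - ((u p x)\<^sup>2 + (du p x)\<^sup>2)
     - (\<Sum>i\<in>UNIV. (2 * (u p x * U i x + du p x * U1 i x)) * (q - p)$i)\<bar> \<le> e * norm (q - p)"
proof -
  have b: "T p + 1 \<ge> 0" using T_pos(1)[OF p] by simp
  obtain N1 where N1: "N1 \<ge> 0" "\<forall>x\<in>{0..T p + 1}. norm (u p x) \<le> N1" using continuous_on_Icc_bounded[OF u_cont(1)[OF p]] by blast
  obtain N2 where N2: "N2 \<ge> 0" "\<forall>x\<in>{0..T p + 1}. norm (du p x) \<le> N2" using continuous_on_Icc_bounded[OF u_cont(2)[OF p]] by blast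
  define N where "N = N1 + N2 + 1"
  obtain C where C: "C \<ge> 0" "\<forall>\<^sub>F q in nhds p. \<forall>x\<in>{0..T p + 1}. \<bar>u q x - u p x\<bar> \<le> C * norm (q - p) \<and>
     \<bar>du q x - du p x\<bar> \<le> C * norm (q - p) \<and> \<bar>acc q (u q x) - acc p (u p x)\<bar> \<le> C * norm (q - p)"
    using wave_lipschitz[OF p b] by (elim exE conjE) (rule that)
  have N0: "N > 0" using N1(1) N2(1) by (simp add: N_def)
  define D where "D = C\<^sup>2 + 1"
  have D0: "D > 0" "C\<^sup>2 \<le> D" by (simp_all add: D_def add_nonneg_pos)
  \<comment> \<open>Each of the two squares may cost e/2: a quarter from the cross term, where 2 N
    times e/(8 N) is e/4, and a quarter from the squared increment. \<open>D\<close> exceeds the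
    squared Lipschitz constant by 1 to stay positive.\<close>
  have pos: "e / (8 * N) > 0" "e / (4 * D) > 0" using e N0 D0 by auto
  show ?thesis
    using C(2) wave_derivative[OF p b U pos(1)] ev_norm_less[OF p pos(2)]
  proof eventually_elim
    case (elim q)
    define n where "n = norm (q - p)"
    have one: "\<bar>a\<^sup>2 - z\<^sup>2 - 2 * z * s\<bar> \<le> e / 2 * n" if "\<bar>a - z\<bar> \<le> C * n" "\<bar>a - z - s\<bar> \<le> e / (8 * N) * n" "\<bar>z\<bar> \<le> N" for a z s :: real
    proof -
      have n0: "n \<ge> 0" by (simp add: n_def)
      have "a\<^sup>2 - z\<^sup>2 - 2 * z * s = (a - z)\<^sup>2 + 2 * z * (a - z - s)" by (simp add: power2_eq_square algebra_simps)
      then have "\<bar>a\<^sup>2 - z\<^sup>2 - 2 * z * s\<bar> \<le> (a - z)\<^sup>2 + 2 * (\<bar>z\<bar> * \<bar>a - z - s\<bar>)"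
        using abs_triangle_ineq[of "(a - z)\<^sup>2" "2 * z * (a - z - s)"] by (simp add: abs_mult)
      also have "(a - z)\<^sup>2 \<le> (C * n)\<^sup>2" using power_mono[OF that(1), of 2] by simp
      also have "(C * n)\<^sup>2 = C\<^sup>2 * n * n" by (simp add: power2_eq_square mult_ac)
      also have "C\<^sup>2 * n * n \<le> D * (e / (4 * D)) * n"
        using elim(3) D0 n0 by (intro mult_right_mono mult_mono) (auto simp: n_def)
      also have "D * (e / (4 * D)) * n = e / 4 * n" using D0 by simp
      also have "\<bar>z\<bar> * \<bar>a - z - s\<bar> \<le> N * (e / (8 * N) * n)" using that N0 by (intro mult_mono) auto
      also have "N * (e / (8 * N) * n) = e / 8 * n" using N0 by simp
      finally show ?thesis by simp
    qed
    show ?case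
    proof
      fix x assume x: "x \<in> {0..T p + 1}"
      define s1 s2 where "s1 = (\<Sum>i\<in>UNIV. U i x * (q - p)$i)" and "s2 = (\<Sum>i\<in>UNIV. U1 i x * (q - p)$i)"
      have zN: "\<bar>u p x\<bar> \<le> N" "\<bar>du p x\<bar> \<le> N" using bspec[OF N1(2) x] bspec[OF N2(2) x] N1(1) N2(1) by (auto simp: N_def)
      have l: "\<bar>u q x - u p x\<bar> \<le> C * n" "\<bar>du q x - du p x\<bar> \<le> C * n"
        using bspec[OF elim(1) x] unfolding n_def by blast+
      have w: "\<bar>u q x - u p x - s1\<bar> \<le> e / (8 * N) * n" "\<bar>du q x - du p x - s2\<bar> \<le> e / (8 * N) * n"
        using bspec[OF elim(2) x] unfolding n_def s1_def s2_def by blast+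
      have "\<bar>(u q x)\<^sup>2 - (u p x)\<^sup>2 - 2 * u p x * s1\<bar> \<le> e / 2 * n" "\<bar>(du q x)\<^sup>2 - (du p x)\<^sup>2 - 2 * du p x * s2\<bar> \<le> e / 2 * n"
        by (rule one[OF l(1) w(1) zN(1)], rule one[OF l(2) w(2) zN(2)])
      moreover have "((u q x)\<^sup>2 + (du q x)\<^sup>2) - ((u p x)\<^sup>2 + (du p x)\<^sup>2)
     - (\<Sum>i\<in>UNIV. (2 * (u p x * U i x + du p x * U1 i x)) * (q - p)$i)
        = ((u q x)\<^sup>2 - (u p x)\<^sup>2 - 2 * u p x * s1) + ((du q x)\<^sup>2 - (du p x)\<^sup>2 - 2 * du p x * s2)"
        by (simp add: s1_def s2_def sum_3 algebra_simps)
      ultimately show "\<bar>((u q x)\<^sup>2 + (du q x)\<^sup>2) - ((u p x)\<^sup>2 + (du p x)\<^sup>2)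
     - (\<Sum>i\<in>UNIV. (2 * (u p x * U i x + du p x * U1 i x)) * (q - p)$i)\<bar> \<le> e * norm (q - p)"
        unfolding n_def by (simp only:)
    qed
  qed
qed

text \<open>The boundary term u_x U vanishes because u_x is zero at 0 and at T. This turns the
  derivative of the momentum into the weight u - u_xx of the conserved functional.\<close>

lemma variation_by_parts:
  assumes U: "variation p U U1"
  shows "integral {0..T p} (\<lambda>x. 2 * (u p x * U i x + du p x * U1 i x)) = 2 * integral {0..T p} (\<lambda>x. U i x * (u p x - acc p (u p x)))"
proof -
  have d: "((\<lambda>x. 2 * (du p x * U i x)) has_vector_derivative 2 * (acc p (u p x) * U i x + du p x * U1 i x)) (at x)" if "x \<ge> 0" for x
  proof -
    have "(U i has_real_derivative U1 i x) (at x)" using U that by (auto simp: variation_def[OF p])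
    from DERIV_cmult[OF DERIV_mult[OF du_deriv[OF p] this], of 2] show ?thesis
      by (simp add: has_real_derivative_iff_has_vector_derivative algebra_simps)
  qed
  have "((\<lambda>x. 2 * (acc p (u p x) * U i x + du p x * U1 i x)) has_integral 2 * (du p (T p) * U i (T p)) - 2 * (du p 0 * U i 0)) {0..T p}"
    by (rule fundamental_theorem_of_calculus[OF _ has_vector_derivative_at_within[OF d]]) (use T_pos(1)[OF p] in auto)
  then have 1: "((\<lambda>x. 2 * (acc p (u p x) * U i x + du p x * U1 i x)) has_integral 0) {0..T p}"
    by (simp add: T_pos(3)[OF p] u_0(2)[OF p])
  have "continuous_on {0..T p} (\<lambda>x. acc p (u p x))"
  proof (rule continuous_at_imp_continuous_on, rule ballI)
    fix x
    show "isCont (\<lambda>x. acc p (u p x)) x"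
      by (rule isCont_o2[OF DERIV_isCont[OF u_deriv[OF p]] DERIV_isCont[OF acc_deriv[OF p]]])
  qed
  then have "(\<lambda>x. U i x * (u p x - acc p (u p x))) integrable_on {0..T p}"
    by (intro integrable_continuous_interval continuous_intros variation_cont[OF p U] u_cont[OF p])
  then have "((\<lambda>x. 2 * (U i x * (u p x - acc p (u p x)))) has_integral 2 * integral {0..T p} (\<lambda>x. U i x * (u p x - acc p (u p x)))) {0..T p}"
    by (intro has_integral_mult_right integrable_integral)
  from has_integral_add[OF this 1]
  have "((\<lambda>x. 2 * (u p x * U i x + du p x * U1 i x)) has_integral 2 * integral {0..T p} (\<lambda>x. U i x * (u p x - acc p (u p x)))) {0..T p}"
    by (simp add: algebra_simps)
  then show ?thesis by (rule integral_unique)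
qed

text \<open>The endpoint contributions to the derivatives of mass and momentum are \<open>um\<close>
  and half its square times the period row, so they drop out of the determinant. The factor -1/k0
  comes from the period row.\<close>

lemma TMP_bracket_variation:
  assumes U: "variation p U U1"
  shows "TMP_bracket u p = - 1 / k0 p * det3 (\<lambda>i. U1 i (T p)) (\<lambda>i. integral {0..T p} (U i))
     (\<lambda>i. integral {0..T p} (\<lambda>x. U i x * (u p x - acc p (u p x))))"
proof -
  define \<tau> where "\<tau> = T_grad p U1"
  define I1 where "I1 i = integral {0..T p} (U i)" for i
  define I2 where "I2 i = integral {0..T p} (\<lambda>x. U i x * (u p x - acc p (u p x)))" for i
  define R1 where "R1 i = I1 i + um p * \<tau> i" for i
  define R2 where "R2 i = I2 i + (um p)\<^sup>2 / 2 * \<tau> i" for i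
  have b: "T p + 1 \<ge> 0" using T_pos(1)[OF p] by simp
  have D1: "((\<lambda>q. period (u q)) has_derivative (\<lambda>h. \<Sum>i\<in>UNIV. \<tau> i * h$i)) (at p)"
    unfolding \<tau>_def by (rule period_derivative[OF p U])
  have "((\<lambda>q. integral {0..period (u q)} (u q)) has_derivative
     (\<lambda>h. \<Sum>i\<in>UNIV. (integral {0..T p} (U i) + u p (T p) * T_grad p U1 i) * h$i)) (at p)"
  proof (rule period_integral_derivative[OF p U])
    fix e :: real assume "e > 0"
    from wave_derivative[OF p b U this]
    show "\<forall>\<^sub>F q in nhds p. \<forall>x\<in>{0..T p + 1}. \<bar>u q x - u p x - (\<Sum>i\<in>UNIV. U i x * (q - p)$i)\<bar> \<le> e * norm (q - p)"
      by (rule eventually_mono) blast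
  qed (intro u_cont variation_cont[OF p U], assumption?)+
  then have D2: "((\<lambda>q. mass (u q)) has_derivative (\<lambda>h. \<Sum>i\<in>UNIV. R1 i * h$i)) (at p)"
    by (simp add: mass_def R1_def I1_def \<tau>_def T_pos(2)[OF p])
  have "((\<lambda>q. integral {0..period (u q)} (\<lambda>x. (u q x)\<^sup>2 + (du q x)\<^sup>2)) has_derivative
     (\<lambda>h. \<Sum>i\<in>UNIV. (integral {0..T p} (\<lambda>x. 2 * (u p x * U i x + du p x * U1 i x)) + ((u p (T p))\<^sup>2 + (du p (T p))\<^sup>2) * T_grad p U1 i) * h$i)) (at p)"
    by (rule period_integral_derivative[OF p U])
       (intro continuous_intros u_cont variation_cont[OF p U] energy_density_derivative[OF U] p | assumption)+
  then have "((\<lambda>q. integral {0..period (u q)} (\<lambda>x. (u q x)\<^sup>2 + (du q x)\<^sup>2)) has_derivative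
     (\<lambda>h. \<Sum>i\<in>UNIV. (2 * I2 i + (um p)\<^sup>2 * \<tau> i) * h$i)) (at p)"
    unfolding variation_by_parts[OF U] T_pos(2,3)[OF p] by (simp add: I2_def \<tau>_def)
  from has_derivative_mult_right[OF this, of "1 / 2"]
  have D3: "((\<lambda>q. momentum (u q)) has_derivative (\<lambda>h. \<Sum>i\<in>UNIV. R2 i * h$i)) (at p)"
    by (simp add: momentum_def R2_def sum_3 algebra_simps)
  define J :: "real^3^3" where "J = (\<chi> r i. if r = 1 then \<tau> i else if r = 2 then R1 i else R2 i)"
  have "((\<lambda>q. vector [period (u q), mass (u q), momentum (u q)] :: real^3) has_derivative (\<lambda>h. J *v h)) (at p)"
  proof -
    have "((\<lambda>q. (vector [period (u q), mass (u q), momentum (u q)] :: real^3) $ r) has_derivative (\<lambda>h. (J *v h) $ r)) (at p)" for r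
    proof -
      have "r = 1 \<or> r = 2 \<or> r = 3" by (rule exhaust_3)
      then show ?thesis
        using D1 D2 D3 by (elim disjE) (simp_all add: J_def matrix_vector_mult_def)
    qed
    then show ?thesis by (subst has_derivative_componentwise_within) (auto simp: Basis_vec_def inner_axis)
  qed
  then have "frechet_derivative (\<lambda>q. vector [period (u q), mass (u q), momentum (u q)] :: real^3) (at p) = (\<lambda>h. J *v h)"
    by (rule frechet_derivative_at[symmetric])
  then have "TMP_bracket u p = det J"
    by (simp add: TMP_bracket_def jacobian_def matrix_of_matrix_vector_mul)
  also have "\<dots> = det3 \<tau> I1 I2"
    by (simp add: J_def det_3 det3_eq R1_def R2_def algebra_simps)
  also have "\<dots> = - 1 / k0 p * det3 (\<lambda>i. U1 i (T p)) I1 I2"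
    using k0_pos[OF p] by (simp add: det3_eq \<tau>_def T_grad_def[OF p] field_simps)
  finally show ?thesis by (simp add: I1_def[abs_def] I2_def[abs_def])
qed

end

end

section \<open>Linking the wave family to the spectral analysis\<close>

lemma deriv_cnj_symmetric:
  assumes a: "a holomorphic_on UNIV" and s: "\<And>z. a (cnj z) = cnj (a z)"
  shows "deriv a (cnj z) = cnj (deriv a z)"
proof -
  have d: "(a has_field_derivative deriv a w) (at w)" for w
    using holomorphic_derivI[OF a, of w UNIV] by simp
  have "((cnj \<circ> a \<circ> cnj) has_field_derivative cnj (deriv a z)) (at (cnj z))"
    by (rule has_field_derivative_cnj_cnj) (simp add: d)
  moreover have "cnj \<circ> a \<circ> cnj = a" using s by (simp add: fun_eq_iff)
  ultimately show ?thesis by (simp add: DERIV_imp_deriv)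
qed

lemma trace_second_deriv:
  fixes M :: "complex \<Rightarrow> complex^3^3"
  assumes hol: "\<And>i j. (\<lambda>\<nu>. M \<nu> $ i $ j) holomorphic_on UNIV"
  shows "deriv (deriv (\<lambda>\<nu>. trace (M \<nu>))) \<mu> = trace (second_deriv_matrix M \<mu>)"
proof -
  define g where "g i \<nu> = M \<nu> $ i $ i" for i \<nu>
  have g: "g i holomorphic_on UNIV" for i unfolding g_def[abs_def] by (rule hol)
  have d1: "(g i has_field_derivative deriv (g i) \<nu>) (at \<nu>)" for i \<nu>
    using holomorphic_derivI[OF g[of i], of \<nu> UNIV] by simp
  have d2: "(deriv (g i) has_field_derivative deriv (deriv (g i)) \<nu>) (at \<nu>)" for i \<nu>
    by (rule holomorphic_derivI[OF holomorphic_deriv[OF g]]) auto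
  have "((\<lambda>\<nu>. trace (M \<nu>)) has_field_derivative deriv (g 1) \<nu> + deriv (g 2) \<nu> + deriv (g 3) \<nu>) (at \<nu>)" for \<nu>
    unfolding trace_def sum_3 g_def[symmetric] by (intro DERIV_add d1)
  then have "deriv (\<lambda>\<nu>. trace (M \<nu>)) = (\<lambda>\<nu>. deriv (g 1) \<nu> + deriv (g 2) \<nu> + deriv (g 3) \<nu>)"
    by (intro ext DERIV_imp_deriv)
  moreover have "((\<lambda>\<nu>. deriv (g 1) \<nu> + deriv (g 2) \<nu> + deriv (g 3) \<nu>) has_field_derivative
      deriv (deriv (g 1)) \<mu> + deriv (deriv (g 2)) \<mu> + deriv (deriv (g 3)) \<mu>) (at \<mu>)"
    by (intro DERIV_add d2)
  ultimately have "deriv (deriv (\<lambda>\<nu>. trace (M \<nu>))) \<mu> = deriv (deriv (g 1)) \<mu> + deriv (deriv (g 2)) \<mu> + deriv (deriv (g 3)) \<mu>"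
    by (simp add: DERIV_imp_deriv)
  then show ?thesis by (simp add: second_deriv_matrix_def trace_def sum_3 g_def[abs_def])
qed

context wave_parameters
begin

lemma wave_profile_at:
  assumes p: "p \<in> \<Omega>" and Phi: "fundamental_matrix f (p$3) (u p) \<Phi>"
  shows "wave_profile f f1 f2 (p$3) (p$1) (T p) (um p) (k0 p) (u p) (du p) \<Phi>"
proof
  show "p$3 > 0" using c_gt[OF p] by simp
  show "T p > 0" by (rule T_pos(1)[OF p])
  show "(f has_real_derivative f1 x) (at x)" "(f1 has_real_derivative f2 x) (at x)" for x by (rule f_deriv)+
  show "continuous_on UNIV f2" by (rule f2_cont)
  show "(u p has_real_derivative du p x) (at x)" for x by (rule u_deriv[OF p])
  show "(du p has_real_derivative (p$1 + (p$3 - 1) * u p x - f (u p x)) / p$3) (at x)" for x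
    using du_deriv[OF p, of x] by (simp add: acc_def)
  show "u p 0 = um p" "du p 0 = 0" by (rule u_0[OF p])+
  show "(p$1 + (p$3 - 1) * um p - f (um p)) / p$3 = k0 p" by (simp add: k0_def[OF p] acc_def)
  show "k0 p \<noteq> 0" using k0_pos[OF p] by simp
  show "u p (T p - x) = u p x" for x by (rule wave_shift(2)[OF p T_pos(2)[OF p]])
  show "\<Phi> 0 \<mu> = mat 1" for \<mu> using Phi by (simp add: fundamental_matrix_def)
  show "((\<lambda>y. \<Phi> y \<mu>) has_vector_derivative
      (system_matrix (p$3) (p$3 - 1 - f1 (u p x)) (du p x * f2 (u p x)) \<mu> ** \<Phi> x \<mu>)) (at x)" for \<mu> x
    using Phi unfolding fundamental_matrix_def spectral_matrix_def system_matrix_def by blast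
qed

text \<open>The variations are started with the gradient of the trough value, so one and the same
  triple serves both the limit of D(\<mu>, 1) / \<mu>^3 and the Jacobian; the opposite signs of the
  two formulas produce the limit -B.\<close>

lemma evans_symmetric_at:
  assumes p: "p \<in> \<Omega>" and Phi: "fundamental_matrix f (p$3) (u p) \<Phi>" and B: "TMP_bracket u p \<noteq> 0"
  shows "evans_symmetric (\<Phi> (T p)) (\<lambda>\<mu>. trace (\<Phi> (T p) \<mu>)) (T p / p$3)
     (Re (trace (second_deriv_matrix (\<Phi> (T p)) 0))) (TMP_bracket u p)"
proof -
  interpret W: wave_profile f f1 f2 "p$3" "p$1" "T p" "um p" "k0 p" "u p" "du p" \<Phi>
    by (rule wave_profile_at[OF p Phi])
  have w2: "W.w2 x = acc p (u p x)" for x by (simp add: W.w2_def acc_def)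
  have hol: "(\<lambda>\<nu>. \<Phi> (T p) \<nu> $ i $ j) holomorphic_on UNIV" for i j
    using T_pos(1)[OF p] by (intro W.Phi_holomorphic) simp
  have tr: "(\<lambda>\<mu>. trace (\<Phi> (T p) \<mu>)) holomorphic_on UNIV"
    unfolding trace_def by (intro holomorphic_intros hol)
  have sy: "trace (\<Phi> (T p) (cnj \<mu>)) = cnj (trace (\<Phi> (T p) \<mu>))" for \<mu>
    by (simp add: trace_def W.monodromy_cnj)
  obtain Ua Ua1 where Ua: "W.variational 1 0 (um_grad p 1) Ua Ua1" using W.variational_exists by blast
  obtain Ue Ue1 where Ue: "W.variational 0 0 (um_grad p 2) Ue Ue1" using W.variational_exists by blast
  obtain Uc Uc1 where Uc: "W.variational 0 1 (um_grad p 3) Uc Uc1" using W.variational_exists by blast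
  define U where "U i = (if i = (1::3) then Ua else if i = 2 then Ue else Uc)" for i
  define U1 where "U1 i = (if i = (1::3) then Ua1 else if i = 2 then Ue1 else Uc1)" for i
  have i3: "P 1 \<Longrightarrow> P 2 \<Longrightarrow> P 3 \<Longrightarrow> P i" for P and i :: 3 using exhaust_3[of i] by auto
  have V: "variation p U U1"
    unfolding variation_def[OF p]
  proof
    fix i :: 3
    show "U i 0 = um_grad p i \<and> U1 i 0 = 0 \<and>
     (\<forall>x\<ge>0. (U i has_real_derivative U1 i x) (at x) \<and>
       (U1 i has_real_derivative ((p$3 - 1 - f1 (u p x)) * U i x + of_bool (i = 1) + of_bool (i = 3) * (u p x - acc p (u p x))) / p$3) (at x))"
      using Ua Ue Uc by (rule_tac i3[of _ i]) (simp_all add: U_def U1_def W.variational_def W.q_def w2)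
  qed
  have de: "um_grad p 2 = - 1 / (p$3 * k0 p)" by (simp add: um_grad_def[OF p])
  have J1: "(\<lambda>j::3. if j = 1 then W.rv Ua1 else if j = 2 then W.rv Ue1 else W.rv Uc1) = (\<lambda>j. W.rv (U1 j))"
    by (simp add: fun_eq_iff U1_def)
  have J2: "(\<lambda>j::3. if j = 1 then W.ri h Ua else if j = 2 then W.ri h Ue else W.ri h Uc) = (\<lambda>j. W.ri h (U j))" for h
    by (simp add: fun_eq_iff U_def)
  have "1 / k0 p * det3 (\<lambda>j. W.rv (U1 j)) (\<lambda>j. W.ri (\<lambda>_. 1) (U j)) (\<lambda>j. W.ri (\<lambda>x. u p x - W.w2 x) (U j)) = - TMP_bracket u p"
    by (simp add: TMP_bracket_variation[OF p V] W.rv_def W.ri_def w2)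
  moreover note W.evans_cubic_coefficient[OF Ua Ue Uc de, unfolded J1 J2]
  ultimately have lim: "((\<lambda>\<mu>. evans (\<Phi> (T p)) \<mu> 1 / \<mu>^3) \<longlongrightarrow> - of_real (TMP_bracket u p)) (at 0)"
    by (simp only: of_real_minus)
  \<comment> \<open>Conjugation symmetry passes to derivatives, and 0 is its own conjugate, so the
    second derivative of the trace at 0 is real and equals its real part.\<close>
  have real: "deriv (deriv (\<lambda>\<mu>. trace (\<Phi> (T p) \<mu>))) 0 = of_real (Re (trace (second_deriv_matrix (\<Phi> (T p)) 0)))"
  proof -
    have "deriv (deriv (\<lambda>\<mu>. trace (\<Phi> (T p) \<mu>))) (cnj 0) = cnj (deriv (deriv (\<lambda>\<mu>. trace (\<Phi> (T p) \<mu>))) 0)"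
      by (intro deriv_cnj_symmetric holomorphic_deriv tr sy) auto
    then have "trace (second_deriv_matrix (\<Phi> (T p)) 0) \<in> \<real>"
      unfolding trace_second_deriv[OF hol] by (simp add: Reals_cnj_iff)
    then show ?thesis unfolding trace_second_deriv[OF hol] by (simp add: of_real_Re)
  qed
  show ?thesis
    by unfold_locales (rule W.evans_monodromy tr sy W.trace_monodromy_0 real lim B)+
qed

end

theorem theorem3:
  fixes f F :: "real \<Rightarrow> real"
    and \<Omega> :: "(real^3) set" and um up :: "real^3 \<Rightarrow> real" and u :: "real^3 \<Rightarrow> real \<Rightarrow> real"
    and a E c T B \<Delta> :: real and p :: "real^3"
    and \<Phi> :: "real \<Rightarrow> complex \<Rightarrow> complex^3^3" and M :: "complex \<Rightarrow> complex^3^3"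
  assumes "C2_real f"
    and "\<And>x. (F has_real_derivative f x) (at x)" and "F 0 = 0"
    and "wave_family f F \<Omega> um up u"
    and "p = vector [a, E, c]" and "p \<in> \<Omega>"
    and "fundamental_matrix f c (u p) \<Phi>"
    and "T = period (u p)"
    and "M = \<Phi> T"
    and "B = TMP_bracket u p"
    and "\<Delta> = modulational_discriminant M T c B"
    and "B \<noteq> 0"
  shows "(\<Delta> > 0 \<longrightarrow>
           (\<exists>U. open U \<and> 0 \<in> U \<and>
             evans_spectrum M \<inter> U = imaginary_axis \<inter> U \<and>
             (\<forall>\<mu>\<in>imaginary_axis \<inter> U. spec_multiplicity M \<mu> = 3))) \<and>
         (\<Delta> < 0 \<longrightarrow>
           (\<exists>U \<Gamma>1 \<Gamma>2 L1 L2. open U \<and> 0 \<in> U \<and>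
             curve_tangent_at_origin \<Gamma>1 L1 \<and> curve_tangent_at_origin \<Gamma>2 L2 \<and>
             \<Gamma>1 \<inter> imaginary_axis = {0} \<and> \<Gamma>2 \<inter> imaginary_axis = {0} \<and>
             evans_spectrum M \<inter> U = (imaginary_axis \<union> \<Gamma>1 \<union> \<Gamma>2) \<inter> U \<and>
             (\<forall>\<mu>\<in>imaginary_axis \<inter> U - {0}. spec_multiplicity M \<mu> = 1) \<and>
             (\<forall>\<mu>\<in>U - imaginary_axis.
                spec_multiplicity M \<mu> = of_bool (\<mu> \<in> \<Gamma>1) + of_bool (\<mu> \<in> \<Gamma>2))))"
proof -
  interpret P: wave_parameters f F \<Omega> um up u
    by unfold_locales (fact assms)+
  have c: "p $ 3 = c" using assms(5) by simp
  have T: "P.T p = T" by (simp add: P.T_def[OF \<open>p \<in> \<Omega>\<close>] \<open>T = period (u p)\<close>)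
  interpret S: evans_symmetric M "\<lambda>\<mu>. trace (M \<mu>)" "T / c" "Re (trace (second_deriv_matrix M 0))" B
    using P.evans_symmetric_at[OF \<open>p \<in> \<Omega>\<close>, of \<Phi>] assms unfolding c T by simp
  have "\<Delta> = S.disc"
    unfolding \<open>\<Delta> = modulational_discriminant M T c B\<close> modulational_discriminant_def S.disc_def Let_def ..
  then show ?thesis using S.spectrum_triple S.spectrum_curves by simp
qed

end
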